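(* Let $\mathcal{P}$ be a quadratic Koszul operad such that all $\mathcal{P}_{(d)}(n)$ and $\mathcal{P}^{¡}_{(d)}(n)$ are finite dimensional over $k$. Then the Poincaré series satisfy $$f_{\mathcal{P}^{¡}}\big(f_{\mathcal{P}}(x,y),-y\big)=x\qquad\text{and}\qquad f_{\mathcal{P}}\big(f_{\mathcal{P}^{¡}}(x,y),-y\big)=x .$$
   Context: $k$ is a field of characteristic $0$. An $\mathbb{S}$-module is a family $(\mathcal{P}(n))_{n\ge1}$ of right $k[\mathbb{S}_n]$-modules; operads are monoids for the composition product $(\mathcal{P}\circ\mathcal{Q})(n)=\bigoplus_{j\ge 1,\ i_1+\cdots+i_j=n}\mathcal{P}(j)\otimes_{\mathbb{S}_j}\big(\mathcal{Q}(i_1)\otimes\cdots\otimes\mathcal{Q}(i_j)\big)$ (induced representations understood), with unit $I=(k,0,0,\dots)$. The operads considered are not differential graded (homological degree $0$, zero differential). The free operad $\mathcal{F}(V)$ is the sum over rooted trees with vertices decorated by $V$, and $\mathcal{F}_{(d)}(V)$ is its part with $d$ vertices. A quadratic operad is $\mathcal{P}=\mathcal{F}(V)/(R)$ with $(R)$ the ideal generated by $R\subset\mathcal{F}_{(2)}(V)$; it is not assumed binary. It is weight-graded by the number $d$ of vertices: $\mathcal{P}=\bigoplus_d\mathcal{P}_{(d)}$, $\mathcal{P}_{(0)}=I$; put $\overline{\mathcal{P}}=\bigoplus_{d\ge1}\mathcal{P}_{(d)}$. The bar construction $\bar{\mathcal{B}}(\mathcal{P})$ is the cofree cooperad $\mathcal{F}^c(\Sigma\overline{\mathcal{P}})$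 on the suspension of $\overline{\mathcal{P}}$ (trees decorated by $\Sigma\overline{\mathcal{P}}$), with differential the coderivation $d_\theta$ contracting internal edges by means of the composition of $\mathcal{P}$ (with Koszul signs). With $\bar{\mathcal{B}}_{(s)}(\mathcal{P})^{(d)}$ the part with $s$ vertices and total weight $d$, the Koszul dual cooperad is $\mathcal{P}^{¡}_{(d)}=\ker\big(d_\theta:\bar{\mathcal{B}}_{(d)}(\mathcal{P})^{(d)}\to\bar{\mathcal{B}}_{(d-1)}(\mathcal{P})^{(d)}\big)$, and $\mathcal{P}$ is Koszul if the inclusion $\mathcal{P}^{¡}\hookrightarrow\bar{\mathcal{B}}(\mathcal{P})$ is a quasi-isomorphism. The Poincaré series of a weight-graded $\mathbb{S}$-module $\mathcal{P}$ with all $\mathcal{P}_{(d)}(n)$ finite dimensional is the formal power series $$f_{\mathcal{P}}(x,y)=\sum_{d\ge0,\,n\ge1}\frac{\dim\mathcal{P}_{(d)}(n)}{n!}\,y^dx^n .$$ *)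

theory Defs
  imports
    "HOL-Library.Poly_Mapping"
    "HOL-Combinatorics.Permutations"
    "HOL-Computational_Algebra.Formal_Power_Series"
begin

section \<open>Vector spaces, quotients, free vector spaces\<close>

text \<open>
  A quotient vector space \<open>A / (A \<inter> N)\<close> is given by the subspace \<open>A\<close> of representatives and the
  subspace \<open>N\<close> of null vectors; \<open>A\<close> need not contain \<open>N\<close>, so this is also the image of \<open>A\<close> in
  the quotient by \<open>N\<close>.
\<close>

definition fin_dim_mod ::
    "('k::field \<Rightarrow> 'a::ab_group_add \<Rightarrow> 'a) \<Rightarrow> 'a set \<Rightarrow> 'a set \<Rightarrow> bool" where
  "fin_dim_mod s N A \<longleftrightarrow> (\<exists>S. finite S \<and> S \<subseteq> A \<and> A \<subseteq> module.span s (S \<union> N))"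

definition dim_mod ::
    "('k::field \<Rightarrow> 'a::ab_group_add \<Rightarrow> 'a) \<Rightarrow> 'a set \<Rightarrow> 'a set \<Rightarrow> nat" where
  "dim_mod s N A =
     (LEAST m. \<exists>S. finite S \<and> card S = m \<and> S \<subseteq> A \<and> A \<subseteq> module.span s (S \<union> N))"

abbreviation fin_dim :: "('k::field \<Rightarrow> 'a::ab_group_add \<Rightarrow> 'a) \<Rightarrow> 'a set \<Rightarrow> bool" where
  "fin_dim s A \<equiv> fin_dim_mod s {0} A"

text \<open>The free vector space on \<open>'t\<close> is \<open>'t \<Rightarrow>\<^sub>0 'k\<close>.\<close>

definition fscale :: "'k::field \<Rightarrow> ('t \<Rightarrow>\<^sub>0 'k) \<Rightarrow> ('t \<Rightarrow>\<^sub>0 'k)" where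
  "fscale c x = Poly_Mapping.map ((*) c) x"

abbreviation basis_vec :: "'t \<Rightarrow> ('t \<Rightarrow>\<^sub>0 'k::field)" where
  "basis_vec t \<equiv> Poly_Mapping.single t 1"

lemma lookup_fscale [simp]: "Poly_Mapping.lookup (fscale c x) t = c * Poly_Mapping.lookup x t"
  unfolding fscale_def by transfer (simp add: when_def)

lemma vector_space_fscale: "vector_space (fscale :: 'k::field \<Rightarrow> ('t \<Rightarrow>\<^sub>0 'k) \<Rightarrow> _)"
  by unfold_locales (auto intro!: poly_mapping_eqI simp: Poly_Mapping.lookup_add algebra_simps)

text \<open>Linear and multilinear extension of functions defined on basis elements.\<close>

definition lin :: "('s \<Rightarrow> ('t \<Rightarrow>\<^sub>0 'k::field)) \<Rightarrow> ('s \<Rightarrow>\<^sub>0 'k) \<Rightarrow> ('t \<Rightarrow>\<^sub>0 'k)" where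
  "lin f x = (\<Sum>s\<in>Poly_Mapping.keys x. fscale (Poly_Mapping.lookup x s) (f s))"

primrec multilin ::
    "('s list \<Rightarrow> ('t \<Rightarrow>\<^sub>0 'k::field)) \<Rightarrow> ('s \<Rightarrow>\<^sub>0 'k) list \<Rightarrow> ('t \<Rightarrow>\<^sub>0 'k)" where
  "multilin f [] = f []"
| "multilin f (x # xs) = lin (\<lambda>s. multilin (\<lambda>ss. f (s # ss)) xs) x"


section \<open>\<open>\<S>\<close>-modules and operads\<close>

text \<open>
  The component of arity \<open>n\<close> is \<open>car n\<close> for \<open>n \<ge> 1\<close> (\<open>car 0\<close> is never used), and \<open>act n x \<sigma>\<close> is
  \<open>x \<cdot> \<sigma>\<close>. Inputs are numbered \<open>0, \<dots>, n - 1\<close>.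
\<close>

record ('k, 'a) smod =
  scl :: "'k \<Rightarrow> 'a \<Rightarrow> 'a"
  car :: "nat \<Rightarrow> 'a set"
  act :: "nat \<Rightarrow> 'a \<Rightarrow> (nat \<Rightarrow> nat) \<Rightarrow> 'a"

locale smodule =
  fixes M :: "('k::field, 'a::ab_group_add, 'z) smod_scheme"
  assumes vector_space: "vector_space (scl M)"
    and subspace_car: "1 \<le> n \<Longrightarrow> module.subspace (scl M) (car M n)"
    and act_closed: "1 \<le> n \<Longrightarrow> x \<in> car M n \<Longrightarrow> \<sigma> permutes {..<n} \<Longrightarrow> act M n x \<sigma> \<in> car M n"
    and act_linear: "1 \<le> n \<Longrightarrow> x \<in> car M n \<Longrightarrow> y \<in> car M n \<Longrightarrow> \<sigma> permutes {..<n} \<Longrightarrow>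
          act M n (scl M c x + y) \<sigma> = scl M c (act M n x \<sigma>) + act M n y \<sigma>"
    and act_id: "1 \<le> n \<Longrightarrow> x \<in> car M n \<Longrightarrow> act M n x id = x"
    and act_comp: "1 \<le> n \<Longrightarrow> x \<in> car M n \<Longrightarrow> \<sigma> permutes {..<n} \<Longrightarrow> \<tau> permutes {..<n} \<Longrightarrow>
          act M n x (\<sigma> \<circ> \<tau>) = act M n (act M n x \<sigma>) \<tau>"

text \<open>
  A monoid structure \<open>P \<circ> P \<rightarrow> P\<close>, \<open>I \<rightarrow> P\<close> amounts to a unit \<open>one\<close> in arity 1 and equivariant maps
  \<open>P(j) \<otimes> P(i\<^sub>0) \<otimes> \<dots> \<otimes> P(i\<^sub>j\<^sub>-\<^sub>1) \<rightarrow> P(i\<^sub>0 + \<dots> + i\<^sub>j\<^sub>-\<^sub>1)\<close>; here \<open>cmp p is qs\<close> is the value at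
  \<open>p, qs ! 0, \<dots>, qs ! (j - 1)\<close>, where \<open>is\<close> is the list of arities of \<open>qs\<close>.
\<close>

record ('k, 'a) operad_data = "('k, 'a) smod" +
  one :: 'a
  cmp :: "'a \<Rightarrow> nat list \<Rightarrow> 'a list \<Rightarrow> 'a"

definition inputs :: "('k, 'a, 'z) smod_scheme \<Rightarrow> nat list \<Rightarrow> 'a list \<Rightarrow> bool" where
  "inputs M ns qs \<longleftrightarrow> list_all2 (\<lambda>n q. 1 \<le> n \<and> q \<in> car M n) ns qs"

text \<open>Position at which the \<open>a\<close>-th block starts, the blocks having lengths \<open>ns\<close>.\<close>

definition offset :: "nat list \<Rightarrow> nat \<Rightarrow> nat" where
  "offset ns a = sum_list (take a ns)"

text \<open>
  Conventions for equivariance: thinking of \<open>p\<close> as an operation \<open>p(x\<^sub>0, \<dots>, x\<^sub>n\<^sub>-\<^sub>1)\<close>, the operation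
  \<open>p \<cdot> \<sigma>\<close> is \<open>p(y\<^sub>0, \<dots>, y\<^sub>n\<^sub>-\<^sub>1)\<close> with \<open>y\<^sub>i = x\<^sub>j\<close>, \<open>j = \<sigma>\<^sup>-\<^sup>1(i)\<close>. In \<open>cmp_act_outer\<close>,
  \<open>\<beta>\<close> is the permutation of blocks induced by \<open>\<sigma>\<close>; in \<open>cmp_act_inner\<close> it is the block sum of the
  \<open>\<tau> a\<close>.
\<close>

locale operad = smodule P
  for P :: "('k::field, 'a::ab_group_add, 'z) operad_data_scheme" +
  assumes one_closed: "one P \<in> car P 1"
    and cmp_closed: "ns \<noteq> [] \<Longrightarrow> p \<in> car P (length ns) \<Longrightarrow> inputs P ns qs \<Longrightarrow>
          cmp P p ns qs \<in> car P (sum_list ns)"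
    and cmp_linear_outer: "ns \<noteq> [] \<Longrightarrow> p \<in> car P (length ns) \<Longrightarrow> p' \<in> car P (length ns) \<Longrightarrow>
          inputs P ns qs \<Longrightarrow>
          cmp P (scl P c p + p') ns qs = scl P c (cmp P p ns qs) + cmp P p' ns qs"
    and cmp_linear_inner: "p \<in> car P (length ns) \<Longrightarrow> inputs P ns qs \<Longrightarrow> a < length ns \<Longrightarrow>
          q \<in> car P (ns ! a) \<Longrightarrow> q' \<in> car P (ns ! a) \<Longrightarrow>
          cmp P p ns (qs[a := scl P c q + q']) =
            scl P c (cmp P p ns (qs[a := q])) + cmp P p ns (qs[a := q'])"
    and unit_outer: "1 \<le> n \<Longrightarrow> q \<in> car P n \<Longrightarrow> cmp P (one P) [n] [q] = q"
    and unit_inner: "1 \<le> n \<Longrightarrow> p \<in> car P n \<Longrightarrow>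
          cmp P p (replicate n 1) (replicate n (one P)) = p"
    and assoc: "ns \<noteq> [] \<Longrightarrow> p \<in> car P (length ns) \<Longrightarrow> inputs P ns qs \<Longrightarrow>
          length mss = length ns \<Longrightarrow> length rss = length ns \<Longrightarrow>
          (\<And>a. a < length ns \<Longrightarrow> length (mss ! a) = ns ! a \<and> inputs P (mss ! a) (rss ! a)) \<Longrightarrow>
          cmp P (cmp P p ns qs) (concat mss) (concat rss) =
            cmp P p (map sum_list mss)
              (map (\<lambda>a. cmp P (qs ! a) (mss ! a) (rss ! a)) [0..<length ns])"
    and cmp_act_outer: "ns \<noteq> [] \<Longrightarrow> p \<in> car P (length ns) \<Longrightarrow> inputs P ns qs \<Longrightarrow>
          \<sigma> permutes {..<length ns} \<Longrightarrow> ns' = permute_list (inv \<sigma>) ns \<Longrightarrow>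
          \<beta> permutes {..<sum_list ns} \<Longrightarrow>
          (\<And>a b. a < length ns \<Longrightarrow> b < ns ! a \<Longrightarrow>
             \<beta> (offset ns a + b) = offset ns' (\<sigma> a) + b) \<Longrightarrow>
          cmp P (act P (length ns) p \<sigma>) ns qs =
            act P (sum_list ns) (cmp P p ns' (permute_list (inv \<sigma>) qs)) \<beta>"
    and cmp_act_inner: "ns \<noteq> [] \<Longrightarrow> p \<in> car P (length ns) \<Longrightarrow> inputs P ns qs \<Longrightarrow>
          (\<And>a. a < length ns \<Longrightarrow> \<tau> a permutes {..<ns ! a}) \<Longrightarrow>
          \<beta> permutes {..<sum_list ns} \<Longrightarrow>
          (\<And>a b. a < length ns \<Longrightarrow> b < ns ! a \<Longrightarrow>
             \<beta> (offset ns a + b) = offset ns a + \<tau> a b) \<Longrightarrow>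
          cmp P p ns (map (\<lambda>a. act P (ns ! a) (qs ! a) (\<tau> a)) [0..<length ns]) =
            act P (sum_list ns) (cmp P p ns qs) \<beta>"

text \<open>The operadic ideal generated by \<open>G\<close>.\<close>

inductive operad_ideal ::
    "('k::field, 'a::ab_group_add, 'z) operad_data_scheme \<Rightarrow> (nat \<Rightarrow> 'a set) \<Rightarrow> nat \<Rightarrow> 'a \<Rightarrow> bool"
  for A :: "('k, 'a, 'z) operad_data_scheme" and G :: "nat \<Rightarrow> 'a set" where
  gen: "1 \<le> n \<Longrightarrow> x \<in> G n \<Longrightarrow> operad_ideal A G n x"
| zero: "1 \<le> n \<Longrightarrow> operad_ideal A G n 0"
| lin: "operad_ideal A G n x \<Longrightarrow> operad_ideal A G n y \<Longrightarrow> operad_ideal A G n (scl A c x + y)"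
| act: "operad_ideal A G n x \<Longrightarrow> \<sigma> permutes {..<n} \<Longrightarrow> operad_ideal A G n (act A n x \<sigma>)"
| outer: "operad_ideal A G (length ns) x \<Longrightarrow> inputs A ns qs \<Longrightarrow>
    operad_ideal A G (sum_list ns) (cmp A x ns qs)"
| inner: "p \<in> car A (length ns) \<Longrightarrow> inputs A ns qs \<Longrightarrow> a < length ns \<Longrightarrow>
    operad_ideal A G (ns ! a) (qs ! a) \<Longrightarrow> operad_ideal A G (sum_list ns) (cmp A p ns qs)"


section \<open>Decorated trees\<close>

text \<open>
  \<open>Node a ts\<close> is a root vertex decorated by \<open>a\<close> whose incoming edges are numbered, the \<open>i\<close>-th one
  carrying \<open>ts ! i\<close>. The choice of the numbering is divided out by the relation \<open>equiv\<close> below.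
\<close>

datatype 'a tree = Leaf nat | Node 'a "'a tree list"

primrec leaves :: "'a tree \<Rightarrow> nat list" where
  "leaves (Leaf l) = [l]"
| "leaves (Node a ts) = concat (map leaves ts)"

primrec vertices :: "'a tree \<Rightarrow> nat" where
  "vertices (Leaf l) = 0"
| "vertices (Node a ts) = Suc (sum_list (map vertices ts))"

inductive wf_tree :: "('k, 'a, 'z) smod_scheme \<Rightarrow> 'a tree \<Rightarrow> bool"
  for M :: "('k, 'a, 'z) smod_scheme" where
  "wf_tree M (Leaf l)"
| "ts \<noteq> [] \<Longrightarrow> a \<in> car M (length ts) \<Longrightarrow> \<forall>t\<in>set ts. wf_tree M t \<Longrightarrow> wf_tree M (Node a ts)"

definition trees :: "('k, 'a, 'z) smod_scheme \<Rightarrow> nat \<Rightarrow> 'a tree set" where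
  "trees M n = {t. wf_tree M t \<and> mset (leaves t) = mset [0..<n]}"

text \<open>
  Koszul sign for permuting the trees \<open>ts\<close>, moving position \<open>a\<close> to position \<open>\<sigma> a\<close>, when every
  decoration has homological degree \<open>e\<close>.
\<close>

definition koszul_sign :: "nat \<Rightarrow> (nat \<Rightarrow> nat) \<Rightarrow> 'a tree list \<Rightarrow> 'k::field" where
  "koszul_sign e \<sigma> ts =
     (\<Prod>(a, b)\<in>{(a, b). a < b \<and> b < length ts \<and> \<sigma> b < \<sigma> a}.
        (-1) ^ (e * vertices (ts ! a) * (e * vertices (ts ! b))))"

text \<open>
  The space of trees decorated by the \<open>\<S>\<close>-module \<open>M\<close> placed in homological degree \<open>e\<close> is the free
  vector space on the decorated trees modulo these relations: multilinearity in the decorations, and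
  equivariance at each vertex. A tree stands for the tensor of its decorations in
  depth-first (root first) order of the vertices.
\<close>

inductive_set tree_rel ::
    "nat \<Rightarrow> ('k::field, 'a::ab_group_add, 'z) smod_scheme \<Rightarrow> ('a tree \<Rightarrow>\<^sub>0 'k) set"
  for e :: nat and M :: "('k, 'a, 'z) smod_scheme" where
  linear: "wf_tree M (Node a ts) \<Longrightarrow> wf_tree M (Node b ts) \<Longrightarrow>
    basis_vec (Node (scl M c a + b) ts) - fscale c (basis_vec (Node a ts)) - basis_vec (Node b ts)
      \<in> tree_rel e M"
| equiv: "wf_tree M (Node a ts) \<Longrightarrow> \<sigma> permutes {..<length ts} \<Longrightarrow>
    basis_vec (Node (act M (length ts) a \<sigma>) ts)
      - fscale (koszul_sign e \<sigma> ts) (basis_vec (Node a (permute_list (inv \<sigma>) ts)))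
      \<in> tree_rel e M"
| in_context: "r \<in> tree_rel e M \<Longrightarrow> wf_tree M (Node a (us @ Leaf l # vs)) \<Longrightarrow>
    lin (\<lambda>t. basis_vec (Node a (us @ t # vs))) r \<in> tree_rel e M"

definition tree_null ::
    "nat \<Rightarrow> ('k::field, 'a::ab_group_add, 'z) smod_scheme \<Rightarrow> ('a tree \<Rightarrow>\<^sub>0 'k) set" where
  "tree_null e M = module.span fscale (tree_rel e M)"


section \<open>Free and quadratic operads\<close>

primrec tree_subst :: "(nat \<Rightarrow> 'a tree) \<Rightarrow> 'a tree \<Rightarrow> 'a tree" where
  "tree_subst f (Leaf l) = f l"
| "tree_subst f (Node a ts) = Node a (map (tree_subst f) ts)"

definition relabel :: "(nat \<Rightarrow> nat) \<Rightarrow> 'a tree \<Rightarrow> 'a tree" where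
  "relabel g = tree_subst (\<lambda>l. Leaf (g l))"

definition graft :: "'a tree \<Rightarrow> nat list \<Rightarrow> 'a tree list \<Rightarrow> 'a tree" where
  "graft t ns ts = tree_subst (\<lambda>a. relabel (\<lambda>l. offset ns a + l) (ts ! a)) t"

text \<open>
  The free operad, on the level of representatives: \<open>\<F>(V)(n)\<close> is \<open>car (free_operad V) n\<close> modulo
  \<open>tree_null 0 V\<close>.
\<close>

definition free_operad ::
    "('k::field, 'a::ab_group_add, 'z) smod_scheme \<Rightarrow> ('k, 'a tree \<Rightarrow>\<^sub>0 'k) operad_data" where
  "free_operad V =
     \<lparr> scl = fscale,
       car = (\<lambda>n. module.span fscale (basis_vec ` trees V n)),
       act = (\<lambda>n x \<sigma>. lin (\<lambda>t. basis_vec (relabel (inv \<sigma>) t)) x),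
       one = basis_vec (Leaf 0),
       cmp = (\<lambda>x ns ys. lin (\<lambda>t. multilin (\<lambda>ts. basis_vec (graft t ns ts)) ys) x) \<rparr>"

definition free_operad_weight ::
    "('k::field, 'a::ab_group_add, 'z) smod_scheme \<Rightarrow> nat \<Rightarrow> nat \<Rightarrow> ('a tree \<Rightarrow>\<^sub>0 'k) set" where
  "free_operad_weight V d n = module.span fscale (basis_vec ` {t \<in> trees V n. vertices t = d})"

text \<open>Representatives of elements of the ideal \<open>(R)\<close> of \<open>\<F>(V)\<close>.\<close>

definition relation_ideal ::
    "('k::field, 'a::ab_group_add, 'z) smod_scheme \<Rightarrow> (nat \<Rightarrow> ('a tree \<Rightarrow>\<^sub>0 'k) set) \<Rightarrow> nat \<Rightarrow>
       ('a tree \<Rightarrow>\<^sub>0 'k) set" where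
  "relation_ideal V R n =
     {x. operad_ideal (free_operad V) (\<lambda>m. (car (free_operad V) m \<inter> tree_null 0 V) \<union> R m) n x}"

text \<open>
  \<open>P = \<F>(V)/(R)\<close>: the projection \<open>\<pi>\<close> is a morphism of operads from \<open>\<F>(V)\<close> onto \<open>P\<close> with
  kernel \<open>(R)\<close>.
\<close>

locale quadratic_operad = operad P
  for P :: "('k::field, 'p::ab_group_add) operad_data" +
  fixes V :: "('k, 'v::ab_group_add) smod"
    and R :: "nat \<Rightarrow> ('v tree \<Rightarrow>\<^sub>0 'k) set"
    and \<pi> :: "('v tree \<Rightarrow>\<^sub>0 'k) \<Rightarrow> 'p"
  assumes smodule_V: "smodule V"
    and relations: "1 \<le> n \<Longrightarrow> R n \<subseteq> free_operad_weight V 2 n"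
    and proj_linear: "1 \<le> n \<Longrightarrow> x \<in> car (free_operad V) n \<Longrightarrow> y \<in> car (free_operad V) n \<Longrightarrow>
          \<pi> (fscale c x + y) = scl P c (\<pi> x) + \<pi> y"
    and proj_onto: "1 \<le> n \<Longrightarrow> \<pi> ` car (free_operad V) n = car P n"
    and proj_kernel: "1 \<le> n \<Longrightarrow> {x \<in> car (free_operad V) n. \<pi> x = 0} = relation_ideal V R n"
    and proj_act: "1 \<le> n \<Longrightarrow> x \<in> car (free_operad V) n \<Longrightarrow> \<sigma> permutes {..<n} \<Longrightarrow>
          \<pi> (act (free_operad V) n x \<sigma>) = act P n (\<pi> x) \<sigma>"
    and proj_one: "\<pi> (one (free_operad V)) = one P"
    and proj_cmp: "ns \<noteq> [] \<Longrightarrow> x \<in> car (free_operad V) (length ns) \<Longrightarrow>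
          inputs (free_operad V) ns ys \<Longrightarrow>
          \<pi> (cmp (free_operad V) x ns ys) = cmp P (\<pi> x) ns (map \<pi> ys)"

definition weight_part ::
    "('k::field, 'v::ab_group_add) smod \<Rightarrow> (('v tree \<Rightarrow>\<^sub>0 'k) \<Rightarrow> 'p) \<Rightarrow> nat \<Rightarrow> nat \<Rightarrow> 'p set" where
  "weight_part V \<pi> d n = \<pi> ` free_operad_weight V d n"


section \<open>Bar construction, Koszul dual cooperad, Koszul operads\<close>

text \<open>In this section \<open>W d n\<close> is the part of weight \<open>d\<close> and arity \<open>n\<close> of the operad \<open>P\<close>.\<close>

definition aug_part ::
    "('k::field, 'p::ab_group_add) operad_data \<Rightarrow> (nat \<Rightarrow> nat \<Rightarrow> 'p set) \<Rightarrow> ('k, 'p) smod" where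
  "aug_part P W =
     \<lparr> scl = scl P, car = (\<lambda>n. module.span (scl P) (\<Union>d\<in>{1..}. W d n)), act = act P \<rparr>"

inductive tree_weight :: "(nat \<Rightarrow> nat \<Rightarrow> 'p set) \<Rightarrow> 'p tree \<Rightarrow> nat \<Rightarrow> bool"
  for W :: "nat \<Rightarrow> nat \<Rightarrow> 'p set" where
  "tree_weight W (Leaf l) 0"
| "1 \<le> d \<Longrightarrow> p \<in> W d (length ts) \<Longrightarrow> list_all2 (tree_weight W) ts ds \<Longrightarrow>
     tree_weight W (Node p ts) (d + sum_list ds)"

text \<open>
  The part of the bar construction with \<open>s\<close> vertices, total weight \<open>d\<close> and arity \<open>n\<close> is
  \<open>bar_part P W s d n\<close> modulo \<open>bar_null P W\<close>. The decorations are in degree 1 because of the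
  suspension.
\<close>

definition bar_null ::
    "('k::field, 'p::ab_group_add) operad_data \<Rightarrow> (nat \<Rightarrow> nat \<Rightarrow> 'p set) \<Rightarrow> ('p tree \<Rightarrow>\<^sub>0 'k) set"
  where "bar_null P W = tree_null 1 (aug_part P W)"

definition bar_part ::
    "('k::field, 'p::ab_group_add) operad_data \<Rightarrow> (nat \<Rightarrow> nat \<Rightarrow> 'p set) \<Rightarrow> nat \<Rightarrow> nat \<Rightarrow> nat \<Rightarrow>
       ('p tree \<Rightarrow>\<^sub>0 'k) set" where
  "bar_part P W s d n = module.span fscale
     (basis_vec ` {t \<in> trees (aug_part P W) n. vertices t = s \<and> tree_weight W t d})"

text \<open>\<open>partial_cmp P p m i q n\<close> is \<open>p \<circ>\<^sub>i q\<close>, where \<open>p\<close> has arity \<open>m\<close> and \<open>q\<close> has arity \<open>n\<close>.\<close>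

definition partial_cmp ::
    "('k, 'p, 'z) operad_data_scheme \<Rightarrow> 'p \<Rightarrow> nat \<Rightarrow> nat \<Rightarrow> 'p \<Rightarrow> nat \<Rightarrow> 'p" where
  "partial_cmp P p m i q n = cmp P p ((replicate m 1)[i := n]) ((replicate m (one P))[i := q])"

text \<open>
  Contraction of all internal edges. With \<open>\<theta>(\<Sigma>p \<otimes> \<Sigma>q) = \<Sigma>(p \<circ>\<^sub>i q)\<close> of degree \<open>-1\<close>,
  contracting the edge from the root to its \<open>i\<close>-th child gives the sign of moving the root of
  \<open>ts ! i\<close> next to the root of the tree, past the vertices of \<open>ts ! 0, \<dots>, ts ! (i - 1)\<close>;
  contracting an edge inside \<open>ts ! i\<close> gives the sign of moving \<open>\<theta>\<close> past those vertices and the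
  root.
\<close>

function bar_diff_tree ::
    "('k::field, 'p::ab_group_add, 'z) operad_data_scheme \<Rightarrow> 'p tree \<Rightarrow> ('p tree \<Rightarrow>\<^sub>0 'k)" where
  "bar_diff_tree P (Leaf l) = 0"
| "bar_diff_tree P (Node p ts) =
     (\<Sum>i<length ts. fscale ((-1) ^ sum_list (map vertices (take i ts)))
        (case ts ! i of
           Leaf l \<Rightarrow> 0
         | Node q us \<Rightarrow>
             basis_vec (Node (partial_cmp P p (length ts) i q (length us))
               (take i ts @ us @ drop (Suc i) ts)))) +
     (\<Sum>i<length ts. fscale ((-1) ^ Suc (sum_list (map vertices (take i ts))))
        (lin (\<lambda>t. basis_vec (Node p (ts[i := t]))) (bar_diff_tree P (ts ! i))))"
  by pat_completeness auto
termination
  by (relation "measure (size \<circ> snd)") (auto simp: less_Suc_eq_le intro!: size_list_estimation'[OF nth_mem])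

definition bar_diff ::
    "('k::field, 'p::ab_group_add, 'z) operad_data_scheme \<Rightarrow> ('p tree \<Rightarrow>\<^sub>0 'k) \<Rightarrow> ('p tree \<Rightarrow>\<^sub>0 'k)"
  where "bar_diff P = lin (bar_diff_tree P)"

text \<open>The Koszul dual cooperad, modulo \<open>bar_null P W\<close>.\<close>

definition koszul_dual ::
    "('k::field, 'p::ab_group_add) operad_data \<Rightarrow> (nat \<Rightarrow> nat \<Rightarrow> 'p set) \<Rightarrow> nat \<Rightarrow> nat \<Rightarrow>
       ('p tree \<Rightarrow>\<^sub>0 'k) set" where
  "koszul_dual P W d n = {x \<in> bar_part P W d d n. bar_diff P x \<in> bar_null P W}"

text \<open>
  \<open>C\<close> is a chain complex with differential \<open>\<delta>\<close> and \<open>D\<close> a subcomplex of it with zero differential,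
  all modulo \<open>N\<close>. The two clauses are surjectivity and injectivity of the map induced on homology
  by the inclusion.
\<close>

definition inclusion_quasi_iso ::
    "'a::ab_group_add set \<Rightarrow> ('a \<Rightarrow> 'a) \<Rightarrow> (nat \<Rightarrow> 'a set) \<Rightarrow> (nat \<Rightarrow> 'a set) \<Rightarrow> bool" where
  "inclusion_quasi_iso N \<delta> D C \<longleftrightarrow>
     (\<forall>s. \<forall>z\<in>C s. \<delta> z \<in> N \<longrightarrow> (\<exists>x\<in>D s. \<exists>y\<in>C (Suc s). z - x - \<delta> y \<in> N)) \<and>
     (\<forall>s. \<forall>x\<in>D s. (\<exists>y\<in>C (Suc s). x - \<delta> y \<in> N) \<longrightarrow> x \<in> N)"

text \<open>
  The inclusion of the Koszul dual preserves arity, weight and homological degree; its part of weight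
  \<open>d\<close> is concentrated in degree \<open>d\<close>.
\<close>

definition koszul ::
    "('k::field, 'p::ab_group_add) operad_data \<Rightarrow> (nat \<Rightarrow> nat \<Rightarrow> 'p set) \<Rightarrow> bool" where
  "koszul P W \<longleftrightarrow>
     (\<forall>d n. 1 \<le> n \<longrightarrow>
        inclusion_quasi_iso (bar_null P W) (bar_diff P)
          (\<lambda>s. if s = d then koszul_dual P W d n else {0})
          (\<lambda>s. bar_part P W s d n))"


section \<open>Poincare series\<close>

text \<open>
  A series in \<open>x, y\<close> is a power series in \<open>x\<close> whose coefficients are power series in \<open>y\<close>;
  \<open>D d n\<close> is the dimension in weight \<open>d\<close> and arity \<open>n\<close>. Then \<open>F oo G\<close> is \<open>F(G(x, y), y)\<close>,
  for \<open>G\<close> with \<open>G(0, y) = 0\<close>.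
\<close>

definition poincare_series :: "(nat \<Rightarrow> nat \<Rightarrow> nat) \<Rightarrow> rat fps fps" where
  "poincare_series D =
     Abs_fps (\<lambda>n. if n = 0 then 0 else Abs_fps (\<lambda>d. of_nat (D d n) / fact n))"

text \<open>\<open>F(x, -y)\<close>\<close>

definition negate_y :: "rat fps fps \<Rightarrow> rat fps fps" where
  "negate_y F = Abs_fps (\<lambda>n. fps_nth F n oo (- fps_X))"

definition poincare_operad ::
    "('k::field, 'p::ab_group_add) operad_data \<Rightarrow> (nat \<Rightarrow> nat \<Rightarrow> 'p set) \<Rightarrow> rat fps fps" where
  "poincare_operad P W = poincare_series (\<lambda>d n. vector_space.dim (scl P) (W d n))"

definition poincare_koszul_dual ::
    "('k::field, 'p::ab_group_add) operad_data \<Rightarrow> (nat \<Rightarrow> nat \<Rightarrow> 'p set) \<Rightarrow> rat fps fps" where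
  "poincare_koszul_dual P W =
     poincare_series (\<lambda>d n. dim_mod fscale (bar_null P W) (koszul_dual P W d n))"

end

theory Submission
  imports Defs "HOL-Combinatorics.Multiset_Permutations"
begin

text \<open>
  The bar construction of \<open>P\<close> in weight \<open>d\<close> and arity \<open>n\<close> is a complex of finite dimensional spaces
  in homological degrees \<open>0, \<dots>, d\<close>. For a Koszul operad its homology is concentrated in degree \<open>d\<close>,
  where it is the Koszul dual. So the Euler characteristic of this complex is \<open>(-1)\<^sup>d\<close> times the
  dimension of the Koszul dual (\<open>koszul_euler_char\<close>). Let \<open>X\<close> be the series of these Euler
  characteristics, that is, the Poincare series of the Koszul dual at \<open>(x, -y)\<close>.

  The dimensions of the bar construction can also be counted: it is spanned by trees, and a tree is
  either a leaf or a root vertex, of degree 1 and decorated by an element of \<open>P\<close> of positive weight,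
  with an unordered family of trees above it. For the exponential generating function \<open>X\<close> with signs
  \<open>(-1)\<^sup>s\<close> for \<open>s\<close> vertices this means \<open>X = x - (F(X) - X)\<close>, where \<open>F\<close> is the Poincare series of \<open>P\<close>,
  that is, \<open>F(X) = x\<close> (\<open>poincare_operad_tree_series\<close>). As the coefficient of \<open>x\<close> in \<open>F\<close> does not
  vanish, \<open>F\<close> can be cancelled on the left of a composition, so \<open>X(F) = x\<close> too. This is the first
  equation, and changing \<open>y\<close> to \<open>-y\<close> in \<open>F(X) = x\<close> gives the second one.

  Three facts make this rigorous for trees modulo the relations of multilinearity and equivariance.

  \<^item> The differential is defined on trees. That it respects the relations (\<open>bar_diff_null\<close>) comes
    from equivariance of the partial compositions \<open>p \<circ>\<^sub>i q\<close> and from a rule for Koszul signs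
    (\<open>inv_sum_remove_vertex\<close>), that it squares to zero (\<open>bar_diff_bar_diff\<close>) from associativity of
    partial compositions.

  \<^item> The children of a vertex have disjoint nonempty sets of leaves, so permuting them acts freely.
    Hence the trees with decorations in a basis and one chosen ordering of the children at each
    vertex form a basis. They span by \<open>basis_tree_spanned\<close>, and they are independent because of
    functionals that vanish on the relations and are dual to them (\<open>coef_rel\<close>,
    \<open>coef_basis_tree\<close>).

  \<^item> A quadratic operad is the direct sum of its weight parts, because its ideal of relations is
    stable under the automorphism of the free operad multiplying weight \<open>d\<close> by \<open>2\<^sup>d\<close>
    (\<open>homogeneous_parts_in_ideal\<close>).
\<close>

section \<open>Linear algebra in free vector spaces\<close>

interpretation fs: vector_space "fscale :: 'k::field \<Rightarrow> ('t \<Rightarrow>\<^sub>0 'k) \<Rightarrow> ('t \<Rightarrow>\<^sub>0 'k)"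
  by (rule vector_space_fscale)

lemma keys_fscale: "Poly_Mapping.keys (fscale c x) \<subseteq> Poly_Mapping.keys x"
  by (auto simp: in_keys_iff)

lemma lin_superset:
  assumes "finite A" "Poly_Mapping.keys x \<subseteq> A"
  shows "lin f x = (\<Sum>s\<in>A. fscale (Poly_Mapping.lookup x s) (f s))"
  unfolding lin_def using assms
  by (intro sum.mono_neutral_left) (auto simp: in_keys_iff)

lemma lin_basis [simp]: "lin f (basis_vec t) = f t"
  by (subst lin_superset[of "{t}"]) auto

lemma lin_0 [simp]: "lin f 0 = 0"
  by (simp add: lin_def)

lemma lin_add: "lin f (x + y) = lin f x + lin f y"
proof -
  let ?A = "Poly_Mapping.keys x \<union> Poly_Mapping.keys y"
  have *: "lin f z = (\<Sum>s\<in>?A. fscale (Poly_Mapping.lookup z s) (f s))" if "Poly_Mapping.keys z \<subseteq> ?A" for z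
    by (rule lin_superset) (simp_all add: that)
  show ?thesis
    by (simp add: * Poly_Mapping.keys_add lookup_add fs.scale_left_distrib sum.distrib)
qed

lemma lin_scale: "lin f (fscale c x) = fscale c (lin f x)"
  unfolding lin_superset[OF finite_keys keys_fscale[of c x]] lin_def[of f x]
  by (simp add: fs.scale_sum_right)

lemma linear_lin: "Vector_Spaces.linear fscale fscale (lin f)"
  by (simp add: Vector_Spaces.linear_iff vector_space_fscale lin_add lin_scale)

lemma lin_neg: "lin f (- x) = - lin f x"
  using lin_scale[of f "-1" x] by simp

lemma lin_diff: "lin f (x - y) = lin f x - lin f y"
  using lin_add[of f x "-y"] by (simp add: lin_neg)

lemma lin_sum: "lin f (\<Sum>i\<in>I. x i) = (\<Sum>i\<in>I. lin f (x i))"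
  by (induction I rule: infinite_finite_induct) (auto simp: lin_add)

lemma lin_cong: "(\<And>s. s \<in> Poly_Mapping.keys x \<Longrightarrow> f s = g s) \<Longrightarrow> lin f x = lin g x"
  by (simp add: lin_def)

lemma lin_fun_add: "lin (\<lambda>s. f s + g s) x = lin f x + lin g x"
  by (simp add: lin_def fs.scale_right_distrib sum.distrib)

lemma lin_fun_sum: "lin (\<lambda>s. \<Sum>i\<in>I. f i s) x = (\<Sum>i\<in>I. lin (f i) x)"
  by (simp add: lin_def fs.scale_sum_right) (rule sum.swap)

lemma lin_fun_scale: "lin (\<lambda>s. fscale c (f s)) x = fscale c (lin f x)"
  by (simp add: lin_def fs.scale_sum_right mult.commute)

lemma lin_fun_zero [simp]: "lin (\<lambda>s. 0) x = 0"
  by (simp add: lin_def)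

lemma lin_lin: "lin g (lin f x) = lin (\<lambda>s. lin g (f s)) x"
  by (simp add: lin_def[of f] lin_def[of "\<lambda>s. lin g (f s)"] lin_sum lin_scale)

lemma lin_basis_vec [simp]: "lin basis_vec x = x"
proof (rule poly_mapping_eqI)
  fix t
  have "Poly_Mapping.lookup (lin basis_vec x) t =
      (\<Sum>s\<in>Poly_Mapping.keys x. Poly_Mapping.lookup x s * (1 when s = t))"
    by (simp add: lin_def lookup_sum lookup_single)
  also have "\<dots> = (\<Sum>s\<in>Poly_Mapping.keys x. if s = t then Poly_Mapping.lookup x t else 0)"
    by (intro sum.cong) (auto simp: when_def)
  also have "\<dots> = Poly_Mapping.lookup x t"
    by (simp add: in_keys_iff)
  finally show "Poly_Mapping.lookup (lin basis_vec x) t = Poly_Mapping.lookup x t" .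
qed

lemma lin_in_subspace:
  assumes "fs.subspace S" "\<And>s. s \<in> Poly_Mapping.keys x \<Longrightarrow> f s \<in> S"
  shows "lin f x \<in> S"
  unfolding lin_def by (intro fs.subspace_sum assms(1) fs.subspace_scale assms(2))

lemma keys_lin: "Poly_Mapping.keys (lin f x) \<subseteq> (\<Union>s\<in>Poly_Mapping.keys x. Poly_Mapping.keys (f s))"
proof -
  have "Poly_Mapping.keys (lin f x) \<subseteq>
      (\<Union>s\<in>Poly_Mapping.keys x. Poly_Mapping.keys (fscale (Poly_Mapping.lookup x s) (f s)))"
    unfolding lin_def by (rule keys_sum)
  also have "\<dots> \<subseteq> (\<Union>s\<in>Poly_Mapping.keys x. Poly_Mapping.keys (f s))"
    by (intro UN_mono subset_refl keys_fscale)
  finally show ?thesis .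
qed

lemma subspace_keys: "fs.subspace {x :: 't \<Rightarrow>\<^sub>0 'k::field. Poly_Mapping.keys x \<subseteq> A}"
  by (auto simp: fs.subspace_def dest!: subsetD[OF Poly_Mapping.keys_add] subsetD[OF keys_fscale])

lemma span_basis_vec: "fs.span (basis_vec ` A) = {x :: 't \<Rightarrow>\<^sub>0 'k::field. Poly_Mapping.keys x \<subseteq> A}"
proof (intro equalityI subsetI)
  show "x \<in> {x. Poly_Mapping.keys x \<subseteq> A}" if "x \<in> fs.span (basis_vec ` A)" for x :: "'t \<Rightarrow>\<^sub>0 'k"
  proof -
    have "fs.span (basis_vec ` A) \<subseteq> {x :: 't \<Rightarrow>\<^sub>0 'k. Poly_Mapping.keys x \<subseteq> A}"
      by (rule fs.span_minimal[OF _ subspace_keys]) auto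
    then show ?thesis using that by blast
  qed
next
  fix x :: "'t \<Rightarrow>\<^sub>0 'k" assume "x \<in> {x. Poly_Mapping.keys x \<subseteq> A}"
  then have "lin basis_vec x \<in> fs.span (basis_vec ` A)"
    by (intro lin_in_subspace) (auto intro: fs.span_base)
  then show "x \<in> fs.span (basis_vec ` A)" by simp
qed

lemma inj_basis_vec: "inj_on (basis_vec :: 't \<Rightarrow> 't \<Rightarrow>\<^sub>0 'k::field) A"
  by (rule inj_onI) (metis lookup_single_eq lookup_single_not_eq zero_neq_one)

lemma independent_basis_vec: "fs.independent (basis_vec ` (A :: 't set) :: ('t \<Rightarrow>\<^sub>0 'k::field) set)"
proof
  assume "fs.dependent (basis_vec ` A :: ('t \<Rightarrow>\<^sub>0 'k) set)"
  then obtain a where a: "a \<in> A" "(basis_vec a :: 't \<Rightarrow>\<^sub>0 'k) \<in> fs.span (basis_vec ` A - {basis_vec a})"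
    by (auto simp: fs.dependent_def)
  have "(basis_vec ` A - {basis_vec a} :: ('t \<Rightarrow>\<^sub>0 'k) set) = basis_vec ` (A - {a})"
    using inj_basis_vec[of UNIV] by (auto simp: inj_def)
  with a(2) show False by (simp add: span_basis_vec)
qed

lemma dim_span_basis_vec: "fs.dim (fs.span (basis_vec ` T) :: ('t \<Rightarrow>\<^sub>0 'k::field) set) = card T"
  by (simp only: fs.dim_span_eq_card_independent[OF independent_basis_vec] card_image[OF inj_basis_vec])

text \<open>The linear functional that takes the values \<open>f\<close> on the basis.\<close>

definition pairing :: "('t \<Rightarrow> 'k::field) \<Rightarrow> ('t \<Rightarrow>\<^sub>0 'k) \<Rightarrow> 'k" where
  "pairing f x = (\<Sum>s\<in>Poly_Mapping.keys x. Poly_Mapping.lookup x s * f s)"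

lemma pairing_superset:
  assumes "finite A" "Poly_Mapping.keys x \<subseteq> A"
  shows "pairing f x = (\<Sum>s\<in>A. Poly_Mapping.lookup x s * f s)"
  unfolding pairing_def using assms
  by (intro sum.mono_neutral_left) (auto simp: in_keys_iff)

lemma pairing_basis [simp]: "pairing f (basis_vec t) = f t"
  by (subst pairing_superset[of "{t}"]) auto

lemma pairing_0 [simp]: "pairing f 0 = 0"
  by (simp add: pairing_def)

lemma pairing_add: "pairing f (x + y) = pairing f x + pairing f y"
proof -
  let ?A = "Poly_Mapping.keys x \<union> Poly_Mapping.keys y"
  have *: "pairing f z = (\<Sum>s\<in>?A. Poly_Mapping.lookup z s * f s)" if "Poly_Mapping.keys z \<subseteq> ?A" for z
    by (rule pairing_superset) (simp_all add: that)
  show ?thesis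
    by (simp add: * Poly_Mapping.keys_add lookup_add distrib_right sum.distrib)
qed

lemma pairing_scale: "pairing f (fscale c x) = c * pairing f x"
  unfolding pairing_superset[OF finite_keys keys_fscale[of c x]] pairing_def[of f x]
  by (simp add: sum_distrib_left mult.assoc)

lemma pairing_diff: "pairing f (x - y) = pairing f x - pairing f y"
  using pairing_add[of f "x - y" y] by simp

lemma pairing_sum: "pairing f (\<Sum>i\<in>I. x i) = (\<Sum>i\<in>I. pairing f (x i))"
  by (induction I rule: infinite_finite_induct) (auto simp: pairing_add)

lemma pairing_lin: "pairing g (lin f x) = pairing (\<lambda>s. pairing g (f s)) x"
  by (simp add: lin_def pairing_sum pairing_scale pairing_def[of "\<lambda>s. pairing g (f s)"])

lemma pairing_cong: "(\<And>s. s \<in> Poly_Mapping.keys x \<Longrightarrow> f s = g s) \<Longrightarrow> pairing f x = pairing g x"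
  by (simp add: pairing_def)

lemma pairing_fun_sum: "pairing (\<lambda>s. \<Sum>i\<in>I. f i s) x = (\<Sum>i\<in>I. pairing (f i) x)"
  by (simp add: pairing_def sum_distrib_left) (rule sum.swap)

lemma pairing_fun_scale: "pairing (\<lambda>s. c * f s) x = c * pairing f x"
  by (simp add: pairing_def sum_distrib_left mult.left_commute)

lemma pairing_zero_on_span:
  assumes "\<And>r. r \<in> S \<Longrightarrow> pairing f r = 0" "x \<in> fs.span S"
  shows "pairing f x = 0"
  using assms(2) by (induction rule: fs.span_induct_alt) (auto simp: pairing_add pairing_scale assms(1))

section \<open>Dimensions of quotients and Euler characteristics\<close>

context vector_space_pair
begin

text \<open>
  Extend a basis of the kernel to a basis of \<open>A\<close>: the vectors added are mapped bijectively to a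
  basis of the image.
\<close>

lemma rank_nullity:
  assumes h: "Vector_Spaces.linear s1 s2 h" and A: "vs1.subspace A" "A \<subseteq> vs1.span S" "finite S"
  shows "vs1.dim A = vs1.dim {x \<in> A. h x = 0} + vs2.dim (h ` A)"
proof -
  let ?K = "{x \<in> A. h x = 0}"
  have K: "vs1.subspace ?K"
    using A(1) linear_0[OF h] linear_add[OF h] linear_scale[OF h] by (auto simp: vs1.subspace_def)
  obtain B where B: "B \<subseteq> ?K" "vs1.independent B" "?K \<subseteq> vs1.span B" "card B = vs1.dim ?K"
    using vs1.basis_exists by blast
  obtain C where C: "B \<subseteq> C" "C \<subseteq> A" "vs1.independent C" "A \<subseteq> vs1.span C"
    using vs1.maximal_independent_subset_extend[of B A] B by blast
  have finC: "finite C"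
    using vs1.independent_span_bound[OF A(3) C(3)] C(2) A(2) by auto
  have finB: "finite B" using finC C(1) finite_subset by blast
  have spC: "vs1.span C = A"
    using C A(1) by (simp add: subset_antisym vs1.span_minimal)
  have spB: "vs1.span B = ?K"
    using B K by (simp add: subset_antisym vs1.span_minimal)
  have inter: "vs1.span B \<inter> vs1.span (C - B) = {0}"
  proof -
    have "x = 0" if x: "x \<in> vs1.span B" "x \<in> vs1.span (C - B)" for x
    proof -
      have "vs1.representation C x = vs1.representation B x"
        using vs1.representation_extend[OF C(3) x(1) C(1)] by simp
      moreover have "vs1.representation C x = vs1.representation (C - B) x"
        using vs1.representation_extend[OF C(3) x(2)] by simp
      moreover have "vs1.representation B x b = 0" if "b \<notin> B" for b
        using that vs1.representation_ne_zero by blast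
      moreover have "vs1.representation (C - B) x b = 0" if "b \<notin> C - B" for b
        using that vs1.representation_ne_zero by blast
      ultimately have "vs1.representation C x b = 0" for b by (metis DiffD2)
      moreover have "(\<Sum>b | vs1.representation C x b \<noteq> 0. s1 (vs1.representation C x b) b) = x"
        using vs1.sum_nonzero_representation_eq[OF C(3), of x] x(1) C(1) vs1.span_mono by blast
      ultimately show "x = 0" by simp
    qed
    then show ?thesis using vs1.span_zero by blast
  qed
  have inj: "inj_on h (vs1.span (C - B))"
  proof (rule inj_onI)
    fix x y assume xy: "x \<in> vs1.span (C - B)" "y \<in> vs1.span (C - B)" "h x = h y"
    have "x - y \<in> vs1.span (C - B)" using xy by (simp add: vs1.span_diff)
    moreover have "x - y \<in> ?K"
    proof -
      have "x - y \<in> vs1.span C" using calculation vs1.span_mono[of "C - B" C] by blast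
      then show ?thesis using spC xy(3) linear_diff[OF h] by simp
    qed
    ultimately have "x - y \<in> {0}" using inter spB by (metis IntI)
    then show "x = y" by simp
  qed
  have ind: "vs2.independent (h ` (C - B))"
    using linear_independent_injective_image[OF h _ inj] vs1.independent_mono[OF C(3)] by auto
  have "h ` A \<subseteq> vs2.span (h ` (C - B))"
  proof -
    have "h ` C \<subseteq> insert 0 (h ` (C - B))" using B(1) by auto
    then have "vs2.span (h ` C) \<subseteq> vs2.span (h ` (C - B))"
      using vs2.span_mono vs2.span_insert_0 by metis
    then show ?thesis using linear_span_image[OF h, of C] spC by simp
  qed
  moreover have "h ` (C - B) \<subseteq> h ` A" using C(2) by auto
  ultimately have "vs2.dim (h ` A) = card (h ` (C - B))"
    using vs2.basis_card_eq_dim ind by metis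
  also have "\<dots> = card (C - B)"
    using inj by (intro card_image) (meson inj_on_subset vs1.span_superset)
  also have "\<dots> = card C - card B" using finB C(1) by (simp add: card_Diff_subset)
  finally show ?thesis
    using vs1.basis_card_eq_dim[OF C(2,4,3)] B(4) card_mono[OF finC C(1)] by simp
qed

end

interpretation fsp: vector_space_pair "fscale :: 'k::field \<Rightarrow> ('t \<Rightarrow>\<^sub>0 'k) \<Rightarrow> ('t \<Rightarrow>\<^sub>0 'k)"
    "fscale :: 'k::field \<Rightarrow> ('s \<Rightarrow>\<^sub>0 'k) \<Rightarrow> ('s \<Rightarrow>\<^sub>0 'k)"
  by unfold_locales

text \<open>
  A linear map with kernel \<open>N\<close> on \<open>K\<close> identifies \<open>K\<close> modulo \<open>N\<close> with the image of \<open>K\<close>.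
\<close>

lemma dim_mod_eq_dim_image:
  assumes h: "Vector_Spaces.linear fscale fscale (h :: ('t \<Rightarrow>\<^sub>0 'k::field) \<Rightarrow> ('s \<Rightarrow>\<^sub>0 'k))"
    and K: "fs.subspace K" and N: "fs.subspace N"
    and ker: "\<And>x. x \<in> K \<Longrightarrow> h x = 0 \<longleftrightarrow> x \<in> N"
    and fin: "h ` K \<subseteq> fs.span S0" "finite S0"
  shows "dim_mod fscale N K = fs.dim (h ` K)"
proof -
  have span_sum: "\<exists>y\<in>fs.span S. x - y \<in> N" if "x \<in> fs.span (S \<union> N)" for x S
  proof -
    have [simp]: "fs.span N = N" using N fs.span_eq_iff by blast
    obtain a b where "x = a + b" "a \<in> fs.span S" "b \<in> N"
      using \<open>x \<in> fs.span (S \<union> N)\<close> by (auto simp: fs.span_Un)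
    then have "x - a \<in> N" by simp
    then show ?thesis using \<open>a \<in> fs.span S\<close> by blast
  qed
  show ?thesis
    unfolding dim_mod_def
  proof (rule Least_equality)
    obtain B where B: "B \<subseteq> h ` K" "fs.independent B" "h ` K \<subseteq> fs.span B" "card B = fs.dim (h ` K)"
      using fs.basis_exists by blast
    have finB: "finite B"
      using fs.independent_span_bound[OF fin(2) B(2)] B(1) fin(1) by blast
    obtain S where S: "S \<subseteq> K" "inj_on h S" "h ` S = B"
      using iffD1[OF subset_image_inj B(1)] by auto
    have "finite S" using S finB finite_image_iff by blast
    moreover have "card S = fs.dim (h ` K)" using S B(4) card_image by metis
    moreover have "K \<subseteq> fs.span (S \<union> N)"
    proof
      fix x assume x: "x \<in> K"
      have "h x \<in> h ` fs.span S"
        using x B(3) S(3) fsp.linear_span_image[OF h, of S] by auto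
      then obtain y where y: "y \<in> fs.span S" "h x = h y" by auto
      have "y \<in> K" using y(1) S(1) K fs.span_minimal by blast
      then have "x - y \<in> K" using x K fs.subspace_diff by blast
      moreover have "h (x - y) = 0" using y(2) fsp.linear_diff[OF h] by simp
      ultimately have "x - y \<in> N" using ker by blast
      then have "x - y \<in> fs.span (S \<union> N)" by (simp add: fs.span_base)
      moreover have "y \<in> fs.span (S \<union> N)" using y(1) fs.span_mono[of S "S \<union> N"] by auto
      ultimately show "x \<in> fs.span (S \<union> N)" using fs.span_add by force
    qed
    ultimately show "\<exists>S. finite S \<and> card S = fs.dim (h ` K) \<and> S \<subseteq> K \<and> K \<subseteq> fs.span (S \<union> N)"
      using S(1) by blast
  next
    fix m assume "\<exists>S. finite S \<and> card S = m \<and> S \<subseteq> K \<and> K \<subseteq> fs.span (S \<union> N)"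
    then obtain S where S: "finite S" "card S = m" "S \<subseteq> K" "K \<subseteq> fs.span (S \<union> N)" by blast
    have "h ` K \<subseteq> fs.span (h ` S)"
    proof
      fix z assume "z \<in> h ` K"
      then obtain x where x: "x \<in> K" "z = h x" by auto
      obtain y where y: "y \<in> fs.span S" "x - y \<in> N" using span_sum x S(4) by blast
      have "y \<in> K" using y(1) S(3) K fs.span_minimal by blast
      then have "x - y \<in> K" using x K fs.subspace_diff by blast
      then have "h (x - y) = 0" using ker y by blast
      then have "h x = h y" using fsp.linear_diff[OF h] by simp
      then show "z \<in> fs.span (h ` S)" using x y fsp.linear_span_image[OF h, of S] by auto
    qed
    then have "fs.dim (h ` K) \<le> card (h ` S)" using S(1) fs.dim_le_card by blast
    then show "fs.dim (h ` K) \<le> m" using S card_image_le le_trans by blast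
  qed
qed

text \<open>
  Below the top degree \<open>d\<close> kernels are images, so by rank-nullity the alternating sum of the
  dimensions telescopes and leaves the homology in degree \<open>d\<close>.
\<close>

lemma euler_char_top:
  assumes D: "Vector_Spaces.linear fscale fscale (D :: ('t \<Rightarrow>\<^sub>0 'k::field) \<Rightarrow> ('t \<Rightarrow>\<^sub>0 'k))"
    and fin: "\<And>s. s \<le> d \<Longrightarrow> finite (T s)"
    and A: "\<And>s. s \<le> d \<Longrightarrow> A s = fs.span (basis_vec ` T s)"
    and bot: "D ` A 0 \<subseteq> {0}"
    and exact: "\<And>s. s < d \<Longrightarrow> {x \<in> A s. D x = 0} = D ` A (Suc s)"
  shows "(\<Sum>s\<le>d. (-1) ^ s * int (card (T s))) = (-1) ^ d * int (fs.dim {x \<in> A d. D x = 0})"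
proof -
  define r where "r s = int (fs.dim (D ` A s))" for s
  define z where "z s = int (fs.dim {x \<in> A s. D x = 0})" for s
  have rz: "int (card (T s)) = z s + r s" if "s \<le> d" for s
  proof -
    have "fs.dim (A s) = fs.dim {x \<in> A s. D x = 0} + fs.dim (D ` A s)"
      using fsp.rank_nullity[OF D, of "A s" "basis_vec ` T s"] A[OF that] fin[OF that] by simp
    moreover have "fs.dim (A s) = card (T s)" unfolding A[OF that] by (rule dim_span_basis_vec)
    ultimately show ?thesis unfolding r_def z_def by linarith
  qed
  have r0: "r 0 = 0" using fs.dim_le_card[of "D ` A 0" "{}"] bot by (simp add: r_def)
  have zr: "z s = r (Suc s)" if "s < d" for s using exact[OF that] by (simp add: z_def r_def)
  have "(\<Sum>s\<le>k. (-1) ^ s * (z s + r s)) = (-1) ^ k * z k" if "k \<le> d" for k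
    using that
  proof (induction k)
    case 0 then show ?case by (simp add: r0)
  next
    case (Suc k)
    then have "z k = r (Suc k)" using zr by simp
    then show ?case using Suc by (simp add: algebra_simps)
  qed
  then show ?thesis using rz by (simp add: z_def)
qed

section \<open>Partial compositions\<close>

sublocale smodule \<subseteq> vs: vector_space "scl M"
  by (rule vector_space)

lemma list_all2_replicateI: "(0 < n \<Longrightarrow> Q x y) \<Longrightarrow> list_all2 Q (replicate n x) (replicate n y)"
  by (induction n) auto

lemma replicate_update: "(replicate (i + Suc k) x)[i := y] = replicate i x @ y # replicate k x"
  by (induction i) auto

lemma map_nth3_eq_zip:
  assumes "length xs = n" "length ys = n" "length zs = n"
  shows "map (\<lambda>a. f (xs ! a) (ys ! a) (zs ! a)) [0..<n] = map (\<lambda>(x, y, z). f x y z) (zip xs (zip ys zs))"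
  using assms by (intro nth_equalityI) auto

lemma permute_list_replicate_update:
  assumes "\<sigma> permutes {..<m}" "i < m"
  shows "permute_list (inv \<sigma>) ((replicate m x)[i := y]) = (replicate m x)[\<sigma> i := y]"
proof (rule nth_equalityI)
  have inv: "inv \<sigma> permutes {..<m}" using assms(1) by (rule permutes_inv)
  fix a assume "a < length (permute_list (inv \<sigma>) ((replicate m x)[i := y]))"
  then have a: "a < m" by simp
  moreover have "inv \<sigma> a < m" using permutes_in_image[OF inv] a by auto
  moreover have "\<sigma> i < m" using permutes_in_image[OF assms(1)] assms(2) by auto
  moreover have "inv \<sigma> a = i \<longleftrightarrow> a = \<sigma> i" using assms(1) by (metis permutes_inverses)
  ultimately show "permute_list (inv \<sigma>) ((replicate m x)[i := y]) ! a = (replicate m x)[\<sigma> i := y] ! a"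
    using inv by (auto simp: permute_list_nth nth_list_update)
qed simp

text \<open>
  Grafting an operation of arity \<open>n\<close> into the \<open>i\<close>-th of \<open>m\<close> inputs turns the inputs into \<open>m\<close>
  blocks, of which the \<open>i\<close>-th has length \<open>n\<close> and the others length 1. Block \<open>a\<close> starts at
  \<open>block_start i n a\<close>, and \<open>block_perm m i n \<sigma>\<close> permutes the blocks as prescribed by \<open>\<sigma>\<close>.
\<close>

definition block_start :: "nat \<Rightarrow> nat \<Rightarrow> nat \<Rightarrow> nat" where
  "block_start i n a = (if a \<le> i then a else a + n - 1)"

definition block_perm :: "nat \<Rightarrow> nat \<Rightarrow> nat \<Rightarrow> (nat \<Rightarrow> nat) \<Rightarrow> nat \<Rightarrow> nat" where
  "block_perm m i n \<sigma> k =
     (if k < i then block_start (\<sigma> i) n (\<sigma> k)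
      else if k < i + n then \<sigma> i + (k - i)
      else if k < m + n - 1 then block_start (\<sigma> i) n (\<sigma> (k + 1 - n))
      else k)"

definition inner_perm :: "nat \<Rightarrow> nat \<Rightarrow> (nat \<Rightarrow> nat) \<Rightarrow> nat \<Rightarrow> nat" where
  "inner_perm i n \<tau> k = (if i \<le> k \<and> k < i + n then i + \<tau> (k - i) else k)"

lemma block_position:
  assumes "k < m + n - 1" "i < m" "1 \<le> n"
  obtains a b where "a < m" "b < (if a = i then n else 1)" "k = block_start i n a + b"
proof -
  consider "k < i" | "i \<le> k" "k < i + n" | "i + n \<le> k" by linarith
  then show thesis
  proof cases
    case 1 then show ?thesis using that[of k 0] assms by (auto simp: block_start_def)
  next
    case 2 then show ?thesis using that[of i "k - i"] assms by (auto simp: block_start_def)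
  next
    case 3 then show ?thesis using that[of "k + 1 - n" 0] assms by (auto simp: block_start_def)
  qed
qed

lemma block_start_bound:
  assumes "a < m" "b < (if a = i then n else 1)" "i < m" "1 \<le> n"
  shows "block_start i n a + b < m + n - 1"
  using assms by (auto simp: block_start_def split: if_splits)

lemma block_perm_block:
  assumes "\<sigma> permutes {..<m}" "i < m" "1 \<le> n" "a < m" "b < (if a = i then n else 1)"
  shows "block_perm m i n \<sigma> (block_start i n a + b) = block_start (\<sigma> i) n (\<sigma> a) + b"
  using assms by (auto simp: block_perm_def block_start_def split: if_splits)

lemma block_perm_permutes:
  assumes \<sigma>: "\<sigma> permutes {..<m}" and i: "i < m" and n: "1 \<le> n"
  shows "block_perm m i n \<sigma> permutes {..<m + n - 1}"
proof -
  let ?g = "block_perm m (\<sigma> i) n (inv \<sigma>)"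
  have inv: "inv \<sigma> permutes {..<m}" using \<sigma> by (rule permutes_inv)
  have \<sigma>i: "\<sigma> a < m" if "a < m" for a using permutes_in_image[OF \<sigma>] that by auto
  have *: "block_perm m i n \<sigma> k < m + n - 1 \<and> ?g (block_perm m i n \<sigma> k) = k"
    if k: "k < m + n - 1" for k
  proof -
    obtain a b where ab: "a < m" "b < (if a = i then n else 1)" "k = block_start i n a + b"
      using block_position[OF k i n] by blast
    have b': "b < (if \<sigma> a = \<sigma> i then n else 1)"
      using ab(2) permutes_inj[OF \<sigma>] by (auto simp: inj_eq split: if_splits)
    have eq: "block_perm m i n \<sigma> k = block_start (\<sigma> i) n (\<sigma> a) + b"
      unfolding ab(3) by (rule block_perm_block[OF \<sigma> i n ab(1,2)])
    have "?g (block_start (\<sigma> i) n (\<sigma> a) + b) = block_start (inv \<sigma> (\<sigma> i)) n (inv \<sigma> (\<sigma> a)) + b"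
      by (rule block_perm_block[OF inv \<sigma>i[OF i] n \<sigma>i[OF ab(1)] b'])
    then show ?thesis
      using eq ab(3) block_start_bound[OF \<sigma>i[OF ab(1)] b' \<sigma>i[OF i] n] \<sigma>
      by (simp add: permutes_inverses)
  qed
  have "inj_on (block_perm m i n \<sigma>) {..<m + n - 1}"
    using * by (intro inj_on_inverseI[of _ ?g]) auto
  moreover have "block_perm m i n \<sigma> ` {..<m + n - 1} = {..<m + n - 1}"
    using * by (intro endo_inj_surj[OF _ _ calculation]) auto
  ultimately show ?thesis
    using i n by (intro bij_imp_permutes) (auto simp: bij_betw_def block_perm_def)
qed

lemma inner_perm_permutes:
  assumes "\<tau> permutes {..<n}" "i + n \<le> N"
  shows "inner_perm i n \<tau> permutes {..<N}"
proof -
  have t: "\<tau> b < n" if "b < n" for b using permutes_in_image[OF assms(1)] that by auto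
  have inj: "inj_on (inner_perm i n \<tau>) {..<N}"
  proof (rule inj_onI)
    fix x y assume "x \<in> {..<N}" "y \<in> {..<N}" "inner_perm i n \<tau> x = inner_perm i n \<tau> y"
    moreover have "z - i < n" if "i \<le> z" "z < i + n" for z using that by linarith
    ultimately show "x = y"
      using t[of "x - i"] t[of "y - i"] injD[OF permutes_inj[OF assms(1)], of "x - i" "y - i"]
      by (auto simp: inner_perm_def split: if_splits)
  qed
  have "inner_perm i n \<tau> ` {..<N} = {..<N}"
  proof (intro endo_inj_surj[OF _ _ inj])
    show "inner_perm i n \<tau> ` {..<N} \<subseteq> {..<N}"
    proof
      fix y assume "y \<in> inner_perm i n \<tau> ` {..<N}"
      then obtain x where "x < N" "y = inner_perm i n \<tau> x" by auto
      moreover have "x - i < n" if "i \<le> x" "x < i + n" using that by linarith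
      ultimately show "y \<in> {..<N}" using t[of "x - i"] assms(2) by (auto simp: inner_perm_def)
    qed
  qed simp
  then show ?thesis
    using inj assms(2) by (intro bij_imp_permutes) (auto simp: bij_betw_def inner_perm_def)
qed

lemma offset_replicate_update:
  assumes "i < m" "1 \<le> n" "a < m"
  shows "offset ((replicate m (Suc 0))[i := n]) a = block_start i n a"
proof (cases "a \<le> i")
  case True
  then show ?thesis using assms
    by (simp add: offset_def block_start_def take_update_cancel sum_list_replicate)
next
  case False
  then have "take a ((replicate m (Suc 0))[i := n]) = (replicate a (Suc 0))[i := n]"
    using assms by (simp add: take_update_swap)
  then show ?thesis using False assms
    by (simp add: offset_def block_start_def sum_list_update sum_list_replicate)
qed

lemma sum_list_replicate_update:
  "i < m \<Longrightarrow> 1 \<le> n \<Longrightarrow> sum_list ((replicate m (Suc 0))[i := n]) = m + n - 1"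
  by (simp add: sum_list_update sum_list_replicate)

context operad
begin

lemma inputs_replicate_update:
  assumes "1 \<le> n" "q \<in> car P n"
  shows "inputs P ((replicate m 1)[i := n]) ((replicate m (one P))[i := q])"
  unfolding inputs_def using assms one_closed
  by (intro list_all2_update_cong list_all2_replicateI) auto

lemma cmp_one_one: "cmp P (one P) [1] [one P] = one P"
  using unit_outer[of 1 "one P"] one_closed by simp

lemma act_one_id: "1 \<le> n \<Longrightarrow> x \<in> car P n \<Longrightarrow> act P n x (\<lambda>b. b) = x"
  using act_id[of n x] by (simp add: id_def)

lemma partial_cmp_linear_outer:
  assumes "i < m" "1 \<le> n" "p \<in> car P m" "p' \<in> car P m" "q \<in> car P n"
  shows "partial_cmp P (scl P c p + p') m i q n =
    scl P c (partial_cmp P p m i q n) + partial_cmp P p' m i q n"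
  unfolding partial_cmp_def using assms
  by (intro cmp_linear_outer inputs_replicate_update) auto

lemma partial_cmp_linear_inner:
  assumes "i < m" "1 \<le> n" "p \<in> car P m" "q \<in> car P n" "q' \<in> car P n"
  shows "partial_cmp P p m i (scl P c q + q') n =
    scl P c (partial_cmp P p m i q n) + partial_cmp P p m i q' n"
  using cmp_linear_inner[of p "(replicate m 1)[i := n]" "(replicate m (one P))[i := q]" i q q' c]
    assms inputs_replicate_update[of n q m i]
  by (simp add: partial_cmp_def)

text \<open>
  Associativity in terms of \<open>zip\<close>, which the simplifier evaluates on lists of blocks that are given
  as concatenations.
\<close>

lemma assoc_zip:
  assumes "ns \<noteq> []" "p \<in> car P (length ns)" "inputs P ns qs"
    "length mss = length ns" "length rss = length ns"
    "list_all2 (\<lambda>n (ms, rs). length ms = n \<and> inputs P ms rs) ns (zip mss rss)"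
  shows "cmp P (cmp P p ns qs) (concat mss) (concat rss) =
    cmp P p (map sum_list mss) (map (\<lambda>(q, ms, rs). cmp P q ms rs) (zip qs (zip mss rss)))"
proof -
  have "length qs = length ns" using assms(3) by (auto simp: inputs_def dest: list_all2_lengthD)
  moreover have "length (mss ! a) = ns ! a \<and> inputs P (mss ! a) (rss ! a)" if "a < length ns" for a
    using list_all2_nthD[OF assms(6) that] assms(4,5) that by simp
  ultimately show ?thesis
    using assoc[OF assms(1-5)] assms(4,5)
    by (simp add: map_nth3_eq_zip[of qs "length ns" mss rss "\<lambda>q ms rs. cmp P q ms rs", symmetric])
qed

lemma inputs_units: "inputs P (replicate n 1) (replicate n (one P))"
  unfolding inputs_def using one_closed by (intro list_all2_replicateI) auto

lemma inputs_split:
  assumes "1 \<le> n" "q \<in> car P n"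
  shows "inputs P (replicate i 1 @ n # replicate k 1) (replicate i (one P) @ q # replicate k (one P))"
  using inputs_units[of i] inputs_units[of k] assms by (auto simp: inputs_def intro: list_all2_appendI)

lemma partial_cmp_split:
  "partial_cmp P p (i + Suc k) i q n =
    cmp P p (replicate i 1 @ n # replicate k 1) (replicate i (one P) @ q # replicate k (one P))"
  by (simp only: partial_cmp_def replicate_update)

lemma unit_list_all2:
  "list_all2 (\<lambda>n (ms, rs). length ms = n \<and> inputs P ms rs) (replicate i (Suc 0)) (replicate i ([Suc 0], [one P]))"
  using one_closed by (intro list_all2_replicateI) (auto simp: inputs_def)

text \<open>
  The two associativity laws of partial compositions are instances of \<open>assoc\<close> in which all other
  blocks are single units.
\<close>

lemma partial_cmp_assoc_seq:
  assumes i: "i < m" and j: "j < n" and l: "1 \<le> l"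
    and p: "p \<in> car P m" and q: "q \<in> car P n" and r: "r \<in> car P l"
  shows "partial_cmp P (partial_cmp P p m i q n) (m + n - 1) (i + j) r l =
    partial_cmp P p m i (partial_cmp P q n j r l) (n + l - 1)"
proof -
  obtain k where m: "m = i + Suc k" using i less_imp_Suc_add by (metis add_Suc_right)
  obtain h where n: "n = j + Suc h" using j less_imp_Suc_add by (metis add_Suc_right)
  let ?ns = "replicate i 1 @ n # replicate k 1"
  let ?qs = "replicate i (one P) @ q # replicate k (one P)"
  let ?mss = "replicate i [1] @ (replicate j 1 @ l # replicate h 1) # replicate k [1]"
  let ?rss = "replicate i [one P] @ (replicate j (one P) @ r # replicate h (one P)) # replicate k [one P]"
  have "list_all2 (\<lambda>n (ms, rs). length ms = n \<and> inputs P ms rs) ?ns (zip ?mss ?rss)"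
    using unit_list_all2 inputs_split[OF l r, of j h]
    by (auto simp: n intro!: list_all2_appendI)
  then have "cmp P (cmp P p ?ns ?qs) (concat ?mss) (concat ?rss) =
    cmp P p (map sum_list ?mss) (map (\<lambda>(q, ms, rs). cmp P q ms rs) (zip ?qs (zip ?mss ?rss)))"
    using p q n by (intro assoc_zip inputs_split) (auto simp: m)
  also have "cmp P p ?ns ?qs = partial_cmp P p m i q n"
    by (simp only: m partial_cmp_split)
  also have "concat ?mss = replicate (i + j) 1 @ l # replicate (h + k) 1"
    by (simp add: concat_replicate_single replicate_add)
  also have "concat ?rss = replicate (i + j) (one P) @ r # replicate (h + k) (one P)"
    by (simp add: concat_replicate_single replicate_add)
  also have "cmp P (partial_cmp P p m i q n) (replicate (i + j) 1 @ l # replicate (h + k) 1)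
      (replicate (i + j) (one P) @ r # replicate (h + k) (one P)) =
      partial_cmp P (partial_cmp P p m i q n) (m + n - 1) (i + j) r l"
    using partial_cmp_split[of "partial_cmp P p m i q n" "i + j" "h + k" r l, symmetric] m n
    by (simp add: ac_simps)
  also have "map (\<lambda>(q, ms, rs). cmp P q ms rs) (zip ?qs (zip ?mss ?rss)) =
      replicate i (one P) @ partial_cmp P q n j r l # replicate k (one P)"
  proof -
    have "cmp P q (replicate j 1 @ l # replicate h 1) (replicate j (one P) @ r # replicate h (one P)) =
        partial_cmp P q n j r l"
      by (simp only: n partial_cmp_split)
    then show ?thesis using cmp_one_one by simp
  qed
  also have "map sum_list ?mss = replicate i 1 @ (n + l - 1) # replicate k 1"
    by (simp add: n sum_list_replicate)
  finally show ?thesis by (simp only: m partial_cmp_split)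
qed

lemma partial_cmp_assoc_par:
  assumes i: "i < k" "k < m" and n: "1 \<le> n" and l: "1 \<le> l"
    and p: "p \<in> car P m" and q: "q \<in> car P n" and r: "r \<in> car P l"
  shows "partial_cmp P (partial_cmp P p m i q n) (m + n - 1) (k + n - 1) r l =
    partial_cmp P (partial_cmp P p m k r l) (m + l - 1) i q n"
proof -
  obtain g where k: "k = i + Suc g" using i(1) less_imp_Suc_add by (metis add_Suc_right)
  obtain h where m: "m = k + Suc h" using i(2) less_imp_Suc_add by (metis add_Suc_right)
  have m1: "m = i + Suc (Suc (g + h))" using m k by simp
  let ?u = "\<lambda>i. replicate i (1::nat)" let ?v = "\<lambda>i. replicate i (one P)"
  let ?ns = "?u i @ n # ?u (Suc (g + h))" let ?qs = "?v i @ q # ?v (Suc (g + h))"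
  let ?mss = "replicate i [1] @ ?u n # replicate g [1] @ [l] # replicate h [1]"
  let ?rss = "replicate i [one P] @ ?v n # replicate g [one P] @ [r] # replicate h [one P]"
  let ?ns' = "?u k @ l # ?u h" let ?qs' = "?v k @ r # ?v h"
  let ?mss' = "replicate i [1] @ [n] # replicate g [1] @ ?u l # replicate h [1]"
  let ?rss' = "replicate i [one P] @ [q] # replicate g [one P] @ ?v l # replicate h [one P]"
  let ?L = "cmp P p (?u i @ n # ?u g @ l # ?u h) (?v i @ q # ?v g @ r # ?v h)"
  have split: "replicate (Suc (g + h)) x = replicate g x @ x # replicate h x" for x :: 'x
    by (simp add: replicate_add replicate_app_Cons_same)
  have splitk: "replicate k x = replicate i x @ x # replicate g x" for x :: 'x
    by (simp add: k replicate_add replicate_append_same)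
  have "list_all2 (\<lambda>n (ms, rs). length ms = n \<and> inputs P ms rs) ?ns (zip ?mss ?rss)"
    unfolding split using unit_list_all2 inputs_units[of n] l r
    by (auto intro!: list_all2_appendI simp: inputs_def)
  then have "cmp P (cmp P p ?ns ?qs) (concat ?mss) (concat ?rss) =
    cmp P p (map sum_list ?mss) (map (\<lambda>(q, ms, rs). cmp P q ms rs) (zip ?qs (zip ?mss ?rss)))"
    using p q n by (intro assoc_zip inputs_split) (auto simp: m1)
  also have "map sum_list ?mss = ?u i @ n # ?u g @ l # ?u h"
    by (simp add: sum_list_replicate)
  also have "map (\<lambda>(q, ms, rs). cmp P q ms rs) (zip ?qs (zip ?mss ?rss)) = ?v i @ q # ?v g @ r # ?v h"
    unfolding split using cmp_one_one unit_outer[OF l r] unit_inner[OF n q] by simp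
  also have "concat ?mss = ?u (i + n + g) @ l # ?u h"
    by (simp add: concat_replicate_single replicate_add)
  also have "concat ?rss = ?v (i + n + g) @ r # ?v h"
    by (simp add: concat_replicate_single replicate_add)
  also have "cmp P p ?ns ?qs = partial_cmp P p m i q n"
    by (simp only: m1 partial_cmp_split)
  finally have 1: "partial_cmp P (partial_cmp P p m i q n) (i + n + g + Suc h) (i + n + g) r l = ?L"
    by (simp only: partial_cmp_split)
  have "list_all2 (\<lambda>n (ms, rs). length ms = n \<and> inputs P ms rs) ?ns' (zip ?mss' ?rss')"
    unfolding splitk using unit_list_all2 inputs_units[of l] n q
    by (auto intro!: list_all2_appendI simp: inputs_def)
  then have "cmp P (cmp P p ?ns' ?qs') (concat ?mss') (concat ?rss') =
    cmp P p (map sum_list ?mss') (map (\<lambda>(q, ms, rs). cmp P q ms rs) (zip ?qs' (zip ?mss' ?rss')))"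
    using p r l by (intro assoc_zip inputs_split) (auto simp: m k)
  also have "map sum_list ?mss' = ?u i @ n # ?u g @ l # ?u h"
    by (simp add: sum_list_replicate)
  also have "map (\<lambda>(q, ms, rs). cmp P q ms rs) (zip ?qs' (zip ?mss' ?rss')) = ?v i @ q # ?v g @ r # ?v h"
    unfolding splitk using cmp_one_one unit_outer[OF n q] unit_inner[OF l r] by simp
  also have "concat ?mss' = ?u i @ n # ?u (g + l + h)"
    by (simp add: concat_replicate_single replicate_add)
  also have "concat ?rss' = ?v i @ q # ?v (g + l + h)"
    by (simp add: concat_replicate_single replicate_add)
  also have "cmp P p ?ns' ?qs' = partial_cmp P p m k r l"
    by (simp only: m partial_cmp_split)
  finally have 2: "partial_cmp P (partial_cmp P p m k r l) (i + Suc (g + l + h)) i q n = ?L"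
    by (simp only: partial_cmp_split)
  have "i + n + g + Suc h = m + n - 1" "i + n + g = k + n - 1" "i + Suc (g + l + h) = m + l - 1"
    using m k n l by auto
  with 1 2 show ?thesis by simp
qed

text \<open>
  Equivariance of the partial compositions. The blocks are now one of length \<open>n\<close> and others of
  length 1, so the block permutations of the axioms become explicit.
\<close>

lemma partial_cmp_act_outer:
  assumes "i < m" "1 \<le> n" "p \<in> car P m" "q \<in> car P n" "\<sigma> permutes {..<m}"
  shows "partial_cmp P (act P m p \<sigma>) m i q n =
    act P (m + n - 1) (partial_cmp P p m (\<sigma> i) q n) (block_perm m i n \<sigma>)"
proof -
  let ?ns = "(replicate m 1)[i := n]" and ?qs = "(replicate m (one P))[i := q]"
  have \<sigma>i: "\<sigma> a < m" if "a < m" for a using permutes_in_image[OF assms(5)] that by auto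
  have "cmp P (act P (length ?ns) p \<sigma>) ?ns ?qs =
      act P (sum_list ?ns) (cmp P p ((replicate m 1)[\<sigma> i := n]) (permute_list (inv \<sigma>) ?qs))
        (block_perm m i n \<sigma>)"
  proof (rule cmp_act_outer)
    show "?ns \<noteq> []" "p \<in> car P (length ?ns)" "\<sigma> permutes {..<length ?ns}" using assms by auto
    show "inputs P ?ns ?qs" using assms by (intro inputs_replicate_update) auto
    show "(replicate m 1)[\<sigma> i := n] = permute_list (inv \<sigma>) ?ns"
      using assms by (simp add: permute_list_replicate_update)
    show "block_perm m i n \<sigma> permutes {..<sum_list ?ns}"
      using block_perm_permutes[OF assms(5,1,2)] assms by (simp add: sum_list_replicate_update)
    fix a b assume a: "a < length ?ns" "b < ?ns ! a"
    then have "b < (if a = i then n else 1)" using assms(1) by (auto simp: nth_list_update split: if_splits)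
    then show "block_perm m i n \<sigma> (offset ?ns a + b) = offset ((replicate m 1)[\<sigma> i := n]) (\<sigma> a) + b"
      using a assms \<sigma>i by (simp add: offset_replicate_update block_perm_block)
  qed
  then show ?thesis
    using assms by (simp add: partial_cmp_def permute_list_replicate_update sum_list_replicate_update)
qed

lemma partial_cmp_act_inner:
  assumes "i < m" "1 \<le> n" "p \<in> car P m" "q \<in> car P n" "\<tau> permutes {..<n}"
  shows "partial_cmp P p m i (act P n q \<tau>) n =
    act P (m + n - 1) (partial_cmp P p m i q n) (inner_perm i n \<tau>)"
proof -
  let ?ns = "(replicate m 1)[i := n]" and ?qs = "(replicate m (one P))[i := q]"
  let ?\<tau> = "\<lambda>a. if a = i then \<tau> else (\<lambda>b. b)"
  have "cmp P p ?ns (map (\<lambda>a. act P (?ns ! a) (?qs ! a) (?\<tau> a)) [0..<length ?ns]) =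
      act P (sum_list ?ns) (cmp P p ?ns ?qs) (inner_perm i n \<tau>)"
  proof (rule cmp_act_inner)
    show "?ns \<noteq> []" "p \<in> car P (length ?ns)" using assms by auto
    show "inputs P ?ns ?qs" using assms by (intro inputs_replicate_update) auto
    show "inner_perm i n \<tau> permutes {..<sum_list ?ns}"
      using inner_perm_permutes[OF assms(5), of i "m + n - 1"] assms
      by (simp add: sum_list_replicate_update)
    show "?\<tau> a permutes {..<?ns ! a}" if "a < length ?ns" for a
      using that assms permutes_id[of "{..<Suc 0}"] by (auto simp: nth_list_update id_def)
    fix a b assume a: "a < length ?ns" "b < ?ns ! a"
    then have "b < (if a = i then n else 1)" using assms(1) by (auto simp: nth_list_update split: if_splits)
    then show "inner_perm i n \<tau> (offset ?ns a + b) = offset ?ns a + ?\<tau> a b"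
      using a assms by (auto simp: offset_replicate_update inner_perm_def block_start_def split: if_splits)
  qed
  moreover have "map (\<lambda>a. act P (?ns ! a) (?qs ! a) (?\<tau> a)) [0..<length ?ns] =
      (replicate m (one P))[i := act P n q \<tau>]"
    using assms(1) act_one_id[of 1 "one P"] one_closed
    by (intro nth_equalityI) (auto simp: nth_list_update)
  ultimately show ?thesis using assms by (simp add: partial_cmp_def sum_list_replicate_update)
qed

end

section \<open>Weight-graded operads\<close>

text \<open>
  The properties of the weight grading of a quadratic operad that are used in the analysis of its bar
  construction. \<open>W_direct\<close> says that the sum of the weight parts is direct.
\<close>

locale weighted_operad = operad P
  for P :: "('k::field, 'p::ab_group_add) operad_data" +
  fixes W :: "nat \<Rightarrow> nat \<Rightarrow> 'p set"
  assumes W_subspace: "1 \<le> n \<Longrightarrow> module.subspace (scl P) (W d n)"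
    and W_subset: "1 \<le> n \<Longrightarrow> W d n \<subseteq> car P n"
    and W_act: "1 \<le> n \<Longrightarrow> x \<in> W d n \<Longrightarrow> \<sigma> permutes {..<n} \<Longrightarrow> act P n x \<sigma> \<in> W d n"
    and W_partial_cmp: "i < m \<Longrightarrow> 1 \<le> n \<Longrightarrow> p \<in> W d m \<Longrightarrow> q \<in> W d' n \<Longrightarrow>
          partial_cmp P p m i q n \<in> W (d + d') (m + n - 1)"
    and W_direct: "1 \<le> n \<Longrightarrow> finite D \<Longrightarrow> (\<And>d. d \<in> D \<Longrightarrow> w d \<in> W d n) \<Longrightarrow>
          (\<Sum>d\<in>D. w d) = 0 \<Longrightarrow> d \<in> D \<Longrightarrow> w d = 0"
    and W_fin_dim: "1 \<le> n \<Longrightarrow> fin_dim (scl P) (W d n)"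
begin

abbreviation Pbar :: "('k, 'p) smod" where "Pbar \<equiv> aug_part P W"

lemma scl_Pbar [simp]: "scl Pbar = scl P" and act_Pbar [simp]: "act Pbar = act P"
  and car_Pbar: "car Pbar n = vs.span (\<Union>d\<in>{1..}. W d n)"
  by (auto simp: aug_part_def)

lemma subspace_car_Pbar: "vs.subspace (car Pbar n)"
  by (simp add: car_Pbar)

lemma car_Pbar_subset: "1 \<le> n \<Longrightarrow> car Pbar n \<subseteq> car P n"
  unfolding car_Pbar using W_subset subspace_car by (intro vs.span_minimal) auto

lemma W_car_Pbar: "1 \<le> d \<Longrightarrow> x \<in> W d n \<Longrightarrow> x \<in> car Pbar n"
  unfolding car_Pbar by (rule vs.span_base) auto

lemma car_Pbar_act:
  assumes n: "1 \<le> n" and \<sigma>: "\<sigma> permutes {..<n}" and x: "x \<in> car Pbar n"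
  shows "act P n x \<sigma> \<in> car Pbar n"
proof -
  have "x \<in> car P n \<and> act P n x \<sigma> \<in> car Pbar n"
    using x unfolding car_Pbar[of n]
  proof (induction rule: vs.span_induct_alt)
    case base
    have "act P n (scl P (-1) 0 + 0) \<sigma> = scl P (-1) (act P n 0 \<sigma>) + act P n 0 \<sigma>"
      using vs.subspace_0[OF subspace_car[OF n]] n \<sigma> by (intro act_linear) auto
    then have "act P n 0 \<sigma> = 0" by simp
    then show ?case using vs.subspace_0[OF subspace_car[OF n]] vs.span_zero by simp
  next
    case (step c w y)
    then obtain d where d: "1 \<le> d" "w \<in> W d n" by auto
    then have w: "w \<in> car P n" using W_subset n by blast
    have "act P n w \<sigma> \<in> car Pbar n" using W_act d n \<sigma> W_car_Pbar by blast
    moreover have "act P n (scl P c w + y) \<sigma> = scl P c (act P n w \<sigma>) + act P n y \<sigma>"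
      using w step n \<sigma> by (intro act_linear) auto
    ultimately show ?case
      using step w subspace_car[OF n] by (simp add: car_Pbar vs.span_add vs.span_scale vs.subspace_add vs.subspace_scale)
  qed
  then show ?thesis ..
qed

lemma car_Pbar_partial_cmp_W:
  assumes "i < m" "1 \<le> n" "1 \<le> d" "p \<in> W d m" and q: "q \<in> car Pbar n"
  shows "partial_cmp P p m i q n \<in> car Pbar (m + n - 1)"
proof -
  have p: "p \<in> car P m" using assms W_subset[of m] by auto
  have "q \<in> car P n \<and> partial_cmp P p m i q n \<in> car Pbar (m + n - 1)"
    using q unfolding car_Pbar[of n]
  proof (induction rule: vs.span_induct_alt)
    case base
    have 0: "0 \<in> car P n" using vs.subspace_0[OF subspace_car] assms by blast
    have "partial_cmp P p m i (scl P (-1) 0 + 0) n =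
        scl P (-1) (partial_cmp P p m i 0 n) + partial_cmp P p m i 0 n"
      using 0 p assms by (intro partial_cmp_linear_inner) auto
    then show ?case using 0 vs.span_zero by (simp add: car_Pbar)
  next
    case (step c w y)
    then obtain d' where d: "1 \<le> d'" "w \<in> W d' n" by auto
    then have w: "w \<in> car P n" using W_subset assms by blast
    have "partial_cmp P p m i w n \<in> car Pbar (m + n - 1)"
      using W_partial_cmp[OF assms(1,2,4) d(2)] d W_car_Pbar[of "d + d'"] by simp
    moreover have "partial_cmp P p m i (scl P c w + y) n =
        scl P c (partial_cmp P p m i w n) + partial_cmp P p m i y n"
      using w step p assms by (intro partial_cmp_linear_inner) auto
    ultimately show ?case
      using step w subspace_car[OF assms(2)]
      by (simp add: car_Pbar vs.span_add vs.span_scale vs.subspace_add vs.subspace_scale)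
  qed
  then show ?thesis ..
qed

lemma car_Pbar_partial_cmp:
  assumes "i < m" "1 \<le> n" and p: "p \<in> car Pbar m" and q: "q \<in> car Pbar n"
  shows "partial_cmp P p m i q n \<in> car Pbar (m + n - 1)"
proof -
  have q': "q \<in> car P n" using q car_Pbar_subset assms by blast
  have m: "1 \<le> m" using assms by simp
  have "p \<in> car P m \<and> partial_cmp P p m i q n \<in> car Pbar (m + n - 1)"
    using p unfolding car_Pbar[of m]
  proof (induction rule: vs.span_induct_alt)
    case base
    have 0: "0 \<in> car P m" using vs.subspace_0[OF subspace_car] m by blast
    have "partial_cmp P (scl P (-1) 0 + 0) m i q n =
        scl P (-1) (partial_cmp P 0 m i q n) + partial_cmp P 0 m i q n"
      using 0 q' assms by (intro partial_cmp_linear_outer) auto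
    then show ?case using 0 vs.span_zero by (simp add: car_Pbar)
  next
    case (step c w y)
    then obtain d' where d: "1 \<le> d'" "w \<in> W d' m" by auto
    then have w: "w \<in> car P m" using W_subset m by blast
    have "partial_cmp P w m i q n \<in> car Pbar (m + n - 1)"
      using car_Pbar_partial_cmp_W[OF assms(1,2) d q] .
    moreover have "partial_cmp P (scl P c w + y) m i q n =
        scl P c (partial_cmp P w m i q n) + partial_cmp P y m i q n"
      using w step q' assms by (intro partial_cmp_linear_outer) auto
    ultimately show ?case
      using step w subspace_car[OF m]
      by (simp add: car_Pbar vs.span_add vs.span_scale vs.subspace_add vs.subspace_scale)
  qed
  then show ?thesis ..
qed

end

section \<open>Koszul signs\<close>

text \<open>The exponent of the Koszul sign for permuting objects of degrees \<open>v 0, v 1, \<dots>\<close> by \<open>\<sigma>\<close>.\<close>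

definition inv_sum :: "nat \<Rightarrow> (nat \<Rightarrow> nat) \<Rightarrow> (nat \<Rightarrow> nat) \<Rightarrow> nat" where
  "inv_sum m \<sigma> v = (\<Sum>a<m. \<Sum>b<m. if a < b \<and> \<sigma> b < \<sigma> a then v a * v b else 0)"

lemma koszul_sign_inv_sum:
  "(koszul_sign e \<sigma> ts :: 'k::field) = (-1) ^ inv_sum (length ts) \<sigma> (\<lambda>a. e * vertices (ts ! a))"
proof -
  let ?m = "length ts"
  let ?f = "\<lambda>x. e * vertices (ts ! fst x) * (e * vertices (ts ! snd x))"
  let ?Q = "\<lambda>x. fst x < snd x \<and> \<sigma> (snd x) < \<sigma> (fst x)"
  have set: "{(a, b). a < b \<and> b < ?m \<and> \<sigma> b < \<sigma> a} = {x \<in> {..<?m} \<times> {..<?m}. ?Q x}" by auto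
  have "(koszul_sign e \<sigma> ts :: 'k) = (-1) ^ (\<Sum>x\<in>{x \<in> {..<?m} \<times> {..<?m}. ?Q x}. ?f x)"
    unfolding koszul_sign_def set by (simp add: power_sum case_prod_beta)
  also have "(\<Sum>x\<in>{x \<in> {..<?m} \<times> {..<?m}. ?Q x}. ?f x) =
      (\<Sum>x\<in>{..<?m} \<times> {..<?m}. if ?Q x then ?f x else 0)"
    by (rule sum.inter_filter) simp
  also have "\<dots> = inv_sum ?m \<sigma> (\<lambda>a. e * vertices (ts ! a))"
    by (simp add: inv_sum_def sum.cartesian_product case_prod_beta)
  finally show ?thesis .
qed

lemma inv_sum_cong:
  "(\<And>a. a < m \<Longrightarrow> v a = w a) \<Longrightarrow> inv_sum m \<sigma> v = inv_sum m \<sigma> w"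
  unfolding inv_sum_def by (intro sum.cong refl) auto

lemma minus_one_power_cong:
  "x + 2 * z = y + 2 * z' \<Longrightarrow> (-1 :: 'k::ring_1) ^ x = (-1) ^ y"
  by (metis even_add even_mult_iff even_numeral minus_one_power_iff)

text \<open>
  Collecting the terms of a double sum by unordered pairs of indices. This is how signs are compared
  and how terms of opposite sign cancel.
\<close>

lemma sum_ordered_pairs:
  fixes f :: "nat \<Rightarrow> nat \<Rightarrow> 'b::comm_monoid_add"
  assumes "\<And>a. f a a = 0"
  shows "(\<Sum>a<m. \<Sum>b<m. f a b) = (\<Sum>a<m. \<Sum>b<m. if a < b then f a b + f b a else 0)"
proof -
  have "f a b = (if a < b then f a b else 0) + (if b < a then f a b else 0)" for a b
    using assms by (cases a b rule: linorder_cases) auto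
  then have "(\<Sum>a<m. \<Sum>b<m. f a b) =
      (\<Sum>a<m. \<Sum>b<m. if a < b then f a b else 0) + (\<Sum>a<m. \<Sum>b<m. if b < a then f a b else 0)"
    by (simp add: sum.distrib[symmetric])
  also have "(\<Sum>a<m. \<Sum>b<m. if b < a then f a b else 0) = (\<Sum>b<m. \<Sum>a<m. if b < a then f a b else 0)"
    by (rule sum.swap)
  finally show ?thesis by (simp add: sum.distrib[symmetric] if_distrib cong: if_cong)
qed

text \<open>
  Koszul signs form a cocycle: a pair is inverted by \<open>\<sigma> \<circ> \<tau>\<close> if and only if it is inverted by
  exactly one of \<open>\<tau>\<close> and, afterwards, \<open>\<sigma>\<close>.
\<close>

lemma inv_sum_comp:
  assumes \<sigma>: "\<sigma> permutes {..<m}" and \<tau>: "\<tau> permutes {..<m}"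
  shows "(-1 :: 'k::ring_1) ^ inv_sum m (\<sigma> \<circ> \<tau>) v =
    (-1) ^ inv_sum m \<tau> v * (-1) ^ inv_sum m \<sigma> (\<lambda>a. v (inv \<tau> a))"
proof -
  let ?Z = "\<Sum>a<m. \<Sum>b<m. if a < b \<and> \<tau> b < \<tau> a \<and> \<sigma> (\<tau> b) > \<sigma> (\<tau> a) then v a * v b else 0"
  have re: "(\<Sum>a<m. g a) = (\<Sum>a<m. g (\<tau> a))" for g :: "nat \<Rightarrow> nat"
    using sum.permute[OF \<tau>, of g] by (simp add: o_def)
  have "inv_sum m \<sigma> (\<lambda>a. v (inv \<tau> a)) =
      (\<Sum>a<m. \<Sum>b<m. if \<tau> a < \<tau> b \<and> \<sigma> (\<tau> b) < \<sigma> (\<tau> a) then v a * v b else 0)"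
  proof -
    have re2: "(\<Sum>a<m. \<Sum>b<m. g a b) = (\<Sum>a<m. \<Sum>b<m. g (\<tau> a) (\<tau> b))" for g :: "nat \<Rightarrow> nat \<Rightarrow> nat"
      by (subst re) (rule sum.cong[OF refl], rule re)
    have [simp]: "inv \<tau> (\<tau> a) = a" for a by (rule permutes_inverses(2)[OF \<tau>])
    show ?thesis unfolding inv_sum_def by (subst re2) (simp cong: if_cong)
  qed
  also have "\<dots> = (\<Sum>a<m. \<Sum>b<m. if a < b then
      (if \<tau> a < \<tau> b \<and> \<sigma> (\<tau> b) < \<sigma> (\<tau> a) then v a * v b else 0) +
      (if \<tau> b < \<tau> a \<and> \<sigma> (\<tau> a) < \<sigma> (\<tau> b) then v b * v a else 0) else 0)"
    by (rule sum_ordered_pairs) simp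
  finally have swapped: "inv_sum m \<sigma> (\<lambda>a. v (inv \<tau> a)) = \<dots>" .
  have pointwise: "(if a < b \<and> \<tau> b < \<tau> a then v a * v b else 0) +
      (if a < b then
        (if \<tau> a < \<tau> b \<and> \<sigma> (\<tau> b) < \<sigma> (\<tau> a) then v a * v b else 0) +
        (if \<tau> b < \<tau> a \<and> \<sigma> (\<tau> a) < \<sigma> (\<tau> b) then v b * v a else 0) else 0) =
      (if a < b \<and> (\<sigma> \<circ> \<tau>) b < (\<sigma> \<circ> \<tau>) a then v a * v b else 0) +
      2 * (if a < b \<and> \<tau> b < \<tau> a \<and> \<sigma> (\<tau> b) > \<sigma> (\<tau> a) then v a * v b else 0)"
    if "a < m" "b < m" for a b
  proof (cases "a < b")
    case True
    then have "\<tau> a \<noteq> \<tau> b" using permutes_inj[OF \<tau>] by (auto simp: inj_eq)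
    then have "\<tau> a < \<tau> b \<or> \<tau> b < \<tau> a" by linarith
    moreover have "\<sigma> (\<tau> a) \<noteq> \<sigma> (\<tau> b)"
      using \<open>\<tau> a \<noteq> \<tau> b\<close> \<sigma> by (auto simp: permutes_inj inj_eq dest!: permutes_inj)
    ultimately show ?thesis using True by (auto simp: mult.commute)
  qed auto
  have "inv_sum m \<tau> v + inv_sum m \<sigma> (\<lambda>a. v (inv \<tau> a)) = inv_sum m (\<sigma> \<circ> \<tau>) v + 2 * ?Z"
    unfolding swapped unfolding inv_sum_def sum_distrib_left sum.distrib[symmetric]
    by (intro sum.cong refl pointwise) auto
  then have "(-1 :: 'k) ^ (inv_sum m \<tau> v + inv_sum m \<sigma> (\<lambda>a. v (inv \<tau> a))) = (-1) ^ inv_sum m (\<sigma> \<circ> \<tau>) v"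
    by (intro minus_one_power_cong[where z = 0]) simp
  then show ?thesis by (simp add: power_add)
qed

text \<open>
  The sign rule behind equivariance of the bar differential. Contracting the edge to the
  \<open>i\<close>-th tree or an edge inside it removes one of its \<open>v i\<close> vertices and costs the sign of passing
  the trees before it. Doing so before or after permuting the trees gives the same sign: the trees
  that are before the \<open>i\<close>-th one on exactly one side are those forming an inversion with it.
\<close>

lemma inv_sum_remove_vertex:
  assumes \<sigma>: "\<sigma> permutes {..<m}" and i: "i < m" and v: "1 \<le> v i"
  shows "(-1 :: 'k::ring_1) ^ (\<Sum>a<i. v a) * (-1) ^ inv_sum m \<sigma> (v(i := v i - 1)) =
    (-1) ^ inv_sum m \<sigma> v * (-1) ^ (\<Sum>a | a < m \<and> \<sigma> a < \<sigma> i. v a)"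
proof -
  let ?w = "v(i := v i - 1)"
  let ?A = "\<Sum>b<m. if i < b \<and> \<sigma> b < \<sigma> i then v b else 0"
  let ?B = "\<Sum>a<m. if a < i \<and> \<sigma> i < \<sigma> a then v a else 0"
  let ?S = "\<Sum>a<m. if a < i then v a else 0"
  let ?S' = "\<Sum>a<m. if \<sigma> a < \<sigma> i then v a else 0"
  let ?Z = "\<Sum>a<m. if i < a \<and> \<sigma> a < \<sigma> i then v a else 0"
  have term_eq: "(if a < b \<and> \<sigma> b < \<sigma> a then v a * v b else 0) =
      (if a < b \<and> \<sigma> b < \<sigma> a then ?w a * ?w b else 0) +
      (if a = i then (if i < b \<and> \<sigma> b < \<sigma> i then v b else 0) else 0) +
      (if b = i then (if a < i \<and> \<sigma> i < \<sigma> a then v a else 0) else 0)" for a b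
    using v by (cases "a = i"; cases "b = i") (auto simp: algebra_simps diff_mult_distrib diff_mult_distrib2 le_add_diff_inverse)
  have "inv_sum m \<sigma> v = inv_sum m \<sigma> ?w +
      (\<Sum>a<m. \<Sum>b<m. if a = i then (if i < b \<and> \<sigma> b < \<sigma> i then v b else 0) else 0) +
      (\<Sum>a<m. \<Sum>b<m. if b = i then (if a < i \<and> \<sigma> i < \<sigma> a then v a else 0) else 0)"
    unfolding inv_sum_def by (subst term_eq) (simp only: sum.distrib)
  also have "(\<Sum>a<m. \<Sum>b<m. if a = i then (if i < b \<and> \<sigma> b < \<sigma> i then v b else 0) else 0) = ?A"
    using i by (subst sum.swap) (simp add: sum.delta')
  also have "(\<Sum>a<m. \<Sum>b<m. if b = i then (if a < i \<and> \<sigma> i < \<sigma> a then v a else 0) else 0) = ?B"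
    using i by (simp add: sum.delta')
  finally have 1: "inv_sum m \<sigma> v = inv_sum m \<sigma> ?w + ?A + ?B" .
  have 2: "?A + ?B + ?S' = ?S + 2 * ?Z"
  proof -
    have "(if i < a \<and> \<sigma> a < \<sigma> i then v a else 0) + (if a < i \<and> \<sigma> i < \<sigma> a then v a else 0) +
        (if \<sigma> a < \<sigma> i then v a else 0) =
        (if a < i then v a else 0) + 2 * (if i < a \<and> \<sigma> a < \<sigma> i then v a else 0)" for a
    proof (cases "a = i")
      case False
      then have "\<sigma> a \<noteq> \<sigma> i" using permutes_inj[OF \<sigma>] by (auto simp: inj_eq)
      then show ?thesis using False by auto
    qed simp
    then show ?thesis unfolding sum_distrib_left sum.distrib[symmetric] by (intro sum.cong refl)
  qed
  have S: "(\<Sum>a<i. v a) = ?S"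
  proof -
    have "(\<Sum>a<i. v a) = (\<Sum>a\<in>{a \<in> {..<m}. a < i}. v a)"
      using i by (intro sum.cong) auto
    then show ?thesis by (simp only: sum.inter_filter[OF finite_lessThan])
  qed
  have S': "(\<Sum>a | a < m \<and> \<sigma> a < \<sigma> i. v a) = ?S'"
  proof -
    have "(\<Sum>a | a < m \<and> \<sigma> a < \<sigma> i. v a) = (\<Sum>a\<in>{a \<in> {..<m}. \<sigma> a < \<sigma> i}. v a)"
      by (intro sum.cong) auto
    then show ?thesis by (simp only: sum.inter_filter[OF finite_lessThan])
  qed
  have "(-1 :: 'k) ^ (?S + inv_sum m \<sigma> ?w) = (-1) ^ (inv_sum m \<sigma> v + ?S')"
    using 1 2 by (intro minus_one_power_cong[where z = ?Z and z' = 0]) linarith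
  then show ?thesis unfolding S S' by (simp only: power_add)
qed

lemma sum_blocks:
  assumes "i < m" "1 \<le> n"
  shows "(\<Sum>k<m + n - 1. g k) = (\<Sum>a<m. \<Sum>b<(if a = i then n else 1). g (block_start i n a + b))"
proof -
  let ?S = "SIGMA a:{..<m}. {..<(if a = i then n else 1)}"
  have "bij_betw (\<lambda>(a, b). block_start i n a + b) ?S {..<m + n - 1}"
    unfolding bij_betw_def
  proof
    show "inj_on (\<lambda>(a, b). block_start i n a + b) ?S"
      using assms by (auto simp: inj_on_def block_start_def split: if_splits)
    show "(\<lambda>(a, b). block_start i n a + b) ` ?S = {..<m + n - 1}"
    proof (intro equalityI subsetI)
      fix k assume "k \<in> {..<m + n - 1}"
      then obtain a b where "a < m" "b < (if a = i then n else 1)" "k = block_start i n a + b"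
        using block_position[of k m n i] assms by blast
      then have "(a, b) \<in> ?S" "k = (\<lambda>(a, b). block_start i n a + b) (a, b)" by auto
      then show "k \<in> (\<lambda>(a, b). block_start i n a + b) ` ?S" by blast
    qed (use block_start_bound assms in auto)
  qed
  then have "(\<Sum>k<m + n - 1. g k) = (\<Sum>(a, b)\<in>?S. g (block_start i n a + b))"
    by (simp add: sum.reindex_bij_betw[symmetric] case_prod_beta)
  then show ?thesis by (simp add: sum.Sigma)
qed

text \<open>
  A block permutation keeps the order inside each block, so that it inverts two positions if and only
  if they are in different blocks that \<open>\<sigma>\<close> inverts.
\<close>

lemma inv_sum_block_perm:
  assumes \<sigma>: "\<sigma> permutes {..<m}" and i: "i < m" and n: "1 \<le> n"
    and w: "\<And>a. a < m \<Longrightarrow> (\<Sum>b<(if a = i then n else 1). w (block_start i n a + b)) = v a"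
  shows "inv_sum (m + n - 1) (block_perm m i n \<sigma>) w = inv_sum m \<sigma> v"
proof -
  let ?s = "block_start i n" and ?l = "\<lambda>a. if a = i then n else 1"
  let ?\<beta> = "block_perm m i n \<sigma>"
  have inv: "(?s a + b < ?s a' + b' \<and> ?\<beta> (?s a' + b') < ?\<beta> (?s a + b)) \<longleftrightarrow> a < a' \<and> \<sigma> a' < \<sigma> a"
    if "a < m" "a' < m" "b < ?l a" "b' < ?l a'" for a a' b b'
  proof -
    have ne: "\<sigma> a = \<sigma> i \<longleftrightarrow> a = i" "\<sigma> a' = \<sigma> i \<longleftrightarrow> a' = i" "\<sigma> a' = \<sigma> a \<longleftrightarrow> a' = a"
      using permutes_inj[OF \<sigma>] by (auto simp: inj_eq)
    have "?\<beta> (?s a + b) = block_start (\<sigma> i) n (\<sigma> a) + b"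
      "?\<beta> (?s a' + b') = block_start (\<sigma> i) n (\<sigma> a') + b'"
      using block_perm_block[OF \<sigma> i n] that by blast+
    moreover have "?s a + b < ?s a' + b' \<longleftrightarrow> a < a' \<or> (a = a' \<and> b < b')"
      using that n by (auto simp: block_start_def split: if_splits)
    moreover have "block_start (\<sigma> i) n (\<sigma> a') + b' < block_start (\<sigma> i) n (\<sigma> a) + b \<longleftrightarrow>
        \<sigma> a' < \<sigma> a \<or> (a = a' \<and> b' < b)"
      using that n ne by (auto simp: block_start_def split: if_splits)
    ultimately show ?thesis by auto
  qed
  have "inv_sum (m + n - 1) ?\<beta> w =
      (\<Sum>a<m. \<Sum>b<?l a. \<Sum>a'<m. \<Sum>b'<?l a'. if ?s a + b < ?s a' + b' \<and> ?\<beta> (?s a' + b') < ?\<beta> (?s a + b)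
         then w (?s a + b) * w (?s a' + b') else 0)"
    unfolding inv_sum_def by (simp only: sum_blocks[OF i n])
  also have "\<dots> = (\<Sum>a<m. \<Sum>b<?l a. \<Sum>a'<m. \<Sum>b'<?l a'. if a < a' \<and> \<sigma> a' < \<sigma> a
         then w (?s a + b) * w (?s a' + b') else 0)"
    using inv by (intro sum.cong refl) (auto simp only: lessThan_iff)
  also have "\<dots> = (\<Sum>a<m. \<Sum>a'<m. \<Sum>b<?l a. \<Sum>b'<?l a'. if a < a' \<and> \<sigma> a' < \<sigma> a
         then w (?s a + b) * w (?s a' + b') else 0)"
    by (rule sum.cong[OF refl], rule sum.swap)
  also have "\<dots> = (\<Sum>a<m. \<Sum>a'<m. if a < a' \<and> \<sigma> a' < \<sigma> a
         then (\<Sum>b<?l a. w (?s a + b)) * (\<Sum>b'<?l a'. w (?s a' + b')) else 0)"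
    by (intro sum.cong refl) (auto simp: sum_product)
  also have "\<dots> = inv_sum m \<sigma> v"
    unfolding inv_sum_def using w by (intro sum.cong refl) (auto simp only: lessThan_iff)
  finally show ?thesis .
qed

lemma inv_sum_inner_perm:
  assumes \<tau>: "\<tau> permutes {..<n}" and N: "i + n \<le> N"
  shows "inv_sum N (inner_perm i n \<tau>) w = inv_sum n \<tau> (\<lambda>b. w (i + b))"
proof -
  let ?\<beta> = "inner_perm i n \<tau>"
  let ?f = "\<lambda>a b. if a < b \<and> ?\<beta> b < ?\<beta> a then w a * w b else 0"
  have t: "\<tau> b < n" if "b < n" for b using permutes_in_image[OF \<tau>] that by auto
  have in_block: "i \<le> a \<and> b < i + n" if "a < b" "?\<beta> b < ?\<beta> a" for a b
  proof -
    have "c - i < n" if "i \<le> c" "c < i + n" for c using that by linarith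
    then show ?thesis
      using that t[of "a - i"] t[of "b - i"] by (auto simp: inner_perm_def split: if_splits)
  qed
  have restrict: "(\<Sum>a<N. g a) = (\<Sum>b<n. g (i + b))" if "\<And>a. a < i \<or> i + n \<le> a \<Longrightarrow> g a = 0"
    for g :: "nat \<Rightarrow> nat"
  proof -
    have "(\<Sum>a<N. g a) = (\<Sum>a\<in>(+) i ` {..<n}. g a)"
    proof (rule sum.mono_neutral_right)
      show "\<forall>a\<in>{..<N} - (+) i ` {..<n}. g a = 0"
      proof
        fix a assume "a \<in> {..<N} - (+) i ` {..<n}"
        moreover have "a = i + (a - i)" if "i \<le> a" using that by simp
        ultimately have "a < i \<or> i + n \<le> a" by (metis DiffD2 imageI lessThan_iff linorder_not_le nat_add_left_cancel_le)
        then show "g a = 0" by (rule that)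
      qed
    qed (use N in auto)
    then show ?thesis by (simp add: sum.reindex)
  qed
  have zero: "?f a b = 0" if "a < i \<or> i + n \<le> a \<or> b < i \<or> i + n \<le> b" for a b
    using in_block[of a b] that by auto
  have "inv_sum N ?\<beta> w = (\<Sum>a<n. \<Sum>b<N. ?f (i + a) b)"
    unfolding inv_sum_def by (rule restrict) (intro sum.neutral ballI, rule zero, blast)
  also have "\<dots> = (\<Sum>a<n. \<Sum>b<n. ?f (i + a) (i + b))"
    by (rule sum.cong[OF refl], rule restrict, rule zero, blast)
  also have "\<dots> = inv_sum n \<tau> (\<lambda>b. w (i + b))"
    unfolding inv_sum_def by (intro sum.cong refl) (auto simp: inner_perm_def)
  finally show ?thesis .
qed

section \<open>Lists with one entry replaced by a list\<close>

text \<open>The children after contraction of the edge to the \<open>i\<close>-th child, which has children \<open>us\<close>.\<close>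

definition splice_at :: "nat \<Rightarrow> 'a list \<Rightarrow> 'a list \<Rightarrow> 'a list" where
  "splice_at i us ts = take i ts @ us @ drop (Suc i) ts"

lemma length_splice_at: "i < length ts \<Longrightarrow> length (splice_at i us ts) = length ts + length us - 1"
  by (simp add: splice_at_def)

lemma splice_at_append: "splice_at (length xs) us (xs @ t # ys) = xs @ us @ ys"
  by (simp add: splice_at_def)

lemma set_splice_at: "set (splice_at i us ts) \<subseteq> set ts \<union> set us"
  by (auto simp: splice_at_def dest: in_set_takeD in_set_dropD)

lemma splice_at_nth:
  assumes "i < length ts" "a < length ts" "b < (if a = i then length us else 1)" "us \<noteq> []"
  shows "splice_at i us ts ! (block_start i (length us) a + b) = (if a = i then us ! b else ts ! a)"
proof -
  consider "a < i" | "a = i" | "i < a" by linarith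
  then show ?thesis
  proof cases
    case 3
    then have "block_start i (length us) a + b = i + length us + (a - Suc i)"
      using assms by (auto simp: block_start_def)
    moreover have "splice_at i us ts ! (i + length us + (a - Suc i)) = drop (Suc i) ts ! (a - Suc i)"
      using nth_append_length_plus[of "take i ts @ us" "drop (Suc i) ts" "a - Suc i"] assms(1)
      by (simp add: splice_at_def)
    ultimately show ?thesis using 3 assms by simp
  qed (use assms in \<open>auto simp: splice_at_def block_start_def nth_append\<close>)
qed

text \<open>
  In the relation \<open>equiv\<close> the entry at position \<open>k\<close> moves to position \<open>\<beta> k\<close>; this describes
  the permuted list without inverses.
\<close>

lemma permute_list_inv_eqI:
  assumes "\<beta> permutes {..<length xs}" "length ys = length xs"
    and "\<And>k. k < length xs \<Longrightarrow> ys ! \<beta> k = xs ! k"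
  shows "permute_list (inv \<beta>) xs = ys"
proof (rule nth_equalityI)
  have inv: "inv \<beta> permutes {..<length xs}" using assms(1) by (rule permutes_inv)
  fix k assume "k < length (permute_list (inv \<beta>) xs)"
  then have k: "k < length xs" by simp
  then have "inv \<beta> k < length xs" using permutes_in_image[OF inv] by auto
  then have "ys ! \<beta> (inv \<beta> k) = xs ! inv \<beta> k" by (rule assms(3))
  then show "permute_list (inv \<beta>) xs ! k = ys ! k"
    using k inv assms(1) by (simp add: permute_list_nth permutes_inverses)
qed (use assms in simp)

lemma nth_permute_list_inv:
  assumes "\<sigma> permutes {..<length xs}" "a < length xs"
  shows "permute_list (inv \<sigma>) xs ! \<sigma> a = xs ! a"
proof -
  have "\<sigma> a < length xs" using permutes_in_image[OF assms(1)] assms(2) by auto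
  then show ?thesis
    using assms by (simp add: permute_list_nth permutes_inv permutes_inverses)
qed

lemma permute_splice_at:
  assumes \<sigma>: "\<sigma> permutes {..<length ts}" and i: "i < length ts" and us: "us \<noteq> []"
  shows "permute_list (inv (block_perm (length ts) i (length us) \<sigma>)) (splice_at i us ts) =
    splice_at (\<sigma> i) us (permute_list (inv \<sigma>) ts)"
proof (rule permute_list_inv_eqI)
  let ?m = "length ts" and ?n = "length us"
  have n: "1 \<le> ?n" using us by (cases us) auto
  have \<sigma>i: "\<sigma> a < ?m" if "a < ?m" for a using permutes_in_image[OF \<sigma>] that by auto
  show "block_perm ?m i ?n \<sigma> permutes {..<length (splice_at i us ts)}"
    using block_perm_permutes[OF \<sigma> i n] i by (simp add: length_splice_at)
  show "length (splice_at (\<sigma> i) us (permute_list (inv \<sigma>) ts)) = length (splice_at i us ts)"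
    using i \<sigma>i by (simp add: length_splice_at)
  fix k assume "k < length (splice_at i us ts)"
  then have "k < ?m + ?n - 1" using i by (simp add: length_splice_at)
  then obtain a b where ab: "a < ?m" "b < (if a = i then ?n else 1)" "k = block_start i ?n a + b"
    using block_position[of k ?m ?n i] i n by blast
  have eq: "\<sigma> a = \<sigma> i \<longleftrightarrow> a = i" using permutes_inj[OF \<sigma>] by (auto simp: inj_eq)
  have "splice_at (\<sigma> i) us (permute_list (inv \<sigma>) ts) ! (block_start (\<sigma> i) ?n (\<sigma> a) + b) =
      (if \<sigma> a = \<sigma> i then us ! b else permute_list (inv \<sigma>) ts ! \<sigma> a)"
    using ab eq us \<sigma>i i by (intro splice_at_nth) auto
  also have "\<dots> = splice_at i us ts ! k"
    using splice_at_nth[OF i ab(1,2) us] ab(1,3) eq nth_permute_list_inv[OF \<sigma> ab(1)] by simp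
  also have "block_start (\<sigma> i) ?n (\<sigma> a) + b = block_perm ?m i ?n \<sigma> k"
    using block_perm_block[OF \<sigma> i n ab(1,2)] ab(3) by simp
  finally show "splice_at (\<sigma> i) us (permute_list (inv \<sigma>) ts) ! block_perm ?m i ?n \<sigma> k = splice_at i us ts ! k" .
qed

lemma permute_inner:
  assumes \<tau>: "\<tau> permutes {..<length us}"
  shows "permute_list (inv (inner_perm (length xs) (length us) \<tau>)) (xs @ us @ ys) =
    xs @ permute_list (inv \<tau>) us @ ys"
proof (rule permute_list_inv_eqI)
  let ?\<beta> = "inner_perm (length xs) (length us) \<tau>"
  show "?\<beta> permutes {..<length (xs @ us @ ys)}" by (rule inner_perm_permutes[OF \<tau>]) simp
  fix k assume "k < length (xs @ us @ ys)"
  show "(xs @ permute_list (inv \<tau>) us @ ys) ! ?\<beta> k = (xs @ us @ ys) ! k"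
  proof (cases "length xs \<le> k \<and> k < length xs + length us")
    case True
    then have k: "k - length xs < length us" by linarith
    then have "\<tau> (k - length xs) < length us" using permutes_in_image[OF \<tau>] by auto
    then show ?thesis
      using True k nth_permute_list_inv[OF \<tau> k] by (simp add: inner_perm_def nth_append)
  next
    case False
    then show ?thesis by (auto simp: inner_perm_def nth_append)
  qed
qed simp

lemma permute_list_update:
  assumes "\<sigma> permutes {..<length ts}" "i < length ts"
  shows "permute_list (inv \<sigma>) (ts[i := t]) = (permute_list (inv \<sigma>) ts)[\<sigma> i := t]"
proof (rule permute_list_inv_eqI)
  fix k assume "k < length (ts[i := t])"
  then show "(permute_list (inv \<sigma>) ts)[\<sigma> i := t] ! \<sigma> k = ts[i := t] ! k"
    using assms permutes_in_image[OF assms(1), of k] permutes_inj[OF assms(1)] nth_permute_list_inv[OF assms(1)]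
    by (auto simp: nth_list_update inj_eq)
qed (use assms in simp_all)

section \<open>The bar differential\<close>

lemma wf_tree_Leaf [simp]: "wf_tree M (Leaf l)"
  by (rule wf_tree.intros)

lemma wf_tree_Node [simp]:
  "wf_tree M (Node a ts) \<longleftrightarrow> ts \<noteq> [] \<and> a \<in> car M (length ts) \<and> (\<forall>t\<in>set ts. wf_tree M t)"
  by (auto elim: wf_tree.cases intro: wf_tree.intros)

lemma lin_swap: "lin (\<lambda>s. lin (\<lambda>t. f s t) y) x = lin (\<lambda>t. lin (\<lambda>s. f s t) x) y"
  unfolding lin_def fs.scale_sum_right
  by (subst sum.swap) (simp add: mult.commute)

lemma subspace_tree_null: "fs.subspace (tree_null e M)"
  by (simp add: tree_null_def)

lemma tree_rel_null: "r \<in> tree_rel e M \<Longrightarrow> r \<in> tree_null e M"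
  unfolding tree_null_def by (rule fs.span_base)

lemma tree_null_lin:
  assumes "x \<in> tree_null e M" "\<And>r. r \<in> tree_rel e M \<Longrightarrow> lin f r \<in> N" "fs.subspace N"
  shows "lin f x \<in> N"
  using assms(1) unfolding tree_null_def
  by (induction rule: fs.span_induct_alt)
     (use assms(2) in \<open>auto simp: lin_add lin_scale fs.subspace_0[OF assms(3)]
        intro!: fs.subspace_add[OF assms(3)] fs.subspace_scale[OF assms(3)]\<close>)

lemma tree_null_context:
  assumes "x \<in> tree_null e M" "j < length ts" "a \<in> car M (length ts)"
    and "\<And>k. k < length ts \<Longrightarrow> k \<noteq> j \<Longrightarrow> wf_tree M (ts ! k)"
  shows "lin (\<lambda>t. basis_vec (Node a (ts[j := t]))) x \<in> tree_null e M"
proof (rule tree_null_lin[OF assms(1) _ subspace_tree_null])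
  fix r assume "r \<in> tree_rel e M"
  moreover have "wf_tree M (Node a (take j ts @ Leaf 0 # drop (Suc j) ts))"
    using assms by (auto simp: in_set_conv_nth Suc_diff_Suc)
  ultimately show "lin (\<lambda>t. basis_vec (Node a (ts[j := t]))) r \<in> tree_null e M"
    using tree_rel.in_context[of r e M a "take j ts" 0 "drop (Suc j) ts"] assms(2)
    by (simp add: tree_rel_null upd_conv_take_nth_drop)
qed

text \<open>
  The signs in the bar differential depend on numbers of vertices only, so they are constant on the
  trees that occur in a relation.
\<close>

lemma tree_rel_homogeneous:
  assumes "r \<in> tree_rel e M"
  shows "\<exists>v. \<forall>t\<in>Poly_Mapping.keys r. vertices t = v"
  using assms
proof induction
  case (linear a ts b c)
  let ?S = "{x. Poly_Mapping.keys x \<subseteq> {t. vertices t = Suc (sum_list (map vertices ts))}}"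
  have "basis_vec (Node (scl M c a + b) ts) - fscale c (basis_vec (Node a ts)) - basis_vec (Node b ts) \<in> ?S"
    by (intro fs.subspace_diff fs.subspace_scale subspace_keys) auto
  then show ?case by blast
next
  case (equiv a ts \<sigma>)
  let ?S = "{x. Poly_Mapping.keys x \<subseteq> {t. vertices t = Suc (sum_list (map vertices ts))}}"
  have "mset (permute_list (inv \<sigma>) ts) = mset ts"
    using equiv by (simp add: permutes_inv)
  then have "sum_list (map vertices (permute_list (inv \<sigma>) ts)) = sum_list (map vertices ts)"
    by (metis mset_map sum_mset_sum_list)
  then have "basis_vec (Node (act M (length ts) a \<sigma>) ts)
      - fscale (koszul_sign e \<sigma> ts) (basis_vec (Node a (permute_list (inv \<sigma>) ts))) \<in> ?S"
    by (intro fs.subspace_diff fs.subspace_scale subspace_keys) auto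
  then show ?case by blast
next
  case (in_context r a us l vs)
  then obtain v where v: "\<forall>t\<in>Poly_Mapping.keys r. vertices t = v" by blast
  show ?case
  proof (intro exI ballI)
    fix t assume "t \<in> Poly_Mapping.keys (lin (\<lambda>t. basis_vec (Node a (us @ t # vs))) r)"
    then obtain s where "s \<in> Poly_Mapping.keys r" "t = Node a (us @ s # vs)"
      using keys_lin by fastforce
    then show "vertices t = Suc (sum_list (map vertices us) + v + sum_list (map vertices vs))"
      using v by simp
  qed
qed

definition vertices_before :: "nat \<Rightarrow> 'a tree list \<Rightarrow> nat" where
  "vertices_before i ts = sum_list (map vertices (take i ts))"

lemma vertices_before_sum: "i \<le> length ts \<Longrightarrow> vertices_before i ts = (\<Sum>a<i. vertices (ts ! a))"
  by (simp add: vertices_before_def sum_list_sum_nth atLeast0LessThan)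

lemma vertices_before_update:
  "vertices t = vertices t' \<Longrightarrow> vertices_before i (ts[j := t]) = vertices_before i (ts[j := t'])"
  by (simp add: vertices_before_def map_update take_map[symmetric] take_update_swap)

lemma splice_at_update:
  assumes "i < length ts" "j < length ts" "i \<noteq> j" "us \<noteq> []"
  shows "splice_at i us (ts[j := t]) = (splice_at i us ts)[block_start i (length us) j := t]"
proof (cases "j < i")
  case True
  then show ?thesis using assms by (simp add: splice_at_def block_start_def list_update_append take_update_swap)
next
  case False
  then obtain k where k: "j = Suc (i + k)" using assms(3) less_imp_Suc_add by (metis linorder_neqE_nat)
  moreover have "block_start i (length us) j = length (take i ts @ us) + k"
    using k assms by (auto simp: block_start_def)
  ultimately show ?thesis using assms
    by (simp add: splice_at_def list_update_append drop_update_swap)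
qed

text \<open>
  The vertices before a child, after the edge from the root to the \<open>i\<close>-th child has been
  contracted: one vertex less is counted to the right of that child.
\<close>

lemma vertices_before_splice_at:
  assumes "i < length ts" "a < length ts" "b < (if a = i then length us else 1)"
    and "us \<noteq> []" "ts ! i = Node q us"
  shows "(-1 :: 'k::ring_1) ^ vertices_before (block_start i (length us) a + b) (splice_at i us ts) =
    (if a = i then (-1) ^ (vertices_before i ts + vertices_before b us)
     else if a < i then (-1) ^ vertices_before a ts else - ((-1) ^ vertices_before a ts))"
proof -
  consider "a < i" | "a = i" | "i < a" by linarith
  then show ?thesis
  proof cases
    case 3
    then have "block_start i (length us) a + b = i + length us + (a - Suc i)"
      using assms by (auto simp: block_start_def)
    then have 1: "take (block_start i (length us) a + b) (splice_at i us ts) =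
        take i ts @ us @ take (a - Suc i) (drop (Suc i) ts)"
      using assms by (simp add: splice_at_def)
    have "take a ts = take i ts @ ts ! i # take (a - Suc i) (drop (Suc i) ts)"
      using 3 assms by (subst id_take_nth_drop[of i ts]) (auto simp: min_def take_Cons')
    then have "vertices_before a ts = Suc (vertices_before (block_start i (length us) a + b) (splice_at i us ts))"
      using 1 assms(5) by (simp add: vertices_before_def)
    then show ?thesis using 3 by simp
  qed (use assms in \<open>auto simp: splice_at_def block_start_def vertices_before_def min_def\<close>)
qed

text \<open>The two parts of the bar differential that concern the \<open>i\<close>-th child of the root.\<close>

definition root_contract :: "('k::field, 'p::ab_group_add, 'z) operad_data_scheme \<Rightarrow> 'p \<Rightarrow> nat \<Rightarrow>
    'p tree list \<Rightarrow> ('p tree \<Rightarrow>\<^sub>0 'k)" where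
  "root_contract P p i ts =
     (case ts ! i of Leaf l \<Rightarrow> 0
      | Node q us \<Rightarrow> basis_vec (Node (partial_cmp P p (length ts) i q (length us)) (splice_at i us ts)))"

definition child_diff :: "('k::field, 'p::ab_group_add, 'z) operad_data_scheme \<Rightarrow> 'p \<Rightarrow> nat \<Rightarrow>
    'p tree list \<Rightarrow> ('p tree \<Rightarrow>\<^sub>0 'k)" where
  "child_diff P p i ts = lin (\<lambda>t. basis_vec (Node p (ts[i := t]))) (bar_diff_tree P (ts ! i))"

lemma root_contract_Leaf [simp]: "ts ! i = Leaf l \<Longrightarrow> root_contract P p i ts = 0"
  and root_contract_Node: "ts ! i = Node q us \<Longrightarrow> root_contract P p i ts =
    basis_vec (Node (partial_cmp P p (length ts) i q (length us)) (splice_at i us ts))"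
  by (simp_all add: root_contract_def)

lemma child_diff_Leaf [simp]: "ts ! i = Leaf l \<Longrightarrow> child_diff P p i ts = 0"
  by (simp add: child_diff_def)

declare bar_diff_tree.simps(2) [simp del]

lemma bar_diff_tree_Node:
  "bar_diff_tree P (Node p ts) = (\<Sum>i<length ts. fscale ((-1) ^ vertices_before i ts)
     (root_contract P p i ts - child_diff P p i ts))"
  unfolding bar_diff_tree.simps(2)
  by (simp add: root_contract_def child_diff_def vertices_before_def splice_at_def
      fs.scale_right_diff_distrib sum_subtractf sum_negf cong: tree.case_cong)

lemma keys_bar_diff_Node:
  assumes "t' \<in> Poly_Mapping.keys (bar_diff_tree P (Node p ts))"
  obtains (root) i q us where "i < length ts" "ts ! i = Node q us"
      "t' = Node (partial_cmp P p (length ts) i q (length us)) (splice_at i us ts)"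
  | (child) i t where "i < length ts" "t \<in> Poly_Mapping.keys (bar_diff_tree P (ts ! i))"
      "t' = Node p (ts[i := t])"
proof -
  have "bar_diff_tree P (Node p ts) \<in> {x. Poly_Mapping.keys x \<subseteq>
      (\<Union>i<length ts. Poly_Mapping.keys (root_contract P p i ts) \<union> Poly_Mapping.keys (child_diff P p i ts))}"
    unfolding bar_diff_tree_Node
    by (intro fs.subspace_sum fs.subspace_scale fs.subspace_diff subspace_keys) auto
  then obtain i where i: "i < length ts"
    "t' \<in> Poly_Mapping.keys (root_contract P p i ts) \<or> t' \<in> Poly_Mapping.keys (child_diff P p i ts)"
    using assms by blast
  from i(2) show thesis
  proof
    assume "t' \<in> Poly_Mapping.keys (root_contract P p i ts)"
    then show thesis using root[OF i(1)] by (cases "ts ! i") (auto simp: root_contract_Node)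
  next
    assume "t' \<in> Poly_Mapping.keys (child_diff P p i ts)"
    then obtain t where "t \<in> Poly_Mapping.keys (bar_diff_tree P (ts ! i))" "t' = Node p (ts[i := t])"
      unfolding child_diff_def by (auto dest!: subsetD[OF keys_lin])
    then show thesis using child[OF i(1)] by simp
  qed
qed

lemma map_splice_at: "map f (splice_at i us ts) = splice_at i (map f us) (map f ts)"
  by (simp add: splice_at_def take_map drop_map)

lemma sum_list_splice_at:
  fixes xs :: "nat list"
  shows "i < length xs \<Longrightarrow> sum_list (splice_at i ys xs) + xs ! i = sum_list xs + sum_list ys"
  by (subst (3) id_take_nth_drop[of i xs]) (simp_all add: splice_at_def)

lemma vertices_bar_diff:
  "t' \<in> Poly_Mapping.keys (bar_diff_tree P t) \<Longrightarrow> Suc (vertices t') = vertices t"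
proof (induction t arbitrary: t')
  case (Node p ts)
  from Node.prems show ?case
  proof (cases rule: keys_bar_diff_Node)
    case (root i q us)
    then show ?thesis
      using sum_list_splice_at[of i "map vertices ts" "map vertices us"] by (simp add: map_splice_at)
  next
    case (child i t)
    then have "Suc (vertices t) = vertices (ts ! i)" using Node.IH[of "ts ! i"] by simp
    moreover have "vertices (ts ! i) \<le> sum_list (map vertices ts)"
      using child(1) by (simp add: member_le_sum_list)
    ultimately show ?thesis using child
      by (simp add: map_update sum_list_update)
  qed
qed simp

lemma leaves_bar_diff:
  "t' \<in> Poly_Mapping.keys (bar_diff_tree P t) \<Longrightarrow> leaves t' = leaves t"
proof (induction t arbitrary: t')
  case (Node p ts)
  from Node.prems show ?case
  proof (cases rule: keys_bar_diff_Node)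
    case (root i q us)
    have "concat (map leaves ts) = concat (map leaves (take i ts @ ts ! i # drop (Suc i) ts))"
      using id_take_nth_drop[OF root(1)] by simp
    then show ?thesis using root by (simp add: splice_at_def)
  next
    case (child i t)
    then have "leaves t = leaves (ts ! i)" using Node.IH[of "ts ! i"] by simp
    then have "map leaves (ts[i := t]) = map leaves ts" using child(1)
      by (simp add: map_update) (metis list_update_id nth_map)
    then show ?thesis using child by simp
  qed
qed simp

context weighted_operad
begin

lemma nonempty_length: "us \<noteq> [] \<Longrightarrow> 1 \<le> length us"
  by (cases us) auto

lemma wf_splice_at:
  assumes "wf_tree Pbar (Node p ts)" "i < length ts" "ts ! i = Node q us"
  shows "wf_tree Pbar (Node (partial_cmp P p (length ts) i q (length us)) (splice_at i us ts))"
proof -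
  have wf: "wf_tree Pbar (Node q us)" using assms nth_mem[OF assms(2)] by auto
  then have "partial_cmp P p (length ts) i q (length us) \<in> car Pbar (length ts + length us - 1)"
    using assms nonempty_length by (intro car_Pbar_partial_cmp) auto
  moreover have "splice_at i us ts \<noteq> []" using wf by (simp add: splice_at_def)
  ultimately show ?thesis using assms wf set_splice_at[of i us ts] by (auto simp: length_splice_at)
qed

lemma wf_bar_diff:
  "t' \<in> Poly_Mapping.keys (bar_diff_tree P t) \<Longrightarrow> wf_tree Pbar t \<Longrightarrow> wf_tree Pbar t'"
proof (induction t arbitrary: t')
  case (Node p ts)
  from Node.prems(1) show ?case
  proof (cases rule: keys_bar_diff_Node)
    case (root i q us)
    then show ?thesis using wf_splice_at Node.prems(2) by blast
  next
    case (child i t)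
    then have "wf_tree Pbar t" using Node.IH[of "ts ! i" t] Node.prems(2) by simp
    then show ?thesis using child Node.prems(2) set_update_subset_insert[of ts i t] by auto
  qed
qed simp

lemma weight_bar_diff:
  "t' \<in> Poly_Mapping.keys (bar_diff_tree P t) \<Longrightarrow> wf_tree Pbar t \<Longrightarrow> tree_weight W t d \<Longrightarrow> tree_weight W t' d"
proof (induction t arbitrary: t' d)
  case (Node p ts)
  from Node.prems(3) obtain d0 ds where d: "d = d0 + sum_list ds" "1 \<le> d0" "p \<in> W d0 (length ts)"
    "list_all2 (tree_weight W) ts ds" by (auto elim: tree_weight.cases)
  from Node.prems(1) show ?case
  proof (cases rule: keys_bar_diff_Node)
    case (root i q us)
    have len: "length ds = length ts" using d(4) by (simp add: list_all2_lengthD)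
    have "us \<noteq> []" using Node.prems(2) root(1,2) nth_mem[OF root(1)] by auto
    have "tree_weight W (Node q us) (ds ! i)" using d(4) root(1,2) by (metis list_all2_nthD)
    then obtain d1 es where e: "ds ! i = d1 + sum_list es" "1 \<le> d1" "q \<in> W d1 (length us)"
      "list_all2 (tree_weight W) us es" by (auto elim: tree_weight.cases)
    have "partial_cmp P p (length ts) i q (length us) \<in> W (d0 + d1) (length (splice_at i us ts))"
      using W_partial_cmp[OF root(1) nonempty_length[OF \<open>us \<noteq> []\<close>] d(3) e(3)] root(1)
      by (simp add: length_splice_at)
    moreover have "list_all2 (tree_weight W) (splice_at i us ts) (splice_at i es ds)"
      unfolding splice_at_def using d(4) e(4)
      by (intro list_all2_appendI) (auto simp: list_all2_takeI list_all2_dropI)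
    ultimately have "tree_weight W t' (d0 + d1 + sum_list (splice_at i es ds))"
      unfolding root(3) using d(2) by (intro tree_weight.intros) auto
    moreover have "d0 + d1 + sum_list (splice_at i es ds) = d"
      using sum_list_splice_at[of i ds es] e(1) d(1) len root(1) by simp
    ultimately show ?thesis by simp
  next
    case (child i t)
    have "tree_weight W (ts ! i) (ds ! i)" using d(4) child(1) by (metis list_all2_nthD)
    then have "tree_weight W t (ds ! i)" using Node.IH[of "ts ! i" t] child Node.prems(2) by simp
    then have "list_all2 (tree_weight W) (ts[i := t]) (ds[i := ds ! i])"
      using d(4) by (intro list_all2_update_cong) auto
    then have "list_all2 (tree_weight W) (ts[i := t]) ds" by simp
    then show ?thesis using child d by (auto intro: tree_weight.intros)
  qed
qed simp

abbreviation null :: "('p tree \<Rightarrow>\<^sub>0 'k) set" where "null \<equiv> bar_null P W"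

lemma subspace_null: "fs.subspace null"
  by (simp add: bar_null_def subspace_tree_null)

lemmas null_sum = fs.subspace_sum[OF subspace_null]
  and null_scale = fs.subspace_scale[OF subspace_null]
  and null_diff = fs.subspace_diff[OF subspace_null]

lemmas null_intros = fs.subspace_diff[OF subspace_null] fs.subspace_add[OF subspace_null]
  fs.subspace_scale[OF subspace_null] fs.subspace_sum[OF subspace_null] fs.subspace_0[OF subspace_null]

lemma null_context:
  assumes "x \<in> null" "j < length ts" "a \<in> car Pbar (length ts)"
    and "\<And>k. k < length ts \<Longrightarrow> k \<noteq> j \<Longrightarrow> wf_tree Pbar (ts ! k)"
  shows "lin (\<lambda>t. basis_vec (Node a (ts[j := t]))) x \<in> null"
  using assms unfolding bar_null_def by (rule tree_null_context)

lemma null_linear: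
  assumes "wf_tree Pbar (Node a ts)" "wf_tree Pbar (Node b ts)"
  shows "basis_vec (Node (scl P c a + b) ts) - fscale c (basis_vec (Node a ts)) - basis_vec (Node b ts) \<in> null"
  using tree_rel.linear[OF assms, of c 1] unfolding bar_null_def by (simp add: tree_rel_null)

lemma null_equiv:
  assumes "wf_tree Pbar (Node a ts)" "\<sigma> permutes {..<length ts}"
  shows "basis_vec (Node (act P (length ts) a \<sigma>) ts) -
    fscale ((-1) ^ inv_sum (length ts) \<sigma> (\<lambda>a. vertices (ts ! a)))
      (basis_vec (Node a (permute_list (inv \<sigma>) ts))) \<in> null"
  using tree_rel.equiv[OF assms, of 1] unfolding bar_null_def
  by (simp add: tree_rel_null koszul_sign_inv_sum)

lemma bar_diff_linear_rel:
  assumes wf: "wf_tree Pbar (Node a ts)" "wf_tree Pbar (Node b ts)"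
  shows "bar_diff_tree P (Node (scl P c a + b) ts) - fscale c (bar_diff_tree P (Node a ts)) -
    bar_diff_tree P (Node b ts) \<in> null"
proof -
  have car: "a \<in> car P (length ts)" "b \<in> car P (length ts)"
    using wf car_Pbar_subset[OF nonempty_length[of ts]] by auto
  have rc: "root_contract P (scl P c a + b) i ts - fscale c (root_contract P a i ts) - root_contract P b i ts \<in> null"
    if i: "i < length ts" for i
  proof (cases "ts ! i")
    case (Node q us)
    then have q: "wf_tree Pbar (Node q us)" using wf(1) i nth_mem[OF i] by auto
    then have "q \<in> car P (length us)" using car_Pbar_subset[OF nonempty_length[of us]] by auto
    then have "partial_cmp P (scl P c a + b) (length ts) i q (length us) =
      scl P c (partial_cmp P a (length ts) i q (length us)) + partial_cmp P b (length ts) i q (length us)"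
      using i car q nonempty_length by (intro partial_cmp_linear_outer) auto
    then show ?thesis
      using null_linear[OF wf_splice_at[OF wf(1) i Node] wf_splice_at[OF wf(2) i Node]]
      by (simp add: root_contract_Node[OF Node])
  qed (simp add: null_intros)
  have cd: "child_diff P (scl P c a + b) i ts - fscale c (child_diff P a i ts) - child_diff P b i ts \<in> null"
    if i: "i < length ts" for i
  proof -
    have "child_diff P (scl P c a + b) i ts - fscale c (child_diff P a i ts) - child_diff P b i ts =
      (\<Sum>t\<in>Poly_Mapping.keys (bar_diff_tree P (ts ! i)). fscale (Poly_Mapping.lookup (bar_diff_tree P (ts ! i)) t)
        (basis_vec (Node (scl P c a + b) (ts[i := t])) - fscale c (basis_vec (Node a (ts[i := t])))
           - basis_vec (Node b (ts[i := t]))))"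
      by (simp add: child_diff_def lin_def fs.scale_right_diff_distrib sum_subtractf fs.scale_sum_right
          mult.commute)
    moreover have "wf_tree Pbar (Node a (ts[i := t]))" "wf_tree Pbar (Node b (ts[i := t]))"
      if "t \<in> Poly_Mapping.keys (bar_diff_tree P (ts ! i))" for t
      using wf_bar_diff[OF that] wf i nth_mem[OF i] set_update_subset_insert[of ts i t] by auto
    ultimately show ?thesis by (simp only:) (rule null_sum, rule null_scale, rule null_linear)
  qed
  have "bar_diff_tree P (Node (scl P c a + b) ts) - fscale c (bar_diff_tree P (Node a ts)) -
    bar_diff_tree P (Node b ts) =
    (\<Sum>i<length ts. fscale ((-1) ^ vertices_before i ts)
      ((root_contract P (scl P c a + b) i ts - fscale c (root_contract P a i ts) - root_contract P b i ts) -
       (child_diff P (scl P c a + b) i ts - fscale c (child_diff P a i ts) - child_diff P b i ts)))"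
    unfolding bar_diff_tree_Node fs.scale_sum_right sum_subtractf[symmetric]
    by (intro sum.cong refl) (simp add: algebra_simps fs.scale_right_diff_distrib fs.scale_right_distrib mult.commute)
  also have "\<dots> \<in> null"
    by (rule null_sum, rule null_scale, rule null_diff) (simp_all add: rc cd)
  finally show ?thesis .
qed

text \<open>
  The term for the \<open>i\<close>-th child on one side corresponds to the term for the \<open>\<sigma> i\<close>-th child on the
  other side, where this child stands after the permutation. The decorations agree because partial
  compositions are equivariant, the signs by \<open>inv_sum_remove_vertex\<close>.
\<close>

lemma bar_diff_equiv_rel:
  assumes wf: "wf_tree Pbar (Node a ts)" and \<sigma>: "\<sigma> permutes {..<length ts}"
  shows "bar_diff_tree P (Node (act P (length ts) a \<sigma>) ts) -
    fscale ((-1) ^ inv_sum (length ts) \<sigma> (\<lambda>a. vertices (ts ! a)))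
      (bar_diff_tree P (Node a (permute_list (inv \<sigma>) ts))) \<in> null"
proof -
  let ?m = "length ts" and ?v = "\<lambda>a. vertices (ts ! a)"
  let ?us = "permute_list (inv \<sigma>) ts" and ?a = "act P (length ts) a \<sigma>"
  let ?\<kappa> = "(-1 :: 'k) ^ inv_sum ?m \<sigma> ?v"
  have \<sigma>m: "\<sigma> k < ?m" if "k < ?m" for k using permutes_in_image[OF \<sigma>] that by auto
  have us: "?us ! \<sigma> k = ts ! k" if "k < ?m" for k by (rule nth_permute_list_inv[OF \<sigma> that])
  have car: "a \<in> car P ?m" using wf car_Pbar_subset[OF nonempty_length[of ts]] by auto
  have before: "vertices_before (\<sigma> i) ?us = (\<Sum>k | k < ?m \<and> \<sigma> k < \<sigma> i. ?v k)" if i: "i < ?m" for i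
  proof -
    have "vertices_before (\<sigma> i) ?us = (\<Sum>k<\<sigma> i. vertices (?us ! k))"
      using \<sigma>m[OF i] by (intro vertices_before_sum) simp
    also have "\<dots> = (\<Sum>k | k < ?m \<and> \<sigma> k < \<sigma> i. vertices (?us ! \<sigma> k))"
    proof (rule sum.reindex_bij_witness[of _ \<sigma> "inv \<sigma>"])
      fix k assume k: "k \<in> {..<\<sigma> i}"
      then have "k \<in> {..<?m}" using \<sigma>m[OF i] by auto
      then have "inv \<sigma> k < ?m" using permutes_in_image[OF permutes_inv[OF \<sigma>], of k] by simp
      then show "inv \<sigma> k \<in> {k. k < ?m \<and> \<sigma> k < \<sigma> i}" using k by (simp add: permutes_inverses[OF \<sigma>])
    qed (simp_all add: permutes_inverses[OF \<sigma>])
    also have "\<dots> = (\<Sum>k | k < ?m \<and> \<sigma> k < \<sigma> i. ?v k)" by (intro sum.cong refl) (simp add: us)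
    finally show ?thesis .
  qed
  have diff: "fscale ((-1) ^ vertices_before i ts) (root_contract P ?a i ts - child_diff P ?a i ts) -
      fscale ?\<kappa> (fscale ((-1) ^ vertices_before (\<sigma> i) ?us)
        (root_contract P a (\<sigma> i) ?us - child_diff P a (\<sigma> i) ?us)) \<in> null" if i: "i < ?m" for i
  proof (cases "ts ! i")
    case (Leaf l)
    then show ?thesis using us[OF i] by (simp add: null_intros)
  next
    case (Node q ws)
    let ?w = "?v(i := ?v i - 1)"
    let ?\<theta> = "(-1 :: 'k) ^ inv_sum ?m \<sigma> ?w"
    have vi: "1 \<le> ?v i" using Node by simp
    have sign: "(-1) ^ vertices_before i ts * ?\<theta> = ?\<kappa> * (-1) ^ vertices_before (\<sigma> i) ?us"
      using inv_sum_remove_vertex[where v = ?v and 'k = 'k, OF \<sigma> i vi] before[OF i] vertices_before_sum[of i ts] i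
      by simp
    have q: "wf_tree Pbar (Node q ws)" using wf i nth_mem[OF i] Node by auto
    then have ws: "ws \<noteq> []" "1 \<le> length ws" using nonempty_length[of ws] by auto
    then have qcar: "q \<in> car P (length ws)" using q car_Pbar_subset[OF ws(2)] by auto
    have rc: "root_contract P ?a i ts - fscale ?\<theta> (root_contract P a (\<sigma> i) ?us) \<in> null"
    proof -
      let ?\<beta> = "block_perm ?m i (length ws) \<sigma>" and ?L = "splice_at i ws ts"
      let ?p = "partial_cmp P a ?m (\<sigma> i) q (length ws)"
      have len: "length ?L = ?m + length ws - 1" using i by (rule length_splice_at)
      have "?p \<in> car Pbar (length ?L)"
        unfolding len using wf q \<sigma>m[OF i] ws by (intro car_Pbar_partial_cmp) auto
      then have wfL: "wf_tree Pbar (Node ?p ?L)"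
        using wf_splice_at[OF wf i Node] by simp
      have \<beta>: "?\<beta> permutes {..<length ?L}" unfolding len by (rule block_perm_permutes[OF \<sigma> i ws(2)])
      have "inv_sum (?m + length ws - 1) ?\<beta> (\<lambda>k. vertices (?L ! k)) = inv_sum ?m \<sigma> ?w"
      proof (rule inv_sum_block_perm[OF \<sigma> i ws(2)])
        fix k assume k: "k < ?m"
        have "(\<Sum>b<(if k = i then length ws else 1). vertices (?L ! (block_start i (length ws) k + b))) =
          (\<Sum>b<(if k = i then length ws else 1). vertices (if k = i then ws ! b else ts ! k))"
          using splice_at_nth[OF i k _ ws(1)] by (intro sum.cong refl) (simp only: lessThan_iff)
        also have "\<dots> = ?w k" using Node by (simp add: sum_list_sum_nth atLeast0LessThan)
        finally show "(\<Sum>b<(if k = i then length ws else 1). vertices (?L ! (block_start i (length ws) k + b))) = ?w k" .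
      qed
      moreover have "partial_cmp P ?a ?m i q (length ws) = act P (length ?L) ?p ?\<beta>"
        unfolding len using partial_cmp_act_outer[OF i ws(2) car qcar \<sigma>] .
      moreover have "permute_list (inv ?\<beta>) ?L = splice_at (\<sigma> i) ws ?us"
        by (rule permute_splice_at[OF \<sigma> i ws(1)])
      ultimately show ?thesis
        using null_equiv[OF wfL \<beta>] root_contract_Node[of ts i q ws P ?a, OF Node]
          root_contract_Node[of ?us "\<sigma> i" q ws P a] us[OF i] Node
        by (simp add: len)
    qed
    have cd: "child_diff P ?a i ts - fscale ?\<theta> (child_diff P a (\<sigma> i) ?us) \<in> null"
    proof -
      let ?y = "bar_diff_tree P (ts ! i)"
      have eq: "child_diff P ?a i ts - fscale ?\<theta> (child_diff P a (\<sigma> i) ?us) =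
        (\<Sum>t\<in>Poly_Mapping.keys ?y. fscale (Poly_Mapping.lookup ?y t)
          (basis_vec (Node ?a (ts[i := t])) - fscale ?\<theta> (basis_vec (Node a (?us[\<sigma> i := t])))))"
        by (simp add: child_diff_def us[OF i] lin_def fs.scale_right_diff_distrib sum_subtractf
            fs.scale_sum_right mult.commute)
      have "basis_vec (Node ?a (ts[i := t])) - fscale ?\<theta> (basis_vec (Node a (?us[\<sigma> i := t]))) \<in> null"
        if t: "t \<in> Poly_Mapping.keys ?y" for t
      proof -
        have "wf_tree Pbar (Node a (ts[i := t]))"
          using wf_bar_diff[OF t] wf i nth_mem[OF i] set_update_subset_insert[of ts i t] by auto
        moreover have "inv_sum ?m \<sigma> (\<lambda>k. vertices (ts[i := t] ! k)) = inv_sum ?m \<sigma> ?w"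
          using vertices_bar_diff[OF t] i by (intro inv_sum_cong) (auto simp: nth_list_update)
        ultimately show ?thesis
          using null_equiv[of a "ts[i := t]" \<sigma>] \<sigma> permute_list_update[OF \<sigma> i] by simp
      qed
      then show ?thesis unfolding eq by (intro null_sum null_scale)
    qed
    have "fscale ((-1) ^ vertices_before i ts) (root_contract P ?a i ts - child_diff P ?a i ts) -
      fscale ?\<kappa> (fscale ((-1) ^ vertices_before (\<sigma> i) ?us)
        (root_contract P a (\<sigma> i) ?us - child_diff P a (\<sigma> i) ?us)) =
      fscale ((-1) ^ vertices_before i ts)
        ((root_contract P ?a i ts - fscale ?\<theta> (root_contract P a (\<sigma> i) ?us)) -
         (child_diff P ?a i ts - fscale ?\<theta> (child_diff P a (\<sigma> i) ?us)))"
      unfolding fs.scale_scale sign[symmetric]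
      by (simp add: fs.scale_right_diff_distrib algebra_simps)
    then show ?thesis by (simp only:) (rule null_scale, rule null_diff[OF rc cd])
  qed
  have "bar_diff_tree P (Node a ?us) = (\<Sum>i<?m. fscale ((-1) ^ vertices_before (\<sigma> i) ?us)
        (root_contract P a (\<sigma> i) ?us - child_diff P a (\<sigma> i) ?us))"
    unfolding bar_diff_tree_Node
    using sum.permute[OF \<sigma>, of "\<lambda>i. fscale ((-1) ^ vertices_before i ?us)
        (root_contract P a i ?us - child_diff P a i ?us)"] by (simp add: o_def)
  then have "bar_diff_tree P (Node ?a ts) - fscale ?\<kappa> (bar_diff_tree P (Node a ?us)) =
    (\<Sum>i<?m. fscale ((-1) ^ vertices_before i ts) (root_contract P ?a i ts - child_diff P ?a i ts) -
      fscale ?\<kappa> (fscale ((-1) ^ vertices_before (\<sigma> i) ?us)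
        (root_contract P a (\<sigma> i) ?us - child_diff P a (\<sigma> i) ?us)))"
    by (simp only: bar_diff_tree_Node[of P ?a] fs.scale_sum_right sum_subtractf)
  then show ?thesis by (simp only:) (rule null_sum, rule diff, simp)
qed

end

section \<open>The bar complex\<close>

lemma splice_at_same [simp]: "splice_at k us (ts[k := t]) = splice_at k us ts"
  by (simp add: splice_at_def)

lemma splice_at_update_inner:
  "k < length ts \<Longrightarrow> j < length us \<Longrightarrow> splice_at k (us[j := t]) ts = (splice_at k us ts)[k + j := t]"
  by (simp add: splice_at_def list_update_append)

lemma splice_at_inner_nth:
  "k < length ts \<Longrightarrow> b < length us \<Longrightarrow> splice_at k us ts ! (k + b) = us ! b"
  by (simp add: splice_at_def nth_append)

lemma splice_at_splice_at_inner:
  assumes "i < length ts" "b < length us"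
  shows "splice_at (i + b) ws (splice_at i us ts) = splice_at i (splice_at b ws us) ts"
  using assms by (simp add: splice_at_def)

lemma splice_at_splice_at_outer:
  assumes "i < j" "j < length ts" "us \<noteq> []"
  shows "splice_at (j + length us - 1) ws (splice_at i us ts) = splice_at i us (splice_at j ws ts)"
proof -
  define A where "A = take i ts"
  define B where "B = take (j - Suc i) (drop (Suc i) ts)"
  define C where "C = drop (Suc j) ts"
  have "drop (Suc i) ts = B @ ts ! j # C"
    using id_take_nth_drop[of "j - Suc i" "drop (Suc i) ts"] assms by (simp add: B_def C_def)
  then have ts: "ts = A @ ts ! i # B @ ts ! j # C"
    using id_take_nth_drop[of i ts] assms by (simp add: A_def)
  have lens: "i = length A" "j = length (A @ ts ! i # B)" "j + length us - 1 = length (A @ us @ B)"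
    using assms by (auto simp: A_def B_def)
  have "splice_at i us ts = (A @ us @ B) @ ts ! j # C"
    using splice_at_append[of A us "ts ! i" "B @ ts ! j # C"] lens(1) ts by simp
  then have "splice_at (j + length us - 1) ws (splice_at i us ts) = A @ us @ B @ ws @ C"
    using splice_at_append[of "A @ us @ B" ws "ts ! j" C] lens(3) by simp
  moreover have "splice_at j ws ts = A @ ts ! i # B @ ws @ C"
    using splice_at_append[of "A @ ts ! i # B" ws "ts ! j" C] lens(2) ts by simp
  then have "splice_at i us (splice_at j ws ts) = A @ us @ B @ ws @ C"
    by (simp only: lens(1) splice_at_append append_assoc)
  ultimately show ?thesis by simp
qed

context weighted_operad
begin

text \<open>
  Applying the differential to a relation inside a larger tree involves contracting the edge between
  this tree and the root of the relation. Therefore the induction carries along that such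
  contractions respect the relations.
\<close>

lemma bar_diff_rel:
  assumes "r \<in> tree_rel 1 Pbar"
  shows "lin (bar_diff_tree P) r \<in> null \<and>
    (\<forall>p L k. k < length L \<longrightarrow> p \<in> car Pbar (length L) \<longrightarrow>
       (\<forall>j<length L. j \<noteq> k \<longrightarrow> wf_tree Pbar (L ! j)) \<longrightarrow>
       lin (\<lambda>t. root_contract P p k (L[k := t])) r \<in> null)"
  using assms
proof induction
  case (linear a ts b c)
  have n: "1 \<le> length ts" using linear nonempty_length by auto
  have car: "a \<in> car P (length ts)" "b \<in> car P (length ts)"
    using linear car_Pbar_subset[OF n] by auto
  show ?case
  proof (intro conjI allI impI)
    show "lin (bar_diff_tree P) (basis_vec (Node (scl Pbar c a + b) ts) -
        fscale c (basis_vec (Node a ts)) - basis_vec (Node b ts)) \<in> null"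
      using bar_diff_linear_rel[OF linear] by (simp add: lin_diff lin_scale)
  next
    fix p L k
    assume k: "k < length L" and p: "p \<in> car Pbar (length L)"
      and wf: "\<forall>j<length L. j \<noteq> k \<longrightarrow> wf_tree Pbar (L ! j)"
    have wfL: "wf_tree Pbar (Node p (L[k := x]))" if "wf_tree Pbar x" for x
      using that k p wf by (auto simp: in_set_conv_nth nth_list_update)
    have "p \<in> car P (length L)" using p k car_Pbar_subset[of "length L"] by auto
    then have "partial_cmp P p (length L) k (scl P c a + b) (length ts) =
        scl P c (partial_cmp P p (length L) k a (length ts)) + partial_cmp P p (length L) k b (length ts)"
      using k n car by (intro partial_cmp_linear_inner) auto
    then show "lin (\<lambda>t. root_contract P p k (L[k := t])) (basis_vec (Node (scl Pbar c a + b) ts) -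
        fscale c (basis_vec (Node a ts)) - basis_vec (Node b ts)) \<in> null"
      using null_linear[of "partial_cmp P p (length L) k a (length ts)" "splice_at k ts L"
          "partial_cmp P p (length L) k b (length ts)" c]
        wf_splice_at[OF wfL[OF linear(1)], of k a ts] wf_splice_at[OF wfL[OF linear(2)], of k b ts] k
      by (simp add: lin_diff lin_scale root_contract_Node)
  qed
next
  case (equiv a ts \<sigma>)
  have n: "1 \<le> length ts" using equiv nonempty_length by auto
  have car: "a \<in> car P (length ts)" using equiv car_Pbar_subset[OF n] by auto
  have sign: "koszul_sign 1 \<sigma> ts = (-1 :: 'k) ^ inv_sum (length ts) \<sigma> (\<lambda>a. vertices (ts ! a))"
    by (simp add: koszul_sign_inv_sum)
  show ?case
  proof (intro conjI allI impI)
    show "lin (bar_diff_tree P) (basis_vec (Node (act Pbar (length ts) a \<sigma>) ts) -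
        fscale (koszul_sign 1 \<sigma> ts) (basis_vec (Node a (permute_list (inv \<sigma>) ts)))) \<in> null"
      using bar_diff_equiv_rel[OF equiv] unfolding sign by (simp add: lin_diff lin_scale)
  next
    fix p L k
    assume k: "k < length L" and p: "p \<in> car Pbar (length L)"
      and wf: "\<forall>j<length L. j \<noteq> k \<longrightarrow> wf_tree Pbar (L ! j)"
    let ?\<beta> = "inner_perm k (length ts) \<sigma>" and ?S = "splice_at k ts L"
    have len: "length ?S = length L + length ts - 1" using k by (rule length_splice_at)
    have "wf_tree Pbar (Node p (L[k := Node a ts]))"
      using equiv k p wf by (auto simp: in_set_conv_nth nth_list_update)
    then have wfS: "wf_tree Pbar (Node (partial_cmp P p (length L) k a (length ts)) ?S)"
      using wf_splice_at[of p "L[k := Node a ts]" k a ts] k by simp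
    have \<beta>: "?\<beta> permutes {..<length ?S}"
      using inner_perm_permutes[OF equiv(2), of k] k n len by simp
    have "partial_cmp P p (length L) k (act P (length ts) a \<sigma>) (length ts) =
        act P (length ?S) (partial_cmp P p (length L) k a (length ts)) ?\<beta>"
      unfolding len using k n p car car_Pbar_subset[of "length L"] equiv(2)
      by (intro partial_cmp_act_inner) auto
    moreover have "inv_sum (length ?S) ?\<beta> (\<lambda>a. vertices (?S ! a)) =
        inv_sum (length ts) \<sigma> (\<lambda>a. vertices (ts ! a))"
    proof -
      have "inv_sum (length ?S) ?\<beta> (\<lambda>a. vertices (?S ! a)) =
          inv_sum (length ts) \<sigma> (\<lambda>b. vertices (?S ! (k + b)))"
        using k n len by (intro inv_sum_inner_perm[OF equiv(2)]) simp
      also have "\<dots> = inv_sum (length ts) \<sigma> (\<lambda>a. vertices (ts ! a))"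
        using k by (intro inv_sum_cong) (simp add: splice_at_inner_nth)
      finally show ?thesis .
    qed
    moreover have "permute_list (inv ?\<beta>) ?S = splice_at k (permute_list (inv \<sigma>) ts) L"
      using permute_inner[OF equiv(2), of "take k L" "drop (Suc k) L"] k
      by (simp add: splice_at_def min_def)
    ultimately show "lin (\<lambda>t. root_contract P p k (L[k := t]))
        (basis_vec (Node (act Pbar (length ts) a \<sigma>) ts) -
         fscale (koszul_sign 1 \<sigma> ts) (basis_vec (Node a (permute_list (inv \<sigma>) ts)))) \<in> null"
      using null_equiv[OF wfS \<beta>] k unfolding sign
      by (simp add: lin_diff lin_scale root_contract_Node)
  qed
next
  case (in_context r a us l vs)
  define ts where "ts = us @ Leaf l # vs"
  define j where "j = length us"
  have upd: "us @ t # vs = ts[j := t]" for t by (simp add: ts_def j_def)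
  have j: "j < length ts" by (simp add: ts_def j_def)
  have wf: "wf_tree Pbar (Node a ts)" using in_context ts_def by simp
  then have a: "a \<in> car Pbar (length ts)" and wfts: "\<And>k. k < length ts \<Longrightarrow> wf_tree Pbar (ts ! k)"
    by auto
  have r: "r \<in> null" using in_context(1) unfolding bar_null_def by (rule tree_rel_null)
  from in_context.IH have IH1: "lin (bar_diff_tree P) r \<in> null"
    and IH2: "lin (\<lambda>t. root_contract P a j (ts[j := t])) r \<in> null"
    using j a wfts by auto
  have sgn: "\<exists>s. \<forall>t\<in>Poly_Mapping.keys r. (-1 :: 'k) ^ vertices_before i (ts[j := t]) = s" for i
  proof -
    obtain v where "\<forall>t\<in>Poly_Mapping.keys r. vertices t = v"
      using tree_rel_homogeneous[OF in_context(1)] by blast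
    then show ?thesis
      by (cases "Poly_Mapping.keys r = {}") (auto, metis vertices_before_update)
  qed
  have rc: "lin (\<lambda>t. root_contract P a i (ts[j := t])) r \<in> null" if i: "i < length ts" for i
  proof (cases "i = j")
    case True
    then show ?thesis using IH2 by simp
  next
    case False
    show ?thesis
    proof (cases "ts ! i")
      case (Leaf l')
      then show ?thesis using False by (simp add: null_intros)
    next
      case (Node q ws)
      then have ws: "ws \<noteq> []" using wfts[OF i] by auto
      let ?p = "partial_cmp P a (length ts) i q (length ws)"
      have "root_contract P a i (ts[j := t]) =
          basis_vec (Node ?p ((splice_at i ws ts)[block_start i (length ws) j := t]))" for t
        using False Node splice_at_update[OF i j False ws] by (simp add: root_contract_Node)
      moreover have "block_start i (length ws) j < length (splice_at i ws ts)"
        using block_start_bound[of j "length ts" 0 i "length ws"] i j False nonempty_length[OF ws]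
        by (simp add: length_splice_at)
      ultimately show ?thesis
        using wf_splice_at[OF wf i Node] by (simp del: wf_tree_Node) (intro null_context r, auto)
    qed
  qed
  have cd: "lin (\<lambda>t. child_diff P a i (ts[j := t])) r \<in> null" if i: "i < length ts" for i
  proof (cases "i = j")
    case True
    then have "lin (\<lambda>t. child_diff P a i (ts[j := t])) r =
        lin (\<lambda>t. basis_vec (Node a (ts[j := t]))) (lin (bar_diff_tree P) r)"
      using j by (simp add: child_diff_def lin_lin)
    also have "\<dots> \<in> null" using null_context[OF IH1 j a] wfts by blast
    finally show ?thesis .
  next
    case False
    have "lin (\<lambda>t. child_diff P a i (ts[j := t])) r =
        lin (\<lambda>t'. lin (\<lambda>t. basis_vec (Node a ((ts[i := t'])[j := t]))) r) (bar_diff_tree P (ts ! i))"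
      using False unfolding child_diff_def by (subst lin_swap) (simp add: list_update_swap)
    also have "\<dots> \<in> null"
      using wf_bar_diff wfts i j a
      by (intro lin_in_subspace subspace_null null_context r) (auto simp: nth_list_update)
    finally show ?thesis .
  qed
  show ?case
  proof (intro conjI allI impI)
    have "lin (bar_diff_tree P) (lin (\<lambda>t. basis_vec (Node a (us @ t # vs))) r) =
      (\<Sum>i<length ts. lin (\<lambda>t. fscale ((-1) ^ vertices_before i (ts[j := t]))
        (root_contract P a i (ts[j := t]) - child_diff P a i (ts[j := t]))) r)"
      unfolding upd lin_lin lin_basis bar_diff_tree_Node by (simp add: lin_fun_sum)
    also have "\<dots> \<in> null"
    proof (rule null_sum)
      fix i assume "i \<in> {..<length ts}"
      then have i: "i < length ts" by simp
      obtain s where s: "\<forall>t\<in>Poly_Mapping.keys r. (-1 :: 'k) ^ vertices_before i (ts[j := t]) = s"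
        using sgn by blast
      have "lin (\<lambda>t. fscale ((-1) ^ vertices_before i (ts[j := t]))
          (root_contract P a i (ts[j := t]) - child_diff P a i (ts[j := t]))) r =
          lin (\<lambda>t. fscale s (root_contract P a i (ts[j := t]) + fscale (-1) (child_diff P a i (ts[j := t])))) r"
        using s by (intro lin_cong) simp
      also have "\<dots> = fscale s (lin (\<lambda>t. root_contract P a i (ts[j := t])) r +
          fscale (-1) (lin (\<lambda>t. child_diff P a i (ts[j := t])) r))"
        by (simp only: lin_fun_scale lin_fun_add)
      also have "\<dots> \<in> null" using rc[OF i] cd[OF i] by (intro null_intros)
      finally show "lin (\<lambda>t. fscale ((-1) ^ vertices_before i (ts[j := t]))
          (root_contract P a i (ts[j := t]) - child_diff P a i (ts[j := t]))) r \<in> null" .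
    qed
    finally show "lin (bar_diff_tree P) (lin (\<lambda>t. basis_vec (Node a (us @ t # vs))) r) \<in> null" .
  next
    fix p L k
    assume k: "k < length L" and p: "p \<in> car Pbar (length L)"
      and wfL: "\<forall>j<length L. j \<noteq> k \<longrightarrow> wf_tree Pbar (L ! j)"
    let ?p = "partial_cmp P p (length L) k a (length ts)"
    have "wf_tree Pbar (Node p (L[k := Node a ts]))"
      using wf k p wfL by (auto simp: in_set_conv_nth nth_list_update)
    then have wfS: "wf_tree Pbar (Node ?p (splice_at k ts L))"
      using wf_splice_at[of p "L[k := Node a ts]" k a ts] k by simp
    have "lin (\<lambda>t. root_contract P p k (L[k := t])) (lin (\<lambda>t. basis_vec (Node a (us @ t # vs))) r) =
        lin (\<lambda>t. basis_vec (Node ?p ((splice_at k ts L)[k + j := t]))) r"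
      unfolding upd lin_lin using k j by (simp add: root_contract_Node splice_at_update_inner)
    also have "\<dots> \<in> null"
      using wfS k j length_splice_at[OF k, of ts] by (intro null_context r) auto
    finally show "lin (\<lambda>t. root_contract P p k (L[k := t]))
      (lin (\<lambda>t. basis_vec (Node a (us @ t # vs))) r) \<in> null" .
  qed
qed

theorem bar_diff_null: "x \<in> null \<Longrightarrow> bar_diff P x \<in> null"
  unfolding bar_diff_def using bar_diff_rel tree_null_lin[OF _ _ subspace_null, of x 1 Pbar]
  by (simp add: bar_null_def)

text \<open>
  Contracting an edge inside the \<open>i\<close>-th child and then its edge to the root is the same as contracting
  the edge to the root first, by sequential associativity.
\<close>

lemma bar_diff_contracted_child:
  assumes i: "i < length ts" and Node: "ts ! i = Node q us" and wf: "wf_tree Pbar (Node p ts)"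
  defines "p' \<equiv> partial_cmp P p (length ts) i q (length us)"
  shows "lin (\<lambda>t. root_contract P p i (ts[i := t])) (bar_diff_tree P (ts ! i)) =
    (\<Sum>b<length us. fscale ((-1) ^ vertices_before b us)
       (root_contract P p' (i + b) (splice_at i us ts) - child_diff P p' (i + b) (splice_at i us ts)))"
proof -
  let ?F = "\<lambda>t. root_contract P p i (ts[i := t])" and ?L = "splice_at i us ts"
  have wfq: "wf_tree Pbar (Node q us)" using wf i nth_mem[OF i] Node by auto
  then have n: "1 \<le> length us" using nonempty_length by auto
  have car: "p \<in> car P (length ts)" "q \<in> car P (length us)"
    using wf wfq n car_Pbar_subset[OF nonempty_length[of ts]] car_Pbar_subset[OF n] by auto
  have rc: "lin ?F (root_contract P q b us) = root_contract P p' (i + b) ?L" if b: "b < length us" for b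
  proof (cases "us ! b")
    case (Leaf l)
    then show ?thesis using splice_at_inner_nth[OF i b] by simp
  next
    case (Node r ws)
    then have wfr: "wf_tree Pbar (Node r ws)" using wfq nth_mem[OF b] by auto
    then have l: "1 \<le> length ws" using nonempty_length by auto
    then have r: "r \<in> car P (length ws)" using wfr car_Pbar_subset by auto
    have "partial_cmp P p' (length ?L) (i + b) r (length ws) =
        partial_cmp P p (length ts) i (partial_cmp P q (length us) b r (length ws)) (length us + length ws - 1)"
      unfolding p'_def length_splice_at[OF i]
      by (rule partial_cmp_assoc_seq[OF i b l car r])
    then show ?thesis
      using Node i b splice_at_inner_nth[OF i b]
      by (simp add: root_contract_Node length_splice_at splice_at_splice_at_inner)
  qed
  have cd: "lin ?F (child_diff P q b us) = child_diff P p' (i + b) ?L" if b: "b < length us" for b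
    using i b splice_at_inner_nth[OF i b]
    by (simp add: child_diff_def lin_lin root_contract_Node p'_def splice_at_update_inner)
  show ?thesis
    unfolding Node bar_diff_tree_Node lin_sum lin_scale lin_diff
    using rc cd by (intro sum.cong refl) simp
qed

text \<open>
  Contracting two edges in either order gives the same tree, by associativity of the partial
  compositions. The signs are opposite: the first contraction removes a vertex that the second one
  has to pass in one of the two orders.
\<close>

theorem bar_diff_bar_diff: "wf_tree Pbar t \<Longrightarrow> bar_diff P (bar_diff_tree P t) = 0"
proof (induction t)
  case (Leaf l)
  then show ?case by (simp add: bar_diff_def)
next
  case (Node p ts)
  note wf = Node.prems
  let ?m = "length ts" and ?\<delta> = "bar_diff_tree P"
  \<comment> \<open>\<open>RR i j\<close>: contraction of the edges from the root to the children \<open>i\<close> and \<open>j\<close>; \<open>CR i j\<close>: an edge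
    inside the child \<open>i\<close>, then the edge from the root to \<open>j\<close>; \<open>CC i j\<close>: one edge inside each of the two
    children. The factor \<open>\<epsilon> i j\<close> arises because the first contraction removes a vertex, which
    affects the sign of a contraction further to the right.\<close>
  define s :: "nat \<Rightarrow> 'k" where "s i = (-1) ^ vertices_before i ts" for i
  define \<epsilon> :: "nat \<Rightarrow> nat \<Rightarrow> 'k" where "\<epsilon> i j = (if j < i then 1 else -1)" for i j
  define RR where "RR i j = (case ts ! i of Leaf l \<Rightarrow> 0 | Node q us \<Rightarrow>
    root_contract P (partial_cmp P p ?m i q (length us)) (block_start i (length us) j) (splice_at i us ts))" for i j
  define CR where "CR i j = lin (\<lambda>t. root_contract P p j (ts[i := t])) (?\<delta> (ts ! i))" for i j
  define CC where "CC i j = lin (\<lambda>t. lin (\<lambda>t'. basis_vec (Node p (ts[i := t, j := t']))) (?\<delta> (ts ! j))) (?\<delta> (ts ! i))" for i j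
  have wfts: "wf_tree Pbar (ts ! i)" if "i < ?m" for i using wf that by auto
  \<comment> \<open>The summands \<open>j = i\<close> of \<open>A\<close> and \<open>B\<close> are equal, so they cancel in the square of the
    differential.\<close>
  have A: "lin ?\<delta> (root_contract P p i ts) =
      (\<Sum>j<?m. if j = i then fscale (s i) (CR i i) else fscale (s j * \<epsilon> i j) (RR i j - CR j i))"
    if i: "i < ?m" for i
  proof (cases "ts ! i")
    case (Leaf l)
    then have "CR i i = 0" "\<And>j. RR i j = 0" by (simp_all add: CR_def RR_def)
    moreover have "CR j i = 0" if "j \<noteq> i" for j using that Leaf by (simp add: CR_def)
    ultimately show ?thesis using Leaf by (intro sum.neutral[symmetric, THEN trans[rotated]]) auto
  next
    case (Node q us)
    let ?p = "partial_cmp P p ?m i q (length us)" and ?L = "splice_at i us ts" and ?n = "length us"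
    have us: "us \<noteq> []" using wfts[OF i] Node by auto
    have n: "1 \<le> ?n" by (rule nonempty_length[OF us])
    let ?G = "\<lambda>k. fscale ((-1 :: 'k) ^ vertices_before k ?L) (root_contract P ?p k ?L - child_diff P ?p k ?L)"
    have "lin ?\<delta> (root_contract P p i ts) = (\<Sum>k<?m + ?n - 1. ?G k)"
      by (simp add: root_contract_Node[OF Node] bar_diff_tree_Node length_splice_at[OF i])
    also have "\<dots> = (\<Sum>j<?m. \<Sum>b<(if j = i then ?n else 1). ?G (block_start i ?n j + b))"
      by (rule sum_blocks[OF i n])
    also have "\<dots> = (\<Sum>j<?m. if j = i then fscale (s i) (CR i i) else fscale (s j * \<epsilon> i j) (RR i j - CR j i))"
    proof (rule sum.cong[OF refl])
      fix j assume "j \<in> {..<?m}"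
      then have j: "j < ?m" by simp
      show "(\<Sum>b<(if j = i then ?n else 1). ?G (block_start i ?n j + b)) =
          (if j = i then fscale (s i) (CR i i) else fscale (s j * \<epsilon> i j) (RR i j - CR j i))"
      proof (cases "j = i")
        case True
        have G: "?G (i + b) = fscale (s i) (fscale ((-1) ^ vertices_before b us)
            (root_contract P ?p (i + b) ?L - child_diff P ?p (i + b) ?L))" if "b < ?n" for b
          using vertices_before_splice_at[OF i i, of b us q, where 'k = 'k] Node us that
          by (simp add: block_start_def s_def power_add)
        have "(\<Sum>b<?n. ?G (i + b)) = fscale (s i) (CR i i)"
          unfolding CR_def bar_diff_contracted_child[OF i Node wf] fs.scale_sum_right
          by (rule sum.cong[OF refl], rule G) simp
        then show ?thesis using True by (simp add: block_start_def)
      next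
        case False
        have nth: "?L ! block_start i ?n j = ts ! j"
          using splice_at_nth[OF i j, of 0 us] us False by simp
        have "CR j i = child_diff P ?p (block_start i ?n j) ?L"
          using False Node splice_at_update[OF i j False[symmetric] us]
          by (simp add: CR_def child_diff_def nth root_contract_Node)
        moreover have "RR i j = root_contract P ?p (block_start i ?n j) ?L"
          by (simp add: RR_def Node)
        moreover have "(-1) ^ vertices_before (block_start i ?n j) ?L = s j * \<epsilon> i j"
          using vertices_before_splice_at[OF i j, of 0 us q, where 'k = 'k] us Node False
          by (simp add: s_def \<epsilon>_def)
        ultimately show ?thesis using False by simp
      qed
    qed
    finally show ?thesis .
  qed
  have B: "lin ?\<delta> (child_diff P p i ts) =
      (\<Sum>j<?m. if j = i then fscale (s i) (CR i i) else fscale (s j * \<epsilon> i j) (CR i j - CC i j))"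
    if i: "i < ?m" for i
  proof -
    have sign: "(-1) ^ vertices_before j (ts[i := t]) = (if j = i then s i else s j * \<epsilon> i j)"
      if t: "t \<in> Poly_Mapping.keys (?\<delta> (ts ! i))" and j: "j < ?m" for t j
    proof (cases "j \<le> i")
      case True
      then show ?thesis by (auto simp: vertices_before_def s_def \<epsilon>_def)
    next
      case False
      have "map vertices (take j ts) ! i = Suc (vertices t)"
        using False j vertices_bar_diff[OF t] by simp
      moreover have "map vertices (take j ts) ! i \<le> sum_list (map vertices (take j ts))"
        using False j by (intro elem_le_sum_list) simp
      ultimately have "vertices_before j ts = Suc (vertices_before j (ts[i := t]))"
        using False j by (simp add: vertices_before_def take_update_swap map_update sum_list_update)
      then show ?thesis using False by (simp add: s_def \<epsilon>_def)
    qed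
    have "lin ?\<delta> (child_diff P p i ts) = lin (\<lambda>t. ?\<delta> (Node p (ts[i := t]))) (?\<delta> (ts ! i))"
      by (simp add: child_diff_def lin_lin)
    also have "\<dots> = lin (\<lambda>t. \<Sum>j<?m. fscale (if j = i then s i else s j * \<epsilon> i j)
        (root_contract P p j (ts[i := t]) + fscale (-1) (child_diff P p j (ts[i := t])))) (?\<delta> (ts ! i))"
      by (intro lin_cong) (simp add: bar_diff_tree_Node sign)
    also have "\<dots> = (\<Sum>j<?m. fscale (if j = i then s i else s j * \<epsilon> i j)
        (CR i j + fscale (-1) (lin (\<lambda>t. child_diff P p j (ts[i := t])) (?\<delta> (ts ! i)))))"
      by (simp only: lin_fun_sum lin_fun_scale lin_fun_add CR_def)
    also have "\<dots> = (\<Sum>j<?m. if j = i then fscale (s i) (CR i i) else fscale (s j * \<epsilon> i j) (CR i j - CC i j))"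
    proof (rule sum.cong[OF refl])
      fix j assume j: "j \<in> {..<?m}"
      have "lin (\<lambda>t. child_diff P p j (ts[i := t])) (?\<delta> (ts ! i)) = (if j = i then 0 else CC i j)"
      proof (cases "j = i")
        case True
        have "lin (\<lambda>t. child_diff P p i (ts[i := t])) (?\<delta> (ts ! i)) =
            lin (\<lambda>t. basis_vec (Node p (ts[i := t]))) (lin ?\<delta> (?\<delta> (ts ! i)))"
          using i by (simp add: child_diff_def lin_lin)
        also have "lin ?\<delta> (?\<delta> (ts ! i)) = 0"
          using Node.IH[of "ts ! i"] wfts[OF i] i by (simp add: bar_diff_def)
        finally show ?thesis using True by simp
      qed (simp add: CC_def child_diff_def)
      then show "fscale (if j = i then s i else s j * \<epsilon> i j)
          (CR i j + fscale (-1) (lin (\<lambda>t. child_diff P p j (ts[i := t])) (?\<delta> (ts ! i)))) =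
        (if j = i then fscale (s i) (CR i i) else fscale (s j * \<epsilon> i j) (CR i j - CC i j))"
        by simp
    qed
    finally show ?thesis .
  qed
  have CC_sym: "CC i j = CC j i" if "i \<noteq> j" for i j
    unfolding CC_def by (subst lin_swap) (simp add: list_update_swap[OF that])
  have RR_sym: "RR i j = RR j i" if ij: "i < j" "j < ?m" for i j
  proof (cases "ts ! i")
    case (Leaf l)
    then have "RR j i = 0"
      using ij wfts[of j] splice_at_nth[of j ts i 0] by (auto simp: RR_def split: tree.split)
    then show ?thesis using Leaf by (simp add: RR_def)
  next
    case i: (Node q us)
    then have us: "us \<noteq> []" "wf_tree Pbar (Node q us)" using wfts[of i] ij by auto
    show ?thesis
    proof (cases "ts ! j")
      case (Leaf l)
      then have "RR i j = 0"
        using ij us i splice_at_nth[of i ts j 0 us] by (simp add: RR_def)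
      then show ?thesis using Leaf by (simp add: RR_def)
    next
      case j: (Node r ws)
      then have ws: "ws \<noteq> []" "wf_tree Pbar (Node r ws)" using wfts[of j] ij by auto
      have n: "1 \<le> length us" "1 \<le> length ws" using us ws nonempty_length by blast+
      have car: "p \<in> car P ?m" "q \<in> car P (length us)" "r \<in> car P (length ws)"
        using wf us ws car_Pbar_subset[of ?m] car_Pbar_subset[OF n(1)] car_Pbar_subset[OF n(2)]
          nonempty_length[of ts] by auto
      have "partial_cmp P (partial_cmp P p ?m i q (length us)) (?m + length us - 1) (j + length us - 1) r (length ws) =
          partial_cmp P (partial_cmp P p ?m j r (length ws)) (?m + length ws - 1) i q (length us)"
        by (rule partial_cmp_assoc_par[OF ij n car])
      moreover have "splice_at i us ts ! (j + length us - 1) = Node r ws"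
        using splice_at_nth[of i ts j 0 us] us ij j by (simp add: block_start_def)
      moreover have "splice_at j ws ts ! i = Node q us"
        using splice_at_nth[of j ts i 0 ws] ws ij i by (simp add: block_start_def)
      moreover have "splice_at (j + length us - 1) ws (splice_at i us ts) = splice_at i us (splice_at j ws ts)"
        by (rule splice_at_splice_at_outer[OF ij us(1)])
      ultimately show ?thesis
        using ij i j by (simp add: RR_def block_start_def root_contract_Node length_splice_at)
    qed
  qed
  let ?H = "\<lambda>i j. RR i j - CR j i - CR i j + CC i j"
  have "bar_diff P (?\<delta> (Node p ts)) =
      (\<Sum>i<?m. fscale (s i) (lin ?\<delta> (root_contract P p i ts) - lin ?\<delta> (child_diff P p i ts)))"
    by (simp add: bar_diff_def bar_diff_tree_Node lin_sum lin_scale lin_diff s_def)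
  also have "\<dots> = (\<Sum>i<?m. \<Sum>j<?m. if j = i then 0 else fscale (s i * s j * \<epsilon> i j) (?H i j))"
  proof (rule sum.cong[OF refl])
    fix i assume "i \<in> {..<?m}"
    then have i: "i < ?m" by simp
    show "fscale (s i) (lin ?\<delta> (root_contract P p i ts) - lin ?\<delta> (child_diff P p i ts)) =
      (\<Sum>j<?m. if j = i then 0 else fscale (s i * s j * \<epsilon> i j) (?H i j))"
      unfolding A[OF i] B[OF i] sum_subtractf[symmetric] fs.scale_sum_right
      by (intro sum.cong refl)
         (simp add: fs.scale_right_diff_distrib fs.scale_right_distrib mult.assoc)
  qed
  \<comment> \<open>The terms for \<open>(i, j)\<close> and \<open>(j, i)\<close> are opposite.\<close>
  also have "\<dots> = 0"
  proof (subst sum_ordered_pairs)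
    have "fscale (s i * s j * \<epsilon> i j) (?H i j) + fscale (s j * s i * \<epsilon> j i) (?H j i) = 0"
      if "i < j" "j < ?m" for i j
    proof -
      have "?H j i = ?H i j" using RR_sym[OF that] CC_sym[of i j] that by simp
      moreover have "s j * s i * \<epsilon> j i = - (s i * s j * \<epsilon> i j)" using that by (simp add: \<epsilon>_def)
      ultimately show ?thesis by (simp only: fs.scale_minus_left) simp
    qed
    then show "(\<Sum>i<?m. \<Sum>j<?m. if i < j then
        (if j = i then 0 else fscale (s i * s j * \<epsilon> i j) (?H i j)) +
        (if i = j then 0 else fscale (s j * s i * \<epsilon> j i) (?H j i)) else 0) = 0"
      by (intro sum.neutral ballI) auto
  qed simp
  finally show ?case .
qed

end

section \<open>A basis of the bar construction\<close>

text \<open>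
  An arbitrary choice of an enumeration of each finite set. Among the orderings of the children of
  a vertex, which are pairwise distinct because they have different leaves, it singles out one.
\<close>

definition enum :: "'x set \<Rightarrow> 'x list" where
  "enum A = (SOME xs. set xs = A \<and> distinct xs)"

lemma enum: "finite A \<Longrightarrow> set (enum A) = A \<and> distinct (enum A)"
  unfolding enum_def by (rule someI_ex) (rule finite_distinct_list)

lemma mset_concat_map: "mset (concat (map f xs)) = (\<Sum>x\<in>#mset xs. mset (f x))"
  by (induction xs) auto

lemma finite_has_basis:
  assumes "vector_space s" "fin_dim s A" "module.subspace s A"
  shows "\<exists>B. finite B \<and> B \<subseteq> A \<and> \<not> module.dependent s B \<and> module.span s B = A"
proof -
  interpret vector_space s by (rule assms(1))
  obtain S where S: "finite S" "A \<subseteq> span (S \<union> {0})"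
    using assms(2) by (auto simp: fin_dim_mod_def)
  obtain B where B: "B \<subseteq> A" "independent B" "A \<subseteq> span B"
    using basis_exists by blast
  have "finite B" using independent_span_bound[of "S \<union> {0}" B] S B by auto
  moreover have "span B = A" using B assms(3) by (simp add: subset_antisym span_minimal)
  ultimately show ?thesis using B by blast
qed

context weighted_operad
begin

definition weight_basis :: "nat \<Rightarrow> nat \<Rightarrow> 'p set" where
  "weight_basis d n = (SOME B. finite B \<and> B \<subseteq> W d n \<and> vs.independent B \<and> vs.span B = W d n)"

lemma weight_basis:
  assumes "1 \<le> n"
  shows "finite (weight_basis d n)" "weight_basis d n \<subseteq> W d n"
    "vs.independent (weight_basis d n)" "vs.span (weight_basis d n) = W d n"
proof -
  have "\<exists>B. finite B \<and> B \<subseteq> W d n \<and> vs.independent B \<and> vs.span B = W d n"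
    by (rule finite_has_basis[OF vector_space W_fin_dim[OF assms] W_subspace[OF assms]])
  from someI_ex[OF this]
  show "finite (weight_basis d n)" "weight_basis d n \<subseteq> W d n"
    "vs.independent (weight_basis d n)" "vs.span (weight_basis d n) = W d n"
    by (auto simp: weight_basis_def)
qed

lemma weight_basis_disjoint:
  assumes n: "1 \<le> n" and v: "v \<in> weight_basis d n" "v \<in> weight_basis d' n"
  shows "d = d'"
proof (rule ccontr)
  assume ne: "d \<noteq> d'"
  have "v \<in> W d n" "v \<in> W d' n" using v weight_basis(2)[OF n] by auto
  then have "(if c = d then v else - v) \<in> W c n" if "c \<in> {d, d'}" for c
    using that vs.subspace_neg[OF W_subspace[OF n]] by auto
  then have "(if d = d then v else - v) = 0"
    using ne by (intro W_direct[OF n, of "{d, d'}" "\<lambda>c. if c = d then v else - v" d]) auto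
  then show False using weight_basis(3)[OF n] v(1) vs.dependent_zero by auto
qed

definition full_basis :: "nat \<Rightarrow> 'p set" where
  "full_basis n = (\<Union>d\<in>{1..}. weight_basis d n)"

lemma independent_full_basis:
  assumes n: "1 \<le> n"
  shows "vs.independent (full_basis n)"
  unfolding vs.independent_explicit_finite_subsets
proof (intro allI impI ballI)
  fix S u v
  assume S: "S \<subseteq> full_basis n" "finite S" and sum: "(\<Sum>v\<in>S. scl P (u v) v) = 0" and v: "v \<in> S"
  obtain wt where wt: "\<And>x. x \<in> S \<Longrightarrow> x \<in> weight_basis (wt x) n"
    using S(1) unfolding full_basis_def by (metis UN_E subsetD)
  let ?w = "\<lambda>d. \<Sum>v | v \<in> S \<and> wt v = d. scl P (u v) v"
  have "?w (wt v) = 0"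
  proof (rule W_direct[OF n, of "wt ` S" ?w])
    show "?w d \<in> W d n" for d
      using wt weight_basis(2)[OF n]
      by (intro vs.subspace_sum W_subspace n vs.subspace_scale) auto
    show "(\<Sum>d\<in>wt ` S. ?w d) = 0"
      using sum S(2) by (simp add: sum.image_gen[symmetric])
  qed (use S v in auto)
  moreover have "{x \<in> S. wt x = wt v} \<subseteq> weight_basis (wt v) n" using wt by (auto, metis)
  ultimately show "u v = 0"
    using weight_basis(3)[OF n, of "wt v", unfolded vs.independent_explicit_finite_subsets] S(2) v by auto
qed

lemma span_full_basis: "1 \<le> n \<Longrightarrow> vs.span (full_basis n) = car Pbar n"
proof (intro equalityI)
  assume n: "1 \<le> n"
  show "vs.span (full_basis n) \<subseteq> car Pbar n"
    using weight_basis(2)[OF n] W_car_Pbar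
    by (intro vs.span_minimal subspace_car_Pbar) (auto simp: full_basis_def, blast)
  have "W d n \<subseteq> vs.span (full_basis n)" if "1 \<le> d" for d
    using weight_basis(4)[OF n, of d] vs.span_mono[of "weight_basis d n" "full_basis n"] that
    by (auto simp: full_basis_def)
  then show "car Pbar n \<subseteq> vs.span (full_basis n)"
    unfolding car_Pbar by (intro vs.span_minimal) auto
qed

definition coord :: "nat \<Rightarrow> 'p \<Rightarrow> 'p \<Rightarrow> 'k" where
  "coord n b a = vs.representation (full_basis n) a b"

lemma coord_linear:
  assumes n: "1 \<le> n" and "a \<in> car Pbar n" "a' \<in> car Pbar n"
  shows "coord n b (scl P c a + a') = c * coord n b a + coord n b a'"
proof -
  note ind = independent_full_basis[OF n]
  have a: "a \<in> vs.span (full_basis n)" "a' \<in> vs.span (full_basis n)"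
    using assms span_full_basis[OF n] by simp_all
  show ?thesis
    unfolding coord_def
    by (simp add: vs.representation_add[OF ind a(2) vs.span_scale[OF a(1)]] vs.representation_scale[OF ind a(1)])
qed

lemma coord_basis:
  assumes "1 \<le> n" "b \<in> full_basis n" "b' \<in> full_basis n"
  shows "coord n b b' = of_bool (b = b')"
  using vs.representation_basis[OF independent_full_basis[OF assms(1)] assms(3)]
  by (auto simp: coord_def)

text \<open>
  The coefficient of the tree \<open>u\<close> in the tree \<open>t\<close>. Summing over all ways to match the children of
  the roots makes it invariant under reordering of the children; for well-formed trees with distinct
  leaves at most one summand is nonzero.
\<close>

primrec coef :: "'p tree \<Rightarrow> 'p tree \<Rightarrow> 'k" where
  "coef (Leaf l) = (\<lambda>t. case t of Leaf l' \<Rightarrow> of_bool (l = l') | Node a ts \<Rightarrow> 0)"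
| "coef (Node b us) = (\<lambda>t. case t of Leaf l \<Rightarrow> 0 | Node a ts \<Rightarrow>
     if length ts = length us then
       \<Sum>\<sigma> | \<sigma> permutes {..<length ts}.
         koszul_sign 1 \<sigma> ts * coord (length ts) b (act P (length ts) a (inv \<sigma>)) *
         (\<Prod>i<length ts. (map coef us ! \<sigma> i) (ts ! i))
     else 0)"

lemma koszul_sign_id: "koszul_sign e id ts = 1"
proof -
  have "{(a, b). a < b \<and> b < length ts \<and> id b < id a} = {}" by auto
  then show ?thesis by (simp only: koszul_sign_def prod.empty)
qed

lemma koszul_sign_comp:
  assumes \<sigma>: "\<sigma> permutes {..<length ts}" and \<tau>: "\<tau> permutes {..<length ts}"
  shows "(koszul_sign e (\<sigma> \<circ> \<tau>) ts :: 'k) = koszul_sign e \<tau> ts * koszul_sign e \<sigma> (permute_list (inv \<tau>) ts)"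
proof -
  have "inv_sum (length ts) \<sigma> (\<lambda>a. e * vertices (permute_list (inv \<tau>) ts ! a)) =
      inv_sum (length ts) \<sigma> (\<lambda>a. e * vertices (ts ! inv \<tau> a))"
    using \<tau> by (intro inv_sum_cong) (simp add: permute_list_nth permutes_inv)
  then show ?thesis
    by (simp add: koszul_sign_inv_sum inv_sum_comp[OF \<sigma> \<tau>])
qed

text \<open>
  Invariance under equivariance is a change of variables \<open>\<sigma> \<circ> \<tau>\<close> in the sum over all matchings,
  together with the cocycle property of Koszul signs.
\<close>

lemma coef_rel: "r \<in> tree_rel 1 Pbar \<Longrightarrow> pairing (coef u) r = 0"
proof (induction arbitrary: u rule: tree_rel.induct)
  case (linear a ts b c)
  have n: "1 \<le> length ts" using linear nonempty_length by auto
  have ab: "a \<in> car Pbar (length ts)" "b \<in> car Pbar (length ts)" using linear by auto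
  have "coord (length ts) x (act P (length ts) (scl P c a + b) \<tau>) =
      c * coord (length ts) x (act P (length ts) a \<tau>) + coord (length ts) x (act P (length ts) b \<tau>)"
    if "\<tau> permutes {..<length ts}" for x \<tau>
    using coord_linear[OF n] car_Pbar_act[OF n that] ab act_linear[OF n _ _ that] car_Pbar_subset[OF n]
    by (simp add: subset_iff)
  then have "coord (length ts) x (act P (length ts) (scl P c a + b) (inv \<sigma>)) =
      c * coord (length ts) x (act P (length ts) a (inv \<sigma>)) + coord (length ts) x (act P (length ts) b (inv \<sigma>))"
    if "\<sigma> permutes {..<length ts}" for x \<sigma>
    using permutes_inv[OF that] by blast
  then have "coef u (Node (scl P c a + b) ts) = c * coef u (Node a ts) + coef u (Node b ts)"
    by (cases u) (auto simp: sum_distrib_left sum.distrib[symmetric] algebra_simps intro!: sum.cong)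
  then show ?case by (simp add: pairing_diff pairing_scale)
next
  case (equiv a ts \<tau>)
  have n: "1 \<le> length ts" using equiv nonempty_length by auto
  have a: "a \<in> car P (length ts)" using equiv car_Pbar_subset[OF n] by auto
  let ?us = "permute_list (inv \<tau>) ts" and ?m = "length ts"
  show ?case
  proof (cases u)
    case (Leaf l)
    then show ?thesis by (simp add: pairing_diff pairing_scale)
  next
    case (Node b us)
    show ?thesis
    proof (cases "?m = length us")
      case False
      then show ?thesis using Node by (simp add: pairing_diff pairing_scale)
    next
      case True
      let ?f = "\<lambda>\<sigma>. koszul_sign 1 \<sigma> ts * coord ?m b (act P ?m (act P ?m a \<tau>) (inv \<sigma>)) *
         (\<Prod>i<?m. (map coef us ! \<sigma> i) (ts ! i))"
      let ?g = "\<lambda>\<sigma>. koszul_sign 1 \<sigma> ?us * coord ?m b (act P ?m a (inv \<sigma>)) *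
         (\<Prod>i<?m. (map coef us ! \<sigma> i) (?us ! i))"
      have "?f (\<sigma> \<circ> \<tau>) = koszul_sign 1 \<tau> ts * ?g \<sigma>" if \<sigma>: "\<sigma> permutes {..<?m}" for \<sigma>
      proof -
        have perm: "inv (\<sigma> \<circ> \<tau>) permutes {..<?m}"
          using \<sigma> equiv(2) by (intro permutes_inv permutes_compose)
        have "\<tau> \<circ> inv (\<sigma> \<circ> \<tau>) = inv \<sigma>"
          using permutes_bij[OF \<sigma>] permutes_bij[OF equiv(2)] permutes_inverses(1)[OF equiv(2)]
          by (simp add: o_inv_distrib fun_eq_iff)
        then have "act P ?m (act P ?m a \<tau>) (inv (\<sigma> \<circ> \<tau>)) = act P ?m a (inv \<sigma>)"
          using act_comp[OF n a equiv(2) perm] by simp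
        moreover have "(\<Prod>i<?m. (map coef us ! (\<sigma> \<circ> \<tau>) i) (ts ! i)) = (\<Prod>i<?m. (map coef us ! \<sigma> i) (?us ! i))"
          using prod.permute[OF equiv(2), of "\<lambda>i. (map coef us ! \<sigma> i) (?us ! i)"]
          by (simp add: nth_permute_list_inv[OF equiv(2)])
        ultimately show ?thesis using koszul_sign_comp[OF \<sigma> equiv(2), of 1] by simp
      qed
      then have "(\<Sum>\<sigma> | \<sigma> permutes {..<?m}. ?f (\<sigma> \<circ> \<tau>)) = koszul_sign 1 \<tau> ts * (\<Sum>\<sigma> | \<sigma> permutes {..<?m}. ?g \<sigma>)"
        unfolding sum_distrib_left by (intro sum.cong refl) simp
      moreover have "(\<Sum>\<sigma> | \<sigma> permutes {..<?m}. ?f \<sigma>) = (\<Sum>\<sigma> | \<sigma> permutes {..<?m}. ?f (\<sigma> \<circ> \<tau>))"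
        by (rule sum_permutations_compose_right[OF equiv(2)])
      ultimately show ?thesis
        using Node True by (simp add: pairing_diff pairing_scale)
    qed
  qed
next
  case (in_context r a us l vs)
  define ts where "ts = us @ Leaf l # vs"
  define j where "j = length us"
  have upd: "us @ t # vs = ts[j := t]" for t by (simp add: ts_def j_def)
  have j: "j < length ts" by (simp add: ts_def j_def)
  let ?m = "length ts"
  have "pairing (\<lambda>t. coef u (Node a (ts[j := t]))) r = 0"
  proof (cases u)
    case (Leaf l')
    then show ?thesis by (simp add: pairing_def)
  next
    case (Node b ws)
    show ?thesis
    proof (cases "?m = length ws")
      case False
      then show ?thesis using Node by (simp add: pairing_def)
    next
      case True
      obtain v where v: "\<forall>t\<in>Poly_Mapping.keys r. vertices t = v"
        using tree_rel_homogeneous[OF in_context(1)] by blast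
      have "pairing (\<lambda>t. coef u (Node a (ts[j := t]))) r =
          (\<Sum>\<sigma> | \<sigma> permutes {..<?m}. pairing (\<lambda>t. koszul_sign 1 \<sigma> (ts[j := t]) *
            coord ?m b (act P ?m a (inv \<sigma>)) * (\<Prod>i<?m. (map coef ws ! \<sigma> i) (ts[j := t] ! i))) r)"
        using Node True by (simp add: pairing_fun_sum)
      also have "\<dots> = 0"
      proof (rule sum.neutral, rule ballI)
        fix \<sigma> assume "\<sigma> \<in> {\<sigma>. \<sigma> permutes {..<?m}}"
        then have \<sigma>j: "\<sigma> j < ?m" using j permutes_in_image[of \<sigma> "{..<?m}" j] by auto
        let ?c = "(-1 :: 'k) ^ inv_sum ?m \<sigma> ((\<lambda>a. vertices (ts ! a))(j := v)) * coord ?m b (act P ?m a (inv \<sigma>)) *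
          (\<Prod>i\<in>{..<?m} - {j}. (map coef ws ! \<sigma> i) (ts ! i))"
        have "koszul_sign 1 \<sigma> (ts[j := t]) * coord ?m b (act P ?m a (inv \<sigma>)) *
            (\<Prod>i<?m. (map coef ws ! \<sigma> i) (ts[j := t] ! i)) = ?c * coef (ws ! \<sigma> j) t"
          if t: "t \<in> Poly_Mapping.keys r" for t
        proof -
          have "inv_sum ?m \<sigma> (\<lambda>a. vertices (ts[j := t] ! a)) =
              inv_sum ?m \<sigma> ((\<lambda>a. vertices (ts ! a))(j := v))"
            using v t j by (intro inv_sum_cong) (auto simp: nth_list_update)
          moreover have "(\<Prod>i<?m. (map coef ws ! \<sigma> i) (ts[j := t] ! i)) =
              coef (ws ! \<sigma> j) t * (\<Prod>i\<in>{..<?m} - {j}. (map coef ws ! \<sigma> i) (ts ! i))"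
            using j \<sigma>j True by (subst prod.remove[of _ j]) auto
          ultimately show ?thesis by (simp add: koszul_sign_inv_sum)
        qed
        then have "pairing (\<lambda>t. koszul_sign 1 \<sigma> (ts[j := t]) *
            coord ?m b (act P ?m a (inv \<sigma>)) * (\<Prod>i<?m. (map coef ws ! \<sigma> i) (ts[j := t] ! i))) r =
            pairing (\<lambda>t. ?c * coef (ws ! \<sigma> j) t) r"
          by (rule pairing_cong)
        also have "\<dots> = ?c * pairing (coef (ws ! \<sigma> j)) r" by (rule pairing_fun_scale)
        also have "\<dots> = 0" using in_context.IH by simp
        finally show "pairing (\<lambda>t. koszul_sign 1 \<sigma> (ts[j := t]) *
            coord ?m b (act P ?m a (inv \<sigma>)) * (\<Prod>i<?m. (map coef ws ! \<sigma> i) (ts[j := t] ! i))) r = 0" .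
      qed
      finally show ?thesis .
    qed
  qed
  then show ?case unfolding upd by (simp add: pairing_lin)
qed

lemma coef_null: "x \<in> null \<Longrightarrow> pairing (coef u) x = 0"
  unfolding bar_null_def tree_null_def by (rule pairing_zero_on_span[OF coef_rel])

inductive basis_tree :: "'p tree \<Rightarrow> nat \<Rightarrow> bool" where
  Leaf: "basis_tree (Leaf l) 0"
| Node: "1 \<le> d \<Longrightarrow> ts \<noteq> [] \<Longrightarrow> b \<in> weight_basis d (length ts) \<Longrightarrow> ts = enum (set ts) \<Longrightarrow>
    list_all2 basis_tree ts ds \<Longrightarrow> basis_tree (Node b ts) (d + sum_list ds)"

lemma basis_tree_NodeE:
  assumes "basis_tree (Node b ts) d"
  obtains d0 ds where "d = d0 + sum_list ds" "1 \<le> d0" "ts \<noteq> []" "b \<in> weight_basis d0 (length ts)"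
    "ts = enum (set ts)" "distinct ts" "list_all2 basis_tree ts ds"
  using assms by (cases rule: basis_tree.cases) (metis enum finite_set)

lemma basis_tree_wf: "basis_tree t d \<Longrightarrow> wf_tree Pbar t \<and> tree_weight W t d"
proof (induction t arbitrary: d)
  case (Leaf l)
  then show ?case by (auto elim: basis_tree.cases intro: tree_weight.intros)
next
  case (Node b ts)
  from Node.prems obtain d0 ds where d: "d = d0 + sum_list ds" "1 \<le> d0" "ts \<noteq> []"
    "b \<in> weight_basis d0 (length ts)" "list_all2 basis_tree ts ds" by (rule basis_tree_NodeE)
  have b: "b \<in> W d0 (length ts)" using d(4) weight_basis(2)[OF nonempty_length[OF d(3)]] by auto
  have ts: "list_all2 (\<lambda>t d. wf_tree Pbar t \<and> tree_weight W t d) ts ds"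
    using d(5) Node.IH by (auto simp: list_all2_conv_all_nth)
  then have "list_all2 (tree_weight W) ts ds" by (auto elim: list_all2_mono)
  moreover have "\<forall>t\<in>set ts. wf_tree Pbar t"
    using ts by (auto simp: list_all2_conv_all_nth in_set_conv_nth)
  ultimately show ?case
    using d b W_car_Pbar[OF d(2) b] by (auto intro: tree_weight.intros)
qed

text \<open>
  If some matching \<open>\<sigma>\<close> pairs equal children then both lists of children have the same elements, hence
  they are equal, being the chosen enumeration of this set; then \<open>\<sigma>\<close> is the identity because the
  children are distinct.
\<close>

lemma coef_basis_tree:
  "basis_tree u d \<Longrightarrow> basis_tree u' d' \<Longrightarrow> coef u u' = of_bool (u = u')"
proof (induction u arbitrary: u' d d')
  case (Leaf l)
  then show ?case by (cases u') auto
next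
  case (Node b us)
  show ?case
  proof (cases u')
    case (Leaf l)
    then show ?thesis by simp
  next
    case u': (Node b' us')
    show ?thesis
    proof (cases "length us' = length us")
      case False
      then show ?thesis using u' by auto
    next
      case len: True
      let ?m = "length us"
      from Node.prems(1) obtain d0 ds where us: "us \<noteq> []" "b \<in> weight_basis d0 ?m" "1 \<le> d0"
        "us = enum (set us)" "distinct us" "list_all2 basis_tree us ds" by (rule basis_tree_NodeE)
      from Node.prems(2)[unfolded u'] obtain d0' ds' where us': "b' \<in> weight_basis d0' ?m" "1 \<le> d0'"
        "us' = enum (set us')" "list_all2 basis_tree us' ds'"
        by (rule basis_tree_NodeE) (auto simp: len)
      have c: "coef (us ! i) (us' ! j) = of_bool (us ! i = us' ! j)" if "i < ?m" "j < ?m" for i j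
        using Node.IH[of "us ! i"] us(6) us'(4) that len by (metis list_all2_nthD nth_mem)
      have matched: "(\<Prod>i<?m. (map coef us ! \<sigma> i) (us' ! i)) = of_bool (us = us' \<and> \<sigma> = id)"
        if \<sigma>: "\<sigma> permutes {..<?m}" for \<sigma>
      proof -
        have \<sigma>m: "\<sigma> i < ?m" if "i < ?m" for i using permutes_in_image[OF \<sigma>] that by auto
        have "(\<Prod>i<?m. (map coef us ! \<sigma> i) (us' ! i)) = (\<Prod>i<?m. of_bool (us ! \<sigma> i = us' ! i))"
          using \<sigma>m by (intro prod.cong refl) (simp add: c)
        also have "\<dots> = of_bool (\<forall>i<?m. us ! \<sigma> i = us' ! i)"
          by (auto simp: prod_zero_iff)
        also have "(\<forall>i<?m. us ! \<sigma> i = us' ! i) \<longleftrightarrow> us = us' \<and> \<sigma> = id"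
        proof
          assume eq: "\<forall>i<?m. us ! \<sigma> i = us' ! i"
          have "us' = permute_list \<sigma> us"
            using eq len \<sigma> by (intro nth_equalityI) (auto simp: permute_list_nth)
          then have "set us' = set us" using \<sigma> by simp
          then have "us = us'" using us(4) us'(3) by simp
          moreover have "\<sigma> i = i" for i
          proof (cases "i < ?m")
            case True
            then show ?thesis using eq calculation us(5) \<sigma>m by (auto simp: nth_eq_iff_index_eq)
          next
            case False
            then show ?thesis using \<sigma> by (simp add: permutes_def)
          qed
          ultimately show "us = us' \<and> \<sigma> = id" by auto
        qed auto
        finally show ?thesis .
      qed
      have n: "1 \<le> ?m" by (rule nonempty_length[OF us(1)])
      have fb: "b \<in> full_basis ?m" "b' \<in> full_basis ?m" using us us' by (auto simp: full_basis_def)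
      have "b' \<in> car P ?m"
        using us'(1) weight_basis(2)[OF n] W_subset[OF n] by blast
      then have id: "act P ?m b' (inv id) = b'" using act_id[OF n] by simp
      have "coef (Node b us) u' = (\<Sum>\<sigma> | \<sigma> permutes {..<?m}. koszul_sign 1 \<sigma> us' *
          coord ?m b (act P ?m b' (inv \<sigma>)) * of_bool (us = us' \<and> \<sigma> = id))"
        using u' len matched by (simp cong: sum.cong_simp)
      also have "\<dots> = (\<Sum>\<sigma> | \<sigma> permutes {..<?m}. if \<sigma> = id then of_bool (us = us' \<and> b = b') else 0)"
        using coord_basis[OF n fb] id
        by (intro sum.cong refl) (auto simp: koszul_sign_id)
      also have "\<dots> = of_bool (Node b us = u')"
        using permutes_id[of "{..<?m}"] u' by (simp add: sum.delta' finite_permutations conj_commute)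
      finally show ?thesis .
    qed
  qed
qed

definition basis_trees :: "nat multiset \<Rightarrow> nat \<Rightarrow> nat \<Rightarrow> 'p tree set" where
  "basis_trees L s d = {u. basis_tree u d \<and> vertices u = s \<and> mset (leaves u) = L}"

definition spanned :: "'p tree set \<Rightarrow> ('p tree \<Rightarrow>\<^sub>0 'k) set" where
  "spanned X = {x. \<exists>y. Poly_Mapping.keys y \<subseteq> X \<and> x - y \<in> null}"

lemma subspace_spanned: "fs.subspace (spanned X)"
proof (rule fs.subspaceI)
  show "0 \<in> spanned X" unfolding spanned_def using null_intros by (auto intro!: exI[of _ 0])
next
  fix x x' assume "x \<in> spanned X" "x' \<in> spanned X"
  then obtain y y' where "Poly_Mapping.keys y \<subseteq> X" "x - y \<in> null" "Poly_Mapping.keys y' \<subseteq> X" "x' - y' \<in> null"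
    by (auto simp: spanned_def)
  moreover from this have "x + x' - (y + y') \<in> null"
    using null_intros(2)[of "x - y" "x' - y'"] by (simp only: add_diff_add)
  moreover have "Poly_Mapping.keys (y + y') \<subseteq> Poly_Mapping.keys y \<union> Poly_Mapping.keys y'"
    by (rule Poly_Mapping.keys_add)
  ultimately show "x + x' \<in> spanned X" unfolding spanned_def by blast
next
  fix c x assume "x \<in> spanned X"
  then obtain y where "Poly_Mapping.keys y \<subseteq> X" "x - y \<in> null" by (auto simp: spanned_def)
  then show "fscale c x \<in> spanned X"
    unfolding spanned_def using keys_fscale[of c y] null_scale[of "x - y" c]
    by (auto intro!: exI[of _ "fscale c y"] simp: fs.scale_right_diff_distrib)
qed

lemma spanned_null: "x \<in> null \<Longrightarrow> x \<in> spanned X"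
  by (auto simp: spanned_def intro!: exI[of _ 0])

lemma spanned_basis: "t \<in> X \<Longrightarrow> basis_vec t \<in> spanned X"
  by (auto simp: spanned_def null_intros intro!: exI[of _ "basis_vec t"])

lemma spanned_trans:
  assumes "x \<in> spanned X" "\<And>t. t \<in> X \<Longrightarrow> basis_vec t \<in> spanned Y"
  shows "x \<in> spanned Y"
proof -
  obtain y where y: "Poly_Mapping.keys y \<subseteq> X" "x - y \<in> null" using assms(1) by (auto simp: spanned_def)
  have *: "lin basis_vec y \<in> spanned Y"
    using y assms(2) by (intro lin_in_subspace subspace_spanned) auto
  show ?thesis
    using fs.subspace_add[OF subspace_spanned spanned_null[OF y(2)] *] by simp
qed

lemma spanned_diff_null:
  assumes "x - y \<in> null" "y \<in> spanned X"
  shows "x \<in> spanned X"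
  using fs.subspace_add[OF subspace_spanned spanned_null[OF assms(1)] assms(2)] by simp

lemma leaves_nonempty: "wf_tree Pbar t \<Longrightarrow> leaves t \<noteq> []"
proof (induction t)
  case (Node a ts)
  then obtain t where "t \<in> set ts" by (cases ts) auto
  then show ?case using Node by auto
qed simp

lemma distinct_children:
  assumes "distinct (concat (map leaves ts))" "\<forall>t\<in>set ts. wf_tree Pbar t"
  shows "distinct ts"
proof -
  have "removeAll [] (map leaves ts) = map leaves ts"
    using leaves_nonempty assms(2) by (intro removeAll_id) (auto dest: sym)
  then have "distinct (map leaves ts)" using assms(1) by (simp add: distinct_concat_iff)
  then show ?thesis by (simp add: distinct_map)
qed

lemma spanned_replace_children:
  assumes p: "p \<in> car Pbar (length ts)" and wf: "\<forall>t\<in>set ts. wf_tree Pbar t"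
    and T: "\<And>i. i < length ts \<Longrightarrow> basis_vec (ts ! i) \<in> spanned (T i)"
    and wfT: "\<And>i t. t \<in> T i \<Longrightarrow> wf_tree Pbar t"
  shows "basis_vec (Node p ts) \<in> spanned {Node p us |us. length us = length ts \<and> (\<forall>i<length ts. us ! i \<in> T i)}"
proof -
  let ?m = "length ts"
  let ?S = "\<lambda>k. {Node p us |us. length us = ?m \<and> (\<forall>i<k. us ! i \<in> T i) \<and> (\<forall>i<?m. k \<le> i \<longrightarrow> us ! i = ts ! i)}"
  have "basis_vec (Node p ts) \<in> spanned (?S k)" if "k \<le> ?m" for k
    using that
  proof (induction k)
    case 0
    show ?case by (intro spanned_basis) auto
  next
    case (Suc k)
    show ?case
    proof (rule spanned_trans)
      show "basis_vec (Node p ts) \<in> spanned (?S k)" using Suc by simp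
      fix t assume "t \<in> ?S k"
      then obtain us where t: "t = Node p us" and us: "length us = ?m" "\<forall>i<k. us ! i \<in> T i"
        "\<forall>i<?m. k \<le> i \<longrightarrow> us ! i = ts ! i" by auto
      have k: "k < ?m" using Suc by simp
      obtain y where y: "Poly_Mapping.keys y \<subseteq> T k" "basis_vec (ts ! k) - y \<in> null"
        using T[OF k] by (auto simp: spanned_def)
      have "wf_tree Pbar (us ! i)" if "i < ?m" for i
        using that us wf wfT by (cases "i < k") auto
      then have "lin (\<lambda>t. basis_vec (Node p (us[k := t]))) (basis_vec (ts ! k) - y) \<in> null"
        using us(1) p k by (intro null_context y) auto
      moreover have "us[k := ts ! k] = us" using us(3) k by (metis le_refl list_update_id)
      ultimately have "basis_vec t - lin (\<lambda>t. basis_vec (Node p (us[k := t]))) y \<in> null"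
        by (simp add: lin_diff t)
      moreover have "Poly_Mapping.keys (lin (\<lambda>t. basis_vec (Node p (us[k := t]))) y) \<subseteq> ?S (Suc k)"
      proof
        fix z assume "z \<in> Poly_Mapping.keys (lin (\<lambda>t. basis_vec (Node p (us[k := t]))) y)"
        then obtain t where "t \<in> Poly_Mapping.keys y" "z = Node p (us[k := t])"
          by (auto dest!: subsetD[OF keys_lin])
        then show "z \<in> ?S (Suc k)"
          using y(1) us k by (auto simp: nth_list_update less_Suc_eq)
      qed
      ultimately show "basis_vec t \<in> spanned (?S (Suc k))" unfolding spanned_def by blast
    qed
  qed
  from this[of ?m] show ?thesis by simp
qed

text \<open>
  Rewrite the children first, then bring them into the chosen order by \<open>equiv\<close>, which changes the
  decoration of the root, and finally expand this decoration in the basis.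
\<close>

lemma basis_tree_spanned:
  "wf_tree Pbar t \<Longrightarrow> tree_weight W t d \<Longrightarrow> distinct (leaves t) \<Longrightarrow>
   basis_vec t \<in> spanned (basis_trees (mset (leaves t)) (vertices t) d)"
proof (induction t arbitrary: d)
  case (Leaf l)
  then have "d = 0" by (auto elim: tree_weight.cases)
  then show ?case by (intro spanned_basis) (auto simp: basis_trees_def intro: basis_tree.intros)
next
  case (Node p ts)
  let ?m = "length ts"
  let ?X = "basis_trees (mset (leaves (Node p ts))) (vertices (Node p ts)) d"
  from Node.prems(2) obtain d0 ds where d: "d = d0 + sum_list ds" "1 \<le> d0" "p \<in> W d0 ?m"
    "list_all2 (tree_weight W) ts ds" by (auto elim: tree_weight.cases)
  have len: "length ds = ?m" using d(4) by (simp add: list_all2_lengthD)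
  have n: "1 \<le> ?m" using Node.prems nonempty_length by auto
  let ?T = "\<lambda>i. basis_trees (mset (leaves (ts ! i))) (vertices (ts ! i)) (ds ! i)"
  have "basis_vec (Node p ts) \<in> spanned {Node p us |us. length us = ?m \<and> (\<forall>i<?m. us ! i \<in> ?T i)}"
  proof (rule spanned_replace_children)
    show "p \<in> car Pbar ?m" "\<forall>t\<in>set ts. wf_tree Pbar t" using Node.prems by auto
    fix i assume i: "i < ?m"
    have "distinct (leaves (ts ! i))" using Node.prems(3) i by (auto simp: distinct_concat_iff)
    then show "basis_vec (ts ! i) \<in> spanned (?T i)"
      using Node.IH[of "ts ! i" "ds ! i"] Node.prems(1) d(4) i by (auto dest: list_all2_nthD)
  qed (auto simp: basis_trees_def dest: basis_tree_wf)
  then show ?case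
  proof (rule spanned_trans)
    fix t assume "t \<in> {Node p us |us. length us = ?m \<and> (\<forall>i<?m. us ! i \<in> ?T i)}"
    then obtain us where t: "t = Node p us" and us: "length us = ?m" "\<And>i. i < ?m \<Longrightarrow> us ! i \<in> ?T i" by auto
    have wfus: "\<forall>t\<in>set us. wf_tree Pbar t"
      using us basis_tree_wf by (fastforce simp: basis_trees_def in_set_conv_nth)
    have "map (mset \<circ> leaves) us = map (mset \<circ> leaves) ts"
      using us by (intro nth_equalityI) (auto simp: basis_trees_def)
    then have leaves: "mset (concat (map leaves us)) = mset (concat (map leaves ts))"
      by (simp only: mset_concat map_map)
    have vert: "sum_list (map vertices us) = sum_list (map vertices ts)"
    proof -
      have "map vertices us = map vertices ts"
        using us by (intro nth_equalityI) (auto simp: basis_trees_def)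
      then show ?thesis by simp
    qed
    have "distinct (concat (map leaves us))"
      using Node.prems(3) mset_eq_imp_distinct_iff[OF leaves] by simp
    then have dist: "distinct us" using distinct_children wfus by blast
    define us' where "us' = enum (set us)"
    have us': "set us' = set us" "distinct us'" using enum[of "set us"] by (simp_all add: us'_def)
    then have mset: "mset us' = mset us" using dist set_eq_iff_mset_eq_distinct by blast
    then obtain \<tau> where \<tau>: "\<tau> permutes {..<?m}" "permute_list \<tau> us = us'"
      using mset_eq_permutation[OF mset] us(1) by auto
    have us_ne: "us \<noteq> []" using us(1) n by auto
    have inv: "inv \<tau> permutes {..<?m}" using \<tau>(1) by (rule permutes_inv)
    define q where "q = act P ?m p \<tau>"
    have q: "q \<in> W d0 ?m" unfolding q_def by (rule W_act[OF n d(3) \<tau>(1)])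
    have "p \<in> car P ?m" using d(3) W_subset n by blast
    then have p: "p = act P ?m q (inv \<tau>)"
      using act_comp[OF n _ \<tau>(1) inv] act_id[OF n] permutes_inv_o(1)[OF \<tau>(1)] by (simp add: q_def)
    have "basis_vec (Node (act P ?m q (inv \<tau>)) us) - fscale ((-1) ^ inv_sum ?m (inv \<tau>) (\<lambda>a. vertices (us ! a)))
        (basis_vec (Node q us')) \<in> null"
      using us_ne null_equiv[of q us "inv \<tau>"] q W_car_Pbar[OF d(2)] us(1) wfus n inv \<tau> by (auto simp: inv_inv_eq permutes_bij)
    moreover have "basis_vec (Node q us') \<in> spanned ?X"
    proof -
      obtain ds' where ds': "list_all2 basis_tree us' ds'" "sum_list ds' = sum_list ds"
      proof
        show "list_all2 basis_tree us' (permute_list \<tau> ds)"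
          using us len \<tau> permutes_in_image[OF \<tau>(1)]
          by (auto simp: list_all2_conv_all_nth permute_list_nth basis_trees_def simp flip: \<tau>(2))
        show "sum_list (permute_list \<tau> ds) = sum_list ds"
          using \<tau>(1) len by (metis mset_permute_list sum_mset_sum_list)
      qed
      have len': "length us' = ?m" using mset us(1) by (metis size_mset)
      have ne: "us' \<noteq> []" using len' n by auto
      have inX: "Node b us' \<in> ?X" if "b \<in> weight_basis d0 ?m" for b
      proof -
        have "basis_tree (Node b us') (d0 + sum_list ds')"
          using that ne len' us'(1) by (intro basis_tree.intros d(2) ds'(1)) (simp_all add: us'_def)
        moreover have "sum_list (map vertices us') = sum_list (map vertices ts)"
          using vert mset by (metis mset_map sum_mset_sum_list)
        moreover have "mset (concat (map leaves us')) = mset (concat (map leaves ts))"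
          using leaves by (simp only: mset_concat_map mset)
        ultimately show ?thesis using ds'(2) d(1) by (simp add: basis_trees_def)
      qed
      have wfus': "\<forall>t\<in>set us'. wf_tree Pbar t" using wfus us'(1) by simp
      have "q \<in> vs.span (weight_basis d0 ?m)" using q weight_basis(4)[OF n] by simp
      then have "q \<in> car Pbar ?m \<and> basis_vec (Node q us') \<in> spanned ?X"
      proof (induction rule: vs.span_induct_alt)
        case base
        have 0: "0 \<in> car Pbar ?m" by (rule vs.subspace_0[OF subspace_car_Pbar])
        then have "basis_vec (Node 0 us') \<in> null"
          using null_linear[of 0 us' 0 "-1"] ne wfus' len' by simp
        then show ?case using 0 spanned_null by blast
      next
        case (step c b y)
        have b: "b \<in> car Pbar ?m"
          using step(1) weight_basis(2)[OF n] W_car_Pbar[OF d(2)] by blast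
        have y: "y \<in> car Pbar ?m" "basis_vec (Node y us') \<in> spanned ?X" using step by auto
        have "basis_vec (Node (scl P c b + y) us') -
            (fscale c (basis_vec (Node b us')) + basis_vec (Node y us')) \<in> null"
          using null_linear[of b us' y c] ne wfus' len' b y by (simp add: diff_diff_eq)
        moreover have "fscale c (basis_vec (Node b us')) + basis_vec (Node y us') \<in> spanned ?X"
          by (rule fs.subspace_add[OF subspace_spanned
                fs.subspace_scale[OF subspace_spanned spanned_basis[OF inX[OF step(1)]]] y(2)])
        ultimately show ?case
          using b y subspace_car_Pbar[of ?m] spanned_diff_null
          by (blast intro: vs.subspace_add vs.subspace_scale)
      qed
      then show ?thesis ..
    qed
    ultimately show "basis_vec t \<in> spanned ?X"
      unfolding t using spanned_diff_null fs.subspace_scale[OF subspace_spanned] p by metis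
  qed
qed

end

unbundle fps_syntax

lemma negate_y_nth: "negate_y G $ n $ d = (-1) ^ d * G $ n $ d"
proof -
  have "- fps_X = fps_const (-1) * (fps_X :: rat fps)"
    by (simp add: fps_const_neg[symmetric] del: fps_const_neg)
  then show ?thesis by (simp add: negate_y_def fps_compose_linear)
qed

lemma mset_upt_iff: "mset xs = mset [0..<n] \<longleftrightarrow> distinct xs \<and> set xs = {..<n}"
proof
  assume *: "mset xs = mset [0..<n]"
  have "distinct xs" using mset_eq_imp_distinct_iff[OF *] by (simp only: distinct_upt)
  moreover have "set xs = {..<n}"
    using mset_eq_setD[OF *] by (simp only: set_upt lessThan_atLeast0)
  ultimately show "distinct xs \<and> set xs = {..<n}" ..
next
  assume *: "distinct xs \<and> set xs = {..<n}"
  then have "mset xs = mset_set {..<n}" using mset_set_set[of xs] by simp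
  then show "mset xs = mset [0..<n]" by (simp only: mset_set_upto_eq_mset_upto)
qed

context weighted_operad
begin

lemma basis_tree_unique: "basis_tree t d \<Longrightarrow> basis_tree t d' \<Longrightarrow> d = d'"
proof (induction t arbitrary: d d')
  case (Leaf l)
  then show ?case by (auto elim: basis_tree.cases)
next
  case (Node b ts)
  from Node.prems(1) obtain d0 ds where d: "d = d0 + sum_list ds" "ts \<noteq> []" "b \<in> weight_basis d0 (length ts)"
    "list_all2 basis_tree ts ds" by (rule basis_tree_NodeE)
  from Node.prems(2) obtain d0' ds' where d': "d' = d0' + sum_list ds'" "b \<in> weight_basis d0' (length ts)"
    "list_all2 basis_tree ts ds'" by (rule basis_tree_NodeE)
  have "ds = ds'"
  proof (rule nth_equalityI)
    show "length ds = length ds'" using d(4) d'(3) by (metis list_all2_lengthD)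
    fix i assume "i < length ds"
    then show "ds ! i = ds' ! i"
      using Node.IH[of "ts ! i" "ds ! i" "ds' ! i"] d(4) d'(3) by (simp add: list_all2_conv_all_nth)
  qed
  moreover have "d0 = d0'" using weight_basis_disjoint[OF nonempty_length[OF d(2)] d(3) d'(2)] .
  ultimately show ?case using d d' by simp
qed

definition tree_wt :: "'p tree \<Rightarrow> nat" where "tree_wt t = (THE d. basis_tree t d)"

lemma tree_wt: "basis_tree t d \<Longrightarrow> tree_wt t = d"
  unfolding tree_wt_def using basis_tree_unique by blast

lemma list_all2_basis_tree:
  "list_all2 basis_tree ts ds \<longleftrightarrow> (\<forall>t\<in>set ts. basis_tree t (tree_wt t)) \<and> ds = map tree_wt ts"
proof
  assume *: "list_all2 basis_tree ts ds"
  then have "ds = map tree_wt ts"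
    by (intro nth_equalityI) (auto simp: list_all2_conv_all_nth tree_wt)
  moreover have "\<forall>t\<in>set ts. basis_tree t (tree_wt t)"
    using * by (auto simp: list_all2_conv_all_nth in_set_conv_nth) (metis tree_wt)
  ultimately show "(\<forall>t\<in>set ts. basis_tree t (tree_wt t)) \<and> ds = map tree_wt ts" by blast
qed (auto simp: list_all2_conv_all_nth)

lemma basis_tree_Node_iff:
  "basis_tree (Node b ts) d \<longleftrightarrow> ts \<noteq> [] \<and> ts = enum (set ts) \<and> (\<forall>t\<in>set ts. basis_tree t (tree_wt t)) \<and>
     (\<exists>d0. 1 \<le> d0 \<and> b \<in> weight_basis d0 (length ts) \<and> d = d0 + sum_list (map tree_wt ts))"
proof
  assume "basis_tree (Node b ts) d"
  then show "ts \<noteq> [] \<and> ts = enum (set ts) \<and> (\<forall>t\<in>set ts. basis_tree t (tree_wt t)) \<and>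
     (\<exists>d0. 1 \<le> d0 \<and> b \<in> weight_basis d0 (length ts) \<and> d = d0 + sum_list (map tree_wt ts))"
    by (rule basis_tree_NodeE) (auto simp: list_all2_basis_tree)
qed (auto simp: list_all2_basis_tree intro!: basis_tree.intros)

lemma basis_tree_leaves: "basis_tree t d \<Longrightarrow> leaves t \<noteq> []"
  using basis_tree_wf leaves_nonempty by blast

lemma vertices_le_weight: "basis_tree u d \<Longrightarrow> vertices u \<le> d"
proof (induction u arbitrary: d)
  case (Node b us)
  then have "\<forall>t\<in>set us. vertices t \<le> tree_wt t" by (auto simp: basis_tree_Node_iff)
  then have "sum_list (map vertices us) \<le> sum_list (map tree_wt us)" by (intro sum_list_mono) auto
  then show ?case using Node.prems by (auto simp: basis_tree_Node_iff)
qed simp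

lemma length_le_leaves:
  "\<forall>t\<in>set ts. leaves t \<noteq> [] \<Longrightarrow> length ts \<le> length (concat (map leaves ts))"
proof (induction ts)
  case (Cons t ts)
  then show ?case by (cases "leaves t") auto
qed simp

text \<open>
  Vertices with one child may occur, but every vertex has positive weight; so the number of trees is
  finite in each weight.
\<close>

lemma finite_trees_bounded:
  assumes A: "finite A"
  shows "finite {u. basis_tree u d \<and> set (leaves u) \<subseteq> A \<and> length (leaves u) \<le> k}"
proof (induction d rule: less_induct)
  case (less d)
  let ?S = "\<lambda>d. {u. basis_tree u d \<and> set (leaves u) \<subseteq> A \<and> length (leaves u) \<le> k}"
  let ?F = "\<Union>d'<d. ?S d'" and ?B = "\<Union>d0\<le>d. \<Union>m\<in>{1..k}. weight_basis d0 m"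
  have "finite ?F" using less by auto
  moreover have "finite ?B" using weight_basis(1) by auto
  ultimately have "finite (Leaf ` A \<union> (\<lambda>(b, ts). Node b ts) ` (?B \<times> {ts. set ts \<subseteq> ?F \<and> length ts \<le> k}))"
    using A by (intro finite_UnI finite_imageI finite_cartesian_product finite_lists_length_le) auto
  moreover have "?S d \<subseteq> Leaf ` A \<union> (\<lambda>(b, ts). Node b ts) ` (?B \<times> {ts. set ts \<subseteq> ?F \<and> length ts \<le> k})"
  proof
    fix u assume u: "u \<in> ?S d"
    show "u \<in> Leaf ` A \<union> (\<lambda>(b, ts). Node b ts) ` (?B \<times> {ts. set ts \<subseteq> ?F \<and> length ts \<le> k})"
    proof (cases u)
      case (Leaf l)
      then show ?thesis using u by auto
    next
      case (Node b ts)
      then obtain d0 where d0: "1 \<le> d0" "b \<in> weight_basis d0 (length ts)" "d = d0 + sum_list (map tree_wt ts)"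
        and ts: "ts \<noteq> []" "\<forall>t\<in>set ts. basis_tree t (tree_wt t)"
        using u by (auto simp: basis_tree_Node_iff)
      have "length ts \<le> length (concat (map leaves ts))"
        using ts(2) basis_tree_leaves by (intro length_le_leaves) blast
      also have "\<dots> \<le> k" using u Node by simp
      finally have len: "length ts \<le> k" .
      have "set ts \<subseteq> ?F"
      proof
        fix t assume t: "t \<in> set ts"
        have "tree_wt t \<le> sum_list (map tree_wt ts)" using t by (intro member_le_sum_list) auto
        then have "tree_wt t < d" using d0 by simp
        moreover have "length (leaves t) \<le> length (concat (map leaves ts))"
          unfolding length_concat using t by (intro member_le_sum_list) auto
        ultimately show "t \<in> ?F" using t ts u Node by auto
      qed
      moreover have "b \<in> ?B"
        using d0 len nonempty_length[OF ts(1)] by (intro UN_I[of d0] UN_I[of "length ts"]) auto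
      ultimately have "(b, ts) \<in> ?B \<times> {ts. set ts \<subseteq> ?F \<and> length ts \<le> k}"
        using len by blast
      from imageI[OF this, of "\<lambda>(b, ts). Node b ts"] show ?thesis
        unfolding Node prod.case by (rule UnI2)
    qed
  qed
  ultimately show ?case using finite_subset by blast
qed

definition label_trees :: "nat set \<Rightarrow> nat \<Rightarrow> 'p tree set" where
  "label_trees S d = {u. basis_tree u d \<and> distinct (leaves u) \<and> set (leaves u) = S}"

lemma finite_label_trees: "finite S \<Longrightarrow> finite (label_trees S d)"
  by (rule finite_subset[OF _ finite_trees_bounded[of S d "card S"]])
     (auto simp: label_trees_def distinct_card[symmetric])

lemma basis_trees_label_trees:
  "basis_trees (mset [0..<n]) s d = {u \<in> label_trees {..<n} d. vertices u = s}"
  by (auto simp: basis_trees_def label_trees_def mset_upt_iff simp del: mset_upt)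

text \<open>
  The bar complex of a Koszul operad has homology in the top degree only, so this is a case of
  \<open>euler_char_top\<close>: the map \<open>\<Phi>\<close> that extracts the coefficients of the basis trees identifies the
  bar complex, a quotient, with a complex of subspaces spanned by basis trees.
\<close>

theorem koszul_euler_char:
  assumes kos: "koszul P W" and n: "1 \<le> n"
  shows "(\<Sum>u\<in>label_trees {..<n} d. (-1) ^ vertices u) =
    (-1) ^ d * int (dim_mod fscale null (koszul_dual P W d n))"
proof -
  \<comment> \<open>\<open>A s\<close> is the model of the part with \<open>s\<close> vertices, and its differential is \<open>\<Phi> \<circ> \<delta>\<close>.\<close>
  define X where "X = label_trees {..<n} d"
  define T where "T s = basis_trees (mset [0..<n]) s d" for s
  define A :: "nat \<Rightarrow> ('p tree \<Rightarrow>\<^sub>0 'k) set" where "A s = fs.span (basis_vec ` T s)" for s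
  let ?C = "\<lambda>s. bar_part P W s d n"
  define \<Phi> :: "('p tree \<Rightarrow>\<^sub>0 'k) \<Rightarrow> ('p tree \<Rightarrow>\<^sub>0 'k)" where
    "\<Phi> x = (\<Sum>u\<in>X. fscale (pairing (coef u) x) (basis_vec u))" for x
  let ?\<delta> = "bar_diff P"
  have X: "finite X" unfolding X_def by (rule finite_label_trees) simp
  have T: "T s = {u \<in> X. vertices u = s}" for s
    by (simp only: T_def X_def basis_trees_label_trees)
  have keysA: "A s = {x. Poly_Mapping.keys x \<subseteq> T s}" for s unfolding A_def by (rule span_basis_vec)
  have subA: "fs.subspace (A s)" for s unfolding A_def by (rule fs.subspace_span)
  have \<Phi>_linear: "Vector_Spaces.linear fscale fscale \<Phi>"
    by (simp add: Vector_Spaces.linear_iff vector_space_fscale \<Phi>_def pairing_add pairing_scale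
        fs.scale_left_distrib sum.distrib fs.scale_sum_right)
  note \<Phi>_diff = fsp.linear_diff[OF \<Phi>_linear]
  have \<delta>_linear: "Vector_Spaces.linear fscale fscale ?\<delta>"
    unfolding bar_diff_def by (rule linear_lin)
  have \<delta>_diff: "?\<delta> (x - y) = ?\<delta> x - ?\<delta> y" for x y by (simp add: bar_diff_def lin_diff)
  have \<Phi>_null: "\<Phi> x = 0" if "x \<in> null" for x
    unfolding \<Phi>_def using coef_null[OF that] by simp
  have \<Phi>_id: "\<Phi> x = x" if "x \<in> A s" for x s
  proof -
    have "\<Phi> (basis_vec t) = basis_vec t" if t: "t \<in> X" for t
    proof -
      have "coef u t = of_bool (u = t)" if "u \<in> X" for u
        using coef_basis_tree that t by (auto simp: X_def label_trees_def)
      then have "\<Phi> (basis_vec t) = (\<Sum>u\<in>X. if u = t then basis_vec u else 0)"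
        unfolding \<Phi>_def by (intro sum.cong refl) simp
      then show ?thesis using X t by simp
    qed
    then have "lin (\<lambda>t. \<Phi> (basis_vec t)) x = lin basis_vec x"
      using that T by (intro lin_cong) (auto simp: keysA)
    moreover have "lin (\<lambda>t. \<Phi> (basis_vec t)) x = \<Phi> (lin basis_vec x)"
      by (simp only: lin_def fsp.linear_sum[OF \<Phi>_linear] fsp.linear_scale[OF \<Phi>_linear])
    ultimately show ?thesis by simp
  qed
  have A_C: "A s \<subseteq> ?C s" for s
    unfolding A_def bar_part_def
    by (intro fs.span_mono image_mono) (auto simp: T_def basis_trees_def trees_def dest: basis_tree_wf)
  have C_spanned: "x \<in> spanned (T s)" if "x \<in> ?C s" for x s
  proof -
    let ?Y = "{t \<in> trees Pbar n. vertices t = s \<and> tree_weight W t d}"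
    have "Poly_Mapping.keys x \<subseteq> ?Y" using that unfolding bar_part_def span_basis_vec by simp
    moreover have "x - x \<in> null" using fs.subspace_0[OF subspace_null] by simp
    ultimately have "x \<in> spanned ?Y" unfolding spanned_def by blast
    then show ?thesis
    proof (rule spanned_trans)
      fix t assume t: "t \<in> ?Y"
      then have "distinct (leaves t)" using mset_upt_iff[of "leaves t" n] by (auto simp: trees_def)
      then show "basis_vec t \<in> spanned (T s)"
        using basis_tree_spanned[of t d] t by (auto simp: T_def trees_def)
    qed
  qed
  have \<Phi>_C: "\<Phi> x \<in> A s \<and> x - \<Phi> x \<in> null" if x: "x \<in> ?C s" for x s
  proof -
    obtain y where y: "Poly_Mapping.keys y \<subseteq> T s" "x - y \<in> null"
      using C_spanned[OF x] by (auto simp: spanned_def)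
    then have "y \<in> A s" by (simp add: keysA)
    moreover have "\<Phi> x = \<Phi> y" using \<Phi>_null[OF y(2)] \<Phi>_diff by simp
    ultimately show ?thesis using \<Phi>_id y by simp
  qed
  have \<delta>_C: "?\<delta> x \<in> ?C s" if x: "x \<in> ?C (Suc s)" for x s
  proof -
    have keys: "t \<in> trees Pbar n \<and> vertices t = Suc s \<and> tree_weight W t d" if "t \<in> Poly_Mapping.keys x" for t
      using x that unfolding bar_part_def span_basis_vec by auto
    show ?thesis unfolding bar_diff_def
    proof (rule lin_in_subspace)
      show "fs.subspace (?C s)" by (simp add: bar_part_def)
      fix t assume "t \<in> Poly_Mapping.keys x"
      note t = keys[OF this]
      show "bar_diff_tree P t \<in> ?C s"
        unfolding bar_part_def span_basis_vec
        using t wf_bar_diff leaves_bar_diff vertices_bar_diff weight_bar_diff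
        by (fastforce simp: trees_def)
    qed
  qed
  have \<delta>\<delta>: "?\<delta> (?\<delta> x) = 0" if "x \<in> ?C s" for x s
  proof -
    have "wf_tree Pbar t" if "t \<in> Poly_Mapping.keys x" for t
      using \<open>x \<in> ?C s\<close> that unfolding bar_part_def span_basis_vec by (auto simp: trees_def)
    then have "lin (\<lambda>t. ?\<delta> (bar_diff_tree P t)) x = lin (\<lambda>t. 0) x"
      by (intro lin_cong bar_diff_bar_diff)
    then show ?thesis by (simp add: bar_diff_def lin_lin)
  qed
  have \<Phi>\<delta>: "\<Phi> (?\<delta> (\<Phi> x)) = \<Phi> (?\<delta> x)" if "x \<in> ?C s" for x s
  proof -
    have "?\<delta> (x - \<Phi> x) \<in> null" using \<Phi>_C[OF that] bar_diff_null by blast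
    then have "\<Phi> (?\<delta> x - ?\<delta> (\<Phi> x)) = 0" using \<Phi>_null \<delta>_diff by simp
    then show ?thesis by (simp add: \<Phi>_diff)
  qed
  have \<delta>_null_iff: "\<Phi> (?\<delta> x) = 0 \<longleftrightarrow> ?\<delta> x \<in> null" if "x \<in> ?C s" for x s
  proof
    assume *: "\<Phi> (?\<delta> x) = 0"
    show "?\<delta> x \<in> null"
    proof (cases s)
      case 0
      then have "Poly_Mapping.keys x \<subseteq> {t. vertices t = 0}"
        using that unfolding bar_part_def span_basis_vec by auto
      then have "?\<delta> x = lin (\<lambda>t. 0) x"
        unfolding bar_diff_def
      proof (intro lin_cong)
        fix t assume "t \<in> Poly_Mapping.keys x" "Poly_Mapping.keys x \<subseteq> {t. vertices t = 0}"
        then show "bar_diff_tree P t = 0" by (cases t) auto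
      qed
      then show ?thesis by (simp add: null_intros)
    next
      case (Suc s')
      then have "?\<delta> x - \<Phi> (?\<delta> x) \<in> null" using \<Phi>_C \<delta>_C that by blast
      then show ?thesis using * by simp
    qed
  qed (rule \<Phi>_null)
  let ?D = "\<lambda>x. \<Phi> (?\<delta> x)"
  have D_linear: "Vector_Spaces.linear fscale fscale ?D"
    using Vector_Spaces.linear_compose[OF \<delta>_linear \<Phi>_linear] by (simp add: o_def)
  have "(\<Sum>s\<le>d. (-1) ^ s * int (card (T s))) = (-1) ^ d * int (fs.dim {x \<in> A d. ?D x = 0})"
  proof (rule euler_char_top[OF D_linear])
    show "finite (T s)" for s using X T by simp
    show "A s = fs.span (basis_vec ` T s)" for s by (rule A_def)
    show "?D ` A 0 \<subseteq> {0}"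
    proof
      fix z assume "z \<in> ?D ` A 0"
      then obtain x where x: "x \<in> A 0" "z = ?D x" by auto
      have "?\<delta> x = lin (\<lambda>t. 0) x"
        unfolding bar_diff_def
      proof (rule lin_cong)
        fix t assume "t \<in> Poly_Mapping.keys x"
        then have "vertices t = 0" using x T by (auto simp: keysA)
        then show "bar_diff_tree P t = 0" by (cases t) auto
      qed
      then show "z \<in> {0}" using x fsp.linear_0[OF \<Phi>_linear] by simp
    qed
    fix s assume s: "s < d"
    show "{x \<in> A s. ?D x = 0} = ?D ` A (Suc s)"
    proof (intro equalityI subsetI)
      fix x assume "x \<in> {x \<in> A s. ?D x = 0}"
      then have x: "x \<in> A s" "x \<in> ?C s" "?D x = 0" using A_C by auto
      then have "?\<delta> x \<in> null" using \<delta>_null_iff by blast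
      then obtain y where y: "y \<in> ?C (Suc s)" "x - ?\<delta> y \<in> null"
      proof -
        have "\<forall>s. \<forall>z\<in>?C s. ?\<delta> z \<in> null \<longrightarrow>
            (\<exists>x\<in>(if s = d then koszul_dual P W d n else {0}). \<exists>y\<in>?C (Suc s). z - x - ?\<delta> y \<in> null)"
          using kos n unfolding koszul_def inclusion_quasi_iso_def by simp
        then have "\<exists>x'\<in>(if s = d then koszul_dual P W d n else {0}). \<exists>y\<in>?C (Suc s). x - x' - ?\<delta> y \<in> null"
          using x(2) \<open>?\<delta> x \<in> null\<close> by blast
        then have "\<exists>y\<in>?C (Suc s). x - ?\<delta> y \<in> null" using s by simp
        then show thesis using that by blast
      qed
      have "x = \<Phi> x" using \<Phi>_id[OF x(1)] by simp
      also have "\<dots> = ?D y" using \<Phi>_null[OF y(2)] \<Phi>_diff by simp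
      also have "\<dots> = ?D (\<Phi> y)" using \<Phi>\<delta>[OF y(1)] by simp
      finally show "x \<in> ?D ` A (Suc s)" using \<Phi>_C[OF y(1)] by blast
    next
      fix x assume "x \<in> ?D ` A (Suc s)"
      then obtain y where y: "y \<in> A (Suc s)" "x = ?D y" by auto
      then have C: "y \<in> ?C (Suc s)" "?\<delta> y \<in> ?C s" using A_C \<delta>_C by blast+
      have "?D x = \<Phi> (?\<delta> (?\<delta> y))" unfolding y(2) by (rule \<Phi>\<delta>[OF C(2)])
      also have "\<dots> = 0" using \<delta>\<delta>[OF C(1)] fsp.linear_0[OF \<Phi>_linear] by simp
      finally show "x \<in> {x \<in> A s. ?D x = 0}" using \<Phi>_C[OF C(2)] y(2) by simp
    qed
  qed
  also have "{x \<in> A d. ?D x = 0} = \<Phi> ` koszul_dual P W d n"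
  proof (intro equalityI subsetI)
    fix x assume "x \<in> {x \<in> A d. ?D x = 0}"
    then have x: "x \<in> A d" "x \<in> ?C d" "?D x = 0" using A_C by auto
    then have "x \<in> koszul_dual P W d n" using \<delta>_null_iff by (auto simp: koszul_dual_def)
    then show "x \<in> \<Phi> ` koszul_dual P W d n" using \<Phi>_id[OF x(1)] by force
  next
    fix x assume "x \<in> \<Phi> ` koszul_dual P W d n"
    then obtain y where y: "x = \<Phi> y" "y \<in> ?C d" "?\<delta> y \<in> null" by (auto simp: koszul_dual_def)
    then show "x \<in> {x \<in> A d. ?D x = 0}" using \<Phi>_C[OF y(2)] \<Phi>\<delta>[OF y(2)] \<Phi>_null by simp
  qed
  also have "fs.dim \<dots> = dim_mod fscale null (koszul_dual P W d n)"
  proof (rule dim_mod_eq_dim_image[OF \<Phi>_linear _ subspace_null, symmetric])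
    have C: "fs.subspace (?C d)" by (simp add: bar_part_def)
    show "fs.subspace (koszul_dual P W d n)"
      unfolding koszul_dual_def bar_diff_def
      using fs.subspace_0[OF C] fs.subspace_add[OF C] fs.subspace_scale[OF C]
      by (intro fs.subspaceI) (auto simp: lin_add lin_scale null_intros)
    show "\<Phi> x = 0 \<longleftrightarrow> x \<in> null" if "x \<in> koszul_dual P W d n" for x
      using \<Phi>_C[of x d] that \<Phi>_null by (auto simp: koszul_dual_def)
    show "\<Phi> ` koszul_dual P W d n \<subseteq> fs.span (basis_vec ` T d)"
      using \<Phi>_C by (auto simp: koszul_dual_def A_def)
    show "finite (basis_vec ` T d :: ('p tree \<Rightarrow>\<^sub>0 'k) set)" using X T by simp
  qed
  finally have "(\<Sum>s\<le>d. (-1) ^ s * int (card (T s))) =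
    (-1) ^ d * int (dim_mod fscale null (koszul_dual P W d n))" .
  moreover have "(\<Sum>s\<le>d. (-1) ^ s * int (card (T s))) = (\<Sum>s\<le>d. \<Sum>u\<in>{u. u \<in> X \<and> vertices u = s}. (-1) ^ vertices u)"
    using T by (intro sum.cong refl) simp
  moreover have "\<dots> = (\<Sum>u\<in>X. (-1) ^ vertices u)"
    using vertices_le_weight by (intro sum.group X) (auto simp: X_def label_trees_def)
  ultimately show ?thesis by (simp add: X_def)
qed

section \<open>Counting trees\<close>

definition signed_count :: "nat set \<Rightarrow> nat \<Rightarrow> rat" where
  "signed_count S d = (\<Sum>u\<in>label_trees S d. (-1) ^ vertices u)"

text \<open>
  Ordered set partitions of \<open>S\<close> with a tree on each block: the possible children of a root vertex,
  in all orders.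
\<close>

definition forests :: "nat \<Rightarrow> nat set \<Rightarrow> nat \<Rightarrow> 'p tree list set" where
  "forests j S e = {ts. length ts = j \<and> (\<forall>t\<in>set ts. basis_tree t (tree_wt t)) \<and>
     sum_list (map tree_wt ts) = e \<and> distinct (concat (map leaves ts)) \<and> set (concat (map leaves ts)) = S}"

definition forest_sign :: "'p tree list \<Rightarrow> rat" where
  "forest_sign ts = (-1) ^ sum_list (map vertices ts)"

definition forest_count :: "nat \<Rightarrow> nat set \<Rightarrow> nat \<Rightarrow> rat" where
  "forest_count j S e = (\<Sum>ts\<in>forests j S e. forest_sign ts)"

lemma label_trees_wt: "label_trees S d = {u. basis_tree u (tree_wt u) \<and> tree_wt u = d \<and>
    distinct (leaves u) \<and> set (leaves u) = S}"
  unfolding label_trees_def using tree_wt by blast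

lemma finite_forests:
  assumes "finite S"
  shows "finite (forests j S e)"
proof -
  let ?F = "\<Union>d\<le>e. {u. basis_tree u d \<and> set (leaves u) \<subseteq> S \<and> length (leaves u) \<le> card S}"
  have "forests j S e \<subseteq> {ts. set ts \<subseteq> ?F \<and> length ts = j}"
  proof
    fix ts assume ts: "ts \<in> forests j S e"
    have "t \<in> ?F" if t: "t \<in> set ts" for t
    proof -
      have "tree_wt t \<le> sum_list (map tree_wt ts)" using t by (intro member_le_sum_list) auto
      moreover have "length (leaves t) \<le> length (concat (map leaves ts))"
        unfolding length_concat using t by (intro member_le_sum_list) auto
      moreover have "length (concat (map leaves ts)) = card S"
        using ts distinct_card[of "concat (map leaves ts)"] by (simp add: forests_def)
      ultimately show ?thesis using t ts by (auto simp: forests_def)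
    qed
    then show "ts \<in> {ts. set ts \<subseteq> ?F \<and> length ts = j}" using ts by (auto simp: forests_def)
  qed
  moreover have "finite ?F" using finite_trees_bounded[OF assms] by auto
  ultimately show ?thesis using finite_lists_length_eq finite_subset by blast
qed

lemma forest_count_0: "forest_count 0 S e = of_bool (S = {} \<and> e = 0)"
proof -
  have "forests 0 S e = (if S = {} \<and> e = 0 then {[]} else {})"
    by (auto simp: forests_def)
  then show ?thesis by (simp add: forest_count_def forest_sign_def)
qed

lemma forests_Cons:
  "t # us \<in> forests (Suc j) S e \<longleftrightarrow> t \<in> label_trees (set (leaves t)) (tree_wt t) \<and>
     set (leaves t) \<subseteq> S \<and> tree_wt t \<le> e \<and> us \<in> forests j (S - set (leaves t)) (e - tree_wt t)"
proof -
  define U where "U = set (concat (map leaves us))"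
  define L where "L = set (leaves t)"
  define v where "v = sum_list (map tree_wt us)"
  have "(L \<inter> U = {} \<and> L \<union> U = S) \<longleftrightarrow> (L \<subseteq> S \<and> U = S - L)" by blast
  moreover have "tree_wt t + v = e \<longleftrightarrow> tree_wt t \<le> e \<and> v = e - tree_wt t" by linarith
  moreover have "t # us \<in> forests (Suc j) S e \<longleftrightarrow> length us = j \<and> basis_tree t (tree_wt t) \<and>
      (\<forall>t\<in>set us. basis_tree t (tree_wt t)) \<and> tree_wt t + v = e \<and> distinct (leaves t) \<and>
      distinct (concat (map leaves us)) \<and> (L \<inter> U = {} \<and> L \<union> U = S)"
    by (simp add: forests_def U_def L_def v_def)
  moreover have "us \<in> forests j (S - L) (e - tree_wt t) \<longleftrightarrow> length us = j \<and>
      (\<forall>t\<in>set us. basis_tree t (tree_wt t)) \<and> v = e - tree_wt t \<and>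
      distinct (concat (map leaves us)) \<and> U = S - L"
    unfolding forests_def U_def v_def by blast
  moreover have "t \<in> label_trees L (tree_wt t) \<longleftrightarrow> basis_tree t (tree_wt t) \<and> distinct (leaves t)"
    by (simp add: label_trees_def L_def)
  ultimately show ?thesis unfolding L_def[symmetric] by argo
qed

lemma forest_count_Suc:
  assumes S: "finite S"
  shows "forest_count (Suc j) S e =
    (\<Sum>A\<in>Pow S. \<Sum>e'\<le>e. signed_count A e' * forest_count j (S - A) (e - e'))"
proof -
  let ?h = "\<lambda>ts. (set (leaves (hd ts)), tree_wt (hd ts))"
  have "forest_count (Suc j) S e =
      (\<Sum>y\<in>Pow S \<times> {..e}. \<Sum>ts\<in>{ts. ts \<in> forests (Suc j) S e \<and> ?h ts = y}. forest_sign ts)"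
    unfolding forest_count_def
  proof (rule sum.group[symmetric])
    show "?h ` forests (Suc j) S e \<subseteq> Pow S \<times> {..e}"
      by (auto simp: forests_def length_Suc_conv)
  qed (use S finite_forests in auto)
  also have "\<dots> = (\<Sum>(A, e')\<in>Pow S \<times> {..e}. signed_count A e' * forest_count j (S - A) (e - e'))"
  proof (rule sum.cong[OF refl])
    fix y assume "y \<in> Pow S \<times> {..e}"
    then obtain A e' where y: "y = (A, e')" and A: "A \<subseteq> S" "e' \<le> e" by auto
    have eq: "{ts. ts \<in> forests (Suc j) S e \<and> ?h ts = (A, e')} =
        (\<lambda>(t, ts). t # ts) ` (label_trees A e' \<times> forests j (S - A) (e - e'))"
    proof (intro equalityI subsetI)
      fix ts assume "ts \<in> {ts. ts \<in> forests (Suc j) S e \<and> ?h ts = (A, e')}"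
      then have F: "ts \<in> forests (Suc j) S e" and h: "set (leaves (hd ts)) = A" "tree_wt (hd ts) = e'"
        by simp_all
      obtain t us where ts: "ts = t # us" using F by (cases ts) (simp_all add: forests_def)
      have "t \<in> label_trees A e'" "us \<in> forests j (S - A) (e - e')"
        using F h forests_Cons[of t us j S e] unfolding ts by simp_all
      then have "(t, us) \<in> label_trees A e' \<times> forests j (S - A) (e - e')" by (rule SigmaI)
      from imageI[OF this, of "\<lambda>(t, ts). t # ts"]
      show "ts \<in> (\<lambda>(t, ts). t # ts) ` (label_trees A e' \<times> forests j (S - A) (e - e'))"
        unfolding ts prod.case .
    next
      fix ts assume "ts \<in> (\<lambda>(t, ts). t # ts) ` (label_trees A e' \<times> forests j (S - A) (e - e'))"
      then obtain t us where ts: "ts = t # us" and t: "t \<in> label_trees A e'"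
        and us: "us \<in> forests j (S - A) (e - e')" by (elim imageE SigmaE) simp
      have "set (leaves t) = A" "tree_wt t = e'" using t by (simp_all add: label_trees_wt)
      then show "ts \<in> {ts. ts \<in> forests (Suc j) S e \<and> ?h ts = (A, e')}"
        using A t us unfolding ts by (simp add: forests_Cons)
    qed
    have inj: "inj_on (\<lambda>(t, ts). t # ts) (label_trees A e' \<times> forests j (S - A) (e - e'))"
      by (auto simp: inj_on_def)
    have "(\<Sum>ts\<in>{ts. ts \<in> forests (Suc j) S e \<and> ?h ts = (A, e')}. forest_sign ts) =
        (\<Sum>(t, ts)\<in>label_trees A e' \<times> forests j (S - A) (e - e'). forest_sign (t # ts))"
      unfolding eq sum.reindex[OF inj] by (simp add: o_def case_prod_beta)
    also have "\<dots> = signed_count A e' * forest_count j (S - A) (e - e')"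
      unfolding signed_count_def forest_count_def sum_product sum.cartesian_product
      by (intro sum.cong refl) (auto simp: forest_sign_def power_add)
    finally show "(\<Sum>ts\<in>{ts. ts \<in> forests (Suc j) S e \<and> ?h ts = y}. forest_sign ts) =
        (case y of (A, e') \<Rightarrow> signed_count A e' * forest_count j (S - A) (e - e'))"
      unfolding y prod.case .
  qed
  finally show ?thesis by (simp add: sum.cartesian_product)
qed

text \<open>
  The trees of a forest are pairwise distinct, so they have \<open>fact j\<close> orderings, exactly one of which
  is the chosen enumeration.
\<close>

lemma forest_count_canonical:
  assumes S: "finite S"
  shows "forest_count j S e = fact j * (\<Sum>ts | ts \<in> forests j S e \<and> ts = enum (set ts). forest_sign ts)"
proof -
  let ?F = "forests j S e"
  let ?sgn = "\<lambda>X. (-1 :: rat) ^ (\<Sum>t\<in>X. vertices t)"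
  have dist: "distinct ts" if "ts \<in> ?F" for ts
    using that basis_tree_wf by (intro distinct_children) (auto simp: forests_def)
  have sgn: "forest_sign ts = ?sgn (set ts)" if "ts \<in> ?F" for ts
    using dist[OF that] by (simp add: forest_sign_def sum_list_distinct_conv_sum_set)
  have card: "card (set ts) = j" if "ts \<in> ?F" for ts
    using dist[OF that] that by (simp add: distinct_card forests_def)
  have closed: "us \<in> ?F" if ts: "ts \<in> ?F" and us: "set us = set ts" "distinct us" for ts us
  proof -
    have m: "mset us = mset ts" using us dist[OF ts] set_eq_iff_mset_eq_distinct by blast
    have "sum_list (map tree_wt us) = sum_list (map tree_wt ts)"
      using m by (metis mset_map sum_mset_sum_list)
    moreover have m': "mset (concat (map leaves us)) = mset (concat (map leaves ts))"
      using m by (simp only: mset_concat_map)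
    moreover have "length us = length ts" using m by (metis size_mset)
    ultimately show ?thesis
      using ts us(1) mset_eq_imp_distinct_iff[OF m'] by (simp add: forests_def)
  qed
  have perms: "{ts. ts \<in> ?F \<and> set ts = X} = permutations_of_set X" if "X \<in> set ` ?F" for X
    using that closed dist by (auto simp: permutations_of_set_def)
  have "forest_count j S e = (\<Sum>X\<in>set ` ?F. \<Sum>ts\<in>{ts. ts \<in> ?F \<and> set ts = X}. forest_sign ts)"
    unfolding forest_count_def using finite_forests[OF S] by (intro sum.group[symmetric]) auto
  also have "\<dots> = (\<Sum>X\<in>set ` ?F. fact j * ?sgn X)"
  proof (rule sum.cong[OF refl])
    fix X assume X: "X \<in> set ` ?F"
    have "(\<Sum>ts\<in>{ts. ts \<in> ?F \<and> set ts = X}. forest_sign ts) = (\<Sum>ts\<in>{ts. ts \<in> ?F \<and> set ts = X}. ?sgn X)"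
      by (intro sum.cong refl) (auto simp: sgn)
    also have "\<dots> = fact j * ?sgn X"
      using X card by (auto simp: perms)
    finally show "(\<Sum>ts\<in>{ts. ts \<in> ?F \<and> set ts = X}. forest_sign ts) = fact j * ?sgn X" .
  qed
  also have "\<dots> = (\<Sum>ts\<in>{ts. ts \<in> ?F \<and> ts = enum (set ts)}. fact j * forest_sign ts)"
  proof (rule sum.reindex_bij_witness[of _ set enum])
    fix X assume "X \<in> set ` ?F"
    then obtain ts where ts: "ts \<in> ?F" "X = set ts" by auto
    have e: "set (enum X) = X" "distinct (enum X)" using enum[of X] ts by auto
    then show "set (enum X) = X" "enum X \<in> {ts. ts \<in> ?F \<and> ts = enum (set ts)}"
      using closed[OF ts(1)] ts(2) by auto
    then show "fact j * forest_sign (enum X) = fact j * ?sgn X" using sgn[of "enum X"] by simp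
  qed auto
  finally show ?thesis by (simp add: sum_distrib_left)
qed

lemma signed_count_0: "finite S \<Longrightarrow> signed_count S 0 = of_bool (card S = 1)"
proof -
  have "basis_tree u 0 \<longleftrightarrow> (\<exists>l. u = Leaf l)" for u
    by (cases u) (auto simp: basis_tree_Node_iff intro: basis_tree.intros)
  then have "label_trees S 0 = {u. \<exists>l. u = Leaf l \<and> S = {l}}"
    unfolding label_trees_def by auto
  also have "\<dots> = (if card S = 1 then {Leaf (the_elem S)} else {})"
    by (auto simp: card_1_singleton_iff)
  finally show ?thesis by (simp add: signed_count_def)
qed

text \<open>
  A tree of positive weight has a root vertex, which accounts for the minus sign. Division by
  \<open>fact j\<close> passes from lists of children to families.
\<close>

lemma signed_count_rec:
  assumes S: "finite S" and d: "1 \<le> d"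
  shows "signed_count S d = - (\<Sum>j=1..card S. \<Sum>d0=1..d.
    of_nat (card (weight_basis d0 j)) * forest_count j S (d - d0) / fact j)"
proof -
  let ?G = "\<lambda>j e. {ts. ts \<in> forests j S e \<and> ts = enum (set ts)}"
  let ?I = "{1..card S} \<times> {1..d}"
  let ?N = "\<lambda>(j, d0). (\<lambda>(b, ts). Node b ts) ` (weight_basis d0 j \<times> ?G j (d - d0))"
  have U: "label_trees S d = (\<Union>i\<in>?I. ?N i)"
  proof (intro equalityI subsetI)
    fix u assume u: "u \<in> label_trees S d"
    show "u \<in> (\<Union>i\<in>?I. ?N i)"
    proof (cases u)
      case (Leaf l)
      then show ?thesis using u d by (auto simp: label_trees_def elim: basis_tree.cases)
    next
      case (Node b ts)
      then have "basis_tree (Node b ts) d" using u by (simp add: label_trees_def)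
      then obtain d0 where d0: "1 \<le> d0" "b \<in> weight_basis d0 (length ts)" "d = d0 + sum_list (map tree_wt ts)"
        and ts: "ts \<noteq> []" "\<forall>t\<in>set ts. basis_tree t (tree_wt t)" "ts = enum (set ts)"
        by (auto simp: basis_tree_Node_iff)
      have F: "ts \<in> ?G (length ts) (d - d0)"
        using u Node ts d0 by (auto simp: forests_def label_trees_def)
      have "length ts \<le> length (concat (map leaves ts))"
        using ts(2) basis_tree_leaves by (intro length_le_leaves) blast
      also have "\<dots> = card S" using u Node distinct_card[of "leaves u"] by (simp add: label_trees_def)
      finally have "(length ts, d0) \<in> ?I" using d0 nonempty_length[OF ts(1)] by auto
      moreover have "u \<in> ?N (length ts, d0)" using F d0(2) Node by auto
      ultimately show ?thesis by blast
    qed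
  next
    fix u assume "u \<in> (\<Union>i\<in>?I. ?N i)"
    then obtain j d0 b ts where u: "u = Node b ts" "b \<in> weight_basis d0 j" "ts \<in> ?G j (d - d0)"
      "1 \<le> j" "1 \<le> d0" "d0 \<le> d" by auto
    then have "basis_tree (Node b ts) d" by (auto simp: basis_tree_Node_iff forests_def intro!: exI[of _ d0])
    then show "u \<in> label_trees S d" using u by (auto simp: label_trees_def forests_def)
  qed
  have fin: "finite (?N i)" if "i \<in> ?I" for i
    using that weight_basis(1) finite_forests[OF S]
    by (auto intro!: finite_imageI finite_cartesian_product)
  have disj: "?N i \<inter> ?N i' = {}" if i: "i \<in> ?I" "i' \<in> ?I" "i \<noteq> i'" for i i'
  proof (rule ccontr)
    obtain j d0 j' d0' where ii: "i = (j, d0)" "i' = (j', d0')" by (cases i, cases i')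
    assume "?N i \<inter> ?N i' \<noteq> {}"
    then obtain b ts where "b \<in> weight_basis d0 j" "ts \<in> ?G j (d - d0)" "b \<in> weight_basis d0' j'" "ts \<in> ?G j' (d - d0')"
      by (auto simp: ii)
    moreover from this have "j = j'" by (auto simp: forests_def)
    ultimately have "d0 = d0'" using weight_basis_disjoint[of j b d0 d0'] i ii by auto
    then show False using \<open>j = j'\<close> i(3) ii by simp
  qed
  have "signed_count S d = (\<Sum>i\<in>?I. \<Sum>u\<in>?N i. (-1) ^ vertices u)"
    unfolding signed_count_def U using fin disj by (intro sum.UNION_disjoint) auto
  also have "\<dots> = (\<Sum>(j, d0)\<in>?I. - (of_nat (card (weight_basis d0 j)) * forest_count j S (d - d0) / fact j))"
  proof (rule sum.cong[OF refl])
    fix i assume "i \<in> ?I"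
    obtain j d0 where i: "i = (j, d0)" by (cases i)
    have inj: "inj_on (\<lambda>(b, ts). Node b ts) (weight_basis d0 j \<times> ?G j (d - d0))"
      by (auto simp: inj_on_def)
    have "(\<Sum>u\<in>?N i. (-1 :: rat) ^ vertices u) =
        (\<Sum>(b, ts)\<in>weight_basis d0 j \<times> ?G j (d - d0). - forest_sign ts)"
      unfolding i prod.case sum.reindex[OF inj] by (simp add: o_def case_prod_beta forest_sign_def)
    also have "\<dots> = (\<Sum>b\<in>weight_basis d0 j. - (\<Sum>ts\<in>?G j (d - d0). forest_sign ts))"
      by (simp add: sum.cartesian_product[symmetric] sum_negf)
    also have "\<dots> = - (of_nat (card (weight_basis d0 j)) * forest_count j S (d - d0) / fact j)"
      by (simp add: forest_count_canonical[OF S])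
    finally show "(\<Sum>u\<in>?N i. (-1) ^ vertices u) =
      (case i of (j, d0) \<Rightarrow> - (of_nat (card (weight_basis d0 j)) * forest_count j S (d - d0) / fact j))"
      by (simp add: i)
  qed
  finally show ?thesis by (simp add: sum.cartesian_product[symmetric] sum_negf)
qed

definition tree_series :: "rat fps fps" where
  "tree_series = Abs_fps (\<lambda>n. Abs_fps (\<lambda>d. signed_count {..<n} d / fact n))"

lemma tree_series_nth: "tree_series $ n $ d = signed_count {..<n} d / fact n"
  by (simp add: tree_series_def)

lemma sum_Pow_card:
  fixes f :: "nat \<Rightarrow> 'x::comm_semiring_1"
  assumes "finite S"
  shows "(\<Sum>A\<in>Pow S. f (card A)) = (\<Sum>k\<le>card S. of_nat (card S choose k) * f k)"
proof -
  have "(\<Sum>A\<in>Pow S. f (card A)) = (\<Sum>k\<le>card S. \<Sum>A\<in>{A. A \<in> Pow S \<and> card A = k}. f (card A))"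
    using assms by (intro sum.group[symmetric]) (auto simp: card_mono)
  also have "\<dots> = (\<Sum>k\<le>card S. of_nat (card {A. A \<subseteq> S \<and> card A = k}) * f k)"
    by (intro sum.cong refl) simp
  finally show ?thesis using assms by (simp add: n_subsets)
qed

text \<open>
  Splitting off the first tree turns the sum over set partitions into the product of exponential
  generating functions. That numbers of trees depend on the number of labels only is known at this
  point just up to weight \<open>e\<close>, because \<open>signed_count_card\<close> is proved from this lemma by induction on
  the weight.
\<close>

lemma forest_count_power:
  assumes "\<And>e' A. e' \<le> e \<Longrightarrow> finite A \<Longrightarrow> signed_count A e' = signed_count {..<card A} e'"
  shows "e'' \<le> e \<Longrightarrow> finite S \<Longrightarrow> forest_count j S e'' = fact (card S) * (tree_series ^ j) $ card S $ e''"
proof (induction j arbitrary: S e'')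
  case 0
  then show ?case by (auto simp: forest_count_0)
next
  case (Suc j)
  let ?n = "card S" and ?X = "tree_series"
  have "forest_count (Suc j) S e'' =
      (\<Sum>A\<in>Pow S. \<Sum>e'\<le>e''. signed_count A e' * forest_count j (S - A) (e'' - e'))"
    by (rule forest_count_Suc[OF Suc.prems(2)])
  also have "\<dots> = (\<Sum>A\<in>Pow S. fact (card A) * fact (?n - card A) * (?X $ card A * (?X ^ j) $ (?n - card A)) $ e'')"
  proof (rule sum.cong[OF refl])
    fix A assume A: "A \<in> Pow S"
    then have fin: "finite A" "finite (S - A)"
      using Suc.prems(2) finite_subset by auto
    have card: "card (S - A) = ?n - card A" using A fin(1) by (intro card_Diff_subset) auto
    have "signed_count A e' = fact (card A) * ?X $ card A $ e'" if "e' \<le> e''" for e'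
      using assms[of e' A] that fin Suc.prems(1) by (simp add: tree_series_nth)
    then have "(\<Sum>e'\<le>e''. signed_count A e' * forest_count j (S - A) (e'' - e')) =
      (\<Sum>e'\<le>e''. fact (card A) * fact (?n - card A) * (?X $ card A $ e' * (?X ^ j) $ (?n - card A) $ (e'' - e')))"
      using Suc.IH[of _ "S - A"] fin card Suc.prems(1) by (intro sum.cong refl) simp
    then show "(\<Sum>e'\<le>e''. signed_count A e' * forest_count j (S - A) (e'' - e')) =
      fact (card A) * fact (?n - card A) * (?X $ card A * (?X ^ j) $ (?n - card A)) $ e''"
      by (simp add: fps_mult_nth atMost_atLeast0 sum_distrib_left)
  qed
  also have "\<dots> = (\<Sum>k\<le>?n. of_nat (?n choose k) * (fact k * fact (?n - k) * (?X $ k * (?X ^ j) $ (?n - k)) $ e''))"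
    by (rule sum_Pow_card[OF Suc.prems(2)])
  also have "\<dots> = (\<Sum>k\<le>?n. fact ?n * (?X $ k * (?X ^ j) $ (?n - k)) $ e'')"
    by (intro sum.cong refl) (simp add: binomial_fact)
  also have "\<dots> = fact ?n * (?X ^ Suc j) $ ?n $ e''"
    by (simp add: fps_mult_nth[of ?X] atMost_atLeast0 sum_distrib_left fps_sum_nth)
  finally show ?case .
qed

lemma signed_count_card: "finite S \<Longrightarrow> signed_count S d = signed_count {..<card S} d"
proof (induction d arbitrary: S rule: less_induct)
  case (less d)
  show ?case
  proof (cases "d = 0")
    case True
    then show ?thesis using less.prems by (simp add: signed_count_0)
  next
    case False
    have eq: "forest_count j S (d - d0) = forest_count j {..<card S} (d - d0)" if d0: "d0 \<in> {1..d}" for j d0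
    proof -
      have IH: "signed_count A e' = signed_count {..<card A} e'" if "e' \<le> d - d0" "finite A" for e' A
        by (rule less.IH) (use that d0 in auto)
      have "forest_count j A (d - d0) = fact (card A) * (tree_series ^ j) $ card A $ (d - d0)"
        if "finite A" for A
      proof (rule forest_count_power)
        show "signed_count B e' = signed_count {..<card B} e'" if "e' \<le> d - d0" "finite B" for e' B
          using that by (rule IH)
      qed (simp_all add: that)
      from this[OF less.prems] this[OF finite_lessThan[of "card S"]] show ?thesis by simp
    qed
    show ?thesis
    proof -
      have d: "1 \<le> d" using False by simp
      show ?thesis
        unfolding signed_count_rec[OF less.prems d] signed_count_rec[OF finite_lessThan d] card_lessThan
        using eq by simp
    qed
  qed
qed

lemma forest_count_series: "forest_count j {..<n} e = fact n * (tree_series ^ j) $ n $ e"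
proof -
  have "forest_count j {..<n} e = fact (card {..<n}) * (tree_series ^ j) $ card {..<n} $ e"
  proof (rule forest_count_power)
    show "signed_count A e' = signed_count {..<card A} e'" if "finite A" for e' A
      using that by (rule signed_count_card)
  qed (rule order_refl, simp)
  then show ?thesis by simp
qed

text \<open>
  In weight 0 only the term \<open>x\<close> of the Poincare series contributes, and it gives the series of all
  trees. By \<open>signed_count_rec\<close> the contribution of positive weights, from the trees with a root
  vertex, cancels this except for the tree without vertices.
\<close>

theorem poincare_operad_tree_series:
  assumes W0: "\<And>n. 1 \<le> n \<Longrightarrow> vs.dim (W 0 n) = of_bool (n = 1)"
  shows "poincare_operad P W oo tree_series = fps_X"
proof (rule fps_ext, rule fps_ext)
  fix n d
  let ?F = "poincare_operad P W" and ?X = "tree_series"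
  have dim: "vs.dim (W d n) = card (weight_basis d n)" if "1 \<le> n" for d n
    using vs.dim_eq_card[of "weight_basis d n" "W d n"] weight_basis(3,4)[OF that]
    by (metis vs.span_span)
  have F0: "?F $ 0 = 0" by (simp add: poincare_operad_def poincare_series_def)
  have F: "?F $ j $ e = of_nat (vs.dim (W e j)) / fact j" if "1 \<le> j" for j e
    using that by (simp add: poincare_operad_def poincare_series_def)
  have "(?F oo ?X) $ n = (\<Sum>j=1..n. ?F $ j * (?X ^ j) $ n)"
    by (simp add: fps_compose_nth sum.atLeast_Suc_atMost F0)
  then have "(?F oo ?X) $ n $ d = (\<Sum>j=1..n. \<Sum>d0=0..d. ?F $ j $ d0 * (?X ^ j) $ n $ (d - d0))"
    by (simp add: fps_sum_nth fps_mult_nth)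
  also have "\<dots> = (\<Sum>j=1..n. ?F $ j $ 0 * (?X ^ j) $ n $ d) +
      (\<Sum>j=1..n. \<Sum>d0=1..d. ?F $ j $ d0 * (?X ^ j) $ n $ (d - d0))"
    by (simp add: sum.atLeast_Suc_atMost sum.distrib)
  also have "(\<Sum>j=1..n. ?F $ j $ 0 * (?X ^ j) $ n $ d) = (\<Sum>j=1..n. if j = 1 then ?X $ n $ d else 0)"
    by (intro sum.cong refl) (auto simp: F W0)
  also have "\<dots> = signed_count {..<n} d / fact n"
  proof (cases "n = 0")
    case True
    have "label_trees {} d = {}" by (auto simp: label_trees_def dest: basis_tree_leaves)
    then show ?thesis using True by (simp add: signed_count_def)
  qed (simp add: tree_series_nth)
  also have "(\<Sum>j=1..n. \<Sum>d0=1..d. ?F $ j $ d0 * (?X ^ j) $ n $ (d - d0)) =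
      (\<Sum>j=1..n. \<Sum>d0=1..d. of_nat (card (weight_basis d0 j)) * forest_count j {..<n} (d - d0) / fact j) / fact n"
    by (simp add: sum_divide_distrib F dim forest_count_series)
  finally have "(?F oo ?X) $ n $ d = (signed_count {..<n} d +
      (\<Sum>j=1..n. \<Sum>d0=1..d. of_nat (card (weight_basis d0 j)) * forest_count j {..<n} (d - d0) / fact j)) / fact n"
    by (simp add: add_divide_distrib)
  also have "\<dots> = fps_X $ n $ d"
  proof (cases "d = 0")
    case True
    then show ?thesis by (simp add: signed_count_0 fps_X_def)
  next
    case False
    then show ?thesis by (simp add: signed_count_rec fps_X_def)
  qed
  finally show "(?F oo ?X) $ n $ d = fps_X $ n $ d" .
qed

theorem tree_series_koszul_dual:
  assumes "koszul P W"
  shows "tree_series = negate_y (poincare_koszul_dual P W)"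
proof (rule fps_ext, rule fps_ext)
  fix n d
  show "tree_series $ n $ d = negate_y (poincare_koszul_dual P W) $ n $ d"
  proof (cases "n = 0")
    case True
    have "label_trees {} d = {}" by (auto simp: label_trees_def dest: basis_tree_leaves)
    then show ?thesis
      using True by (simp add: negate_y_nth tree_series_nth signed_count_def poincare_koszul_dual_def poincare_series_def)
  next
    case False
    then have "(\<Sum>u\<in>label_trees {..<n} d. (-1) ^ vertices u) =
        (-1) ^ d * int (dim_mod fscale null (koszul_dual P W d n))"
      by (intro koszul_euler_char[OF assms]) simp
    then have "of_int (\<Sum>u\<in>label_trees {..<n} d. (-1) ^ vertices u) =
        (of_int ((-1) ^ d * int (dim_mod fscale null (koszul_dual P W d n))) :: rat)"
      by (simp only:)
    then show ?thesis
      using False by (simp add: negate_y_nth tree_series_nth signed_count_def poincare_koszul_dual_def poincare_series_def)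
  qed
qed

end

section \<open>Composition of power series\<close>

lemma negate_y_negate_y: "negate_y (negate_y F) = F"
  by (simp add: fps_eq_iff negate_y_nth mult.assoc[symmetric] power_mult_distrib[symmetric])

lemma negate_y_mult: "negate_y (F * G) = negate_y F * negate_y G"
proof (rule fps_ext)
  fix n
  show "negate_y (F * G) $ n = (negate_y F * negate_y G) $ n"
    by (simp add: negate_y_def fps_mult_nth fps_compose_sum_distrib fps_compose_mult_distrib)
qed

lemma negate_y_fps_X: "negate_y fps_X = fps_X"
  by (auto simp: fps_eq_iff negate_y_nth fps_X_def)

lemma negate_y_power: "negate_y (F ^ i) = negate_y F ^ i"
proof (induction i)
  case 0
  then show ?case by (simp add: fps_eq_iff negate_y_nth)
qed (simp add: negate_y_mult)

lemma negate_y_compose: "negate_y (F oo G) = negate_y F oo negate_y G"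
proof (rule fps_ext)
  fix n
  show "negate_y (F oo G) $ n = (negate_y F oo negate_y G) $ n"
    by (simp add: negate_y_power[symmetric] fps_compose_nth)
       (simp add: negate_y_def fps_compose_nth fps_compose_sum_distrib fps_compose_mult_distrib)
qed

lemma fps_power_nth_cong:
  fixes A B :: "'a::comm_ring_1 fps"
  assumes "\<And>k. k < n \<Longrightarrow> A $ k = B $ k" "m < n"
  shows "(A ^ j) $ m = (B ^ j) $ m"
  using assms(2)
proof (induction j arbitrary: m)
  case (Suc j)
  then show ?case by (auto simp: fps_mult_nth assms(1) intro!: sum.cong)
qed simp

text \<open>
  In degree \<open>n\<close> the powers \<open>A\<^sup>i\<close> with \<open>i \<ge> 2\<close> involve only coefficients of \<open>A\<close> of degree less
  than \<open>n\<close>, so the coefficients of \<open>A\<close> can be recovered one after the other.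
\<close>

lemma fps_compose_left_cancel:
  fixes F A B :: "'a::idom fps"
  assumes F: "F $ 1 \<noteq> 0" and 0: "A $ 0 = 0" "B $ 0 = 0" and eq: "F oo A = F oo B"
  shows "A = B"
proof (rule fps_ext)
  fix n
  show "A $ n = B $ n"
  proof (induction n rule: less_induct)
    case (less n)
    show ?case
    proof (cases "n = 0")
      case True
      then show ?thesis using 0 by simp
    next
      case False
      have higher: "(A ^ i) $ n = (B ^ i) $ n" if "2 \<le> i" for i
      proof -
        define j where "j = i - 1"
        have i: "i = Suc j" "1 \<le> j" using that by (auto simp: j_def)
        have "(A * A ^ j) $ n = (B * B ^ j) $ n"
          unfolding fps_mult_nth
        proof (rule sum.cong[OF refl])
          fix k assume k: "k \<in> {0..n}"
          consider "k = 0" | "k = n" | "0 < k" "k < n" using k by force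
          then show "A $ k * (A ^ j) $ (n - k) = B $ k * (B ^ j) $ (n - k)"
          proof cases
            case 2
            then show ?thesis using 0 i(2) by (simp add: fps_power_zeroth power_0_left)
          next
            case 3
            then have "(A ^ j) $ (n - k) = (B ^ j) $ (n - k)"
              by (intro fps_power_nth_cong[of n]) (auto simp: less)
            then show ?thesis using less 3 by simp
          qed (use 0 in simp)
        qed
        then show ?thesis by (simp add: i)
      qed
      have split: "(F oo C) $ n = F $ 0 * (C ^ 0) $ n + (F $ 1 * C $ n + (\<Sum>i=2..n. F $ i * (C ^ i) $ n))" for C
        using False by (simp add: fps_compose_nth sum.atLeast_Suc_atMost numeral_2_eq_2)
      have "(\<Sum>i=2..n. F $ i * (A ^ i) $ n) = (\<Sum>i=2..n. F $ i * (B ^ i) $ n)"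
        using higher by (intro sum.cong refl) simp
      moreover have "(F oo A) $ n = (F oo B) $ n" using eq by simp
      ultimately have "F $ 1 * A $ n = F $ 1 * B $ n"
        unfolding split power_0 by (simp only: add_left_cancel add_right_cancel)
      then show ?thesis using F by simp
    qed
  qed
qed

lemma fps_compose_inverse_commute:
  fixes F X :: "'a::idom fps"
  assumes "F $ 1 \<noteq> 0" "F $ 0 = 0" "X $ 0 = 0" "F oo X = fps_X"
  shows "X oo F = fps_X"
proof (rule fps_compose_left_cancel[OF assms(1)])
  have "F oo (X oo F) = (F oo X) oo F" using assms by (intro fps_compose_assoc)
  also have "\<dots> = F oo fps_X" using assms by simp
  finally show "F oo (X oo F) = F oo fps_X" .
qed (use assms in simp_all)

section \<open>Quadratic operads are weight-graded\<close>

lemma leaves_tree_subst: "leaves (tree_subst f t) = concat (map (\<lambda>l. leaves (f l)) (leaves t))"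
proof (induction t)
  case (Node a ts)
  have "concat (map g (concat xss)) = concat (map (\<lambda>xs. concat (map g xs)) xss)" for g :: "nat \<Rightarrow> nat list" and xss
    by (induction xss) auto
  then show ?case using Node by (simp add: o_def cong: map_cong)
qed simp

lemma sum_list_map_concat: "sum_list (map f (concat xss)) = sum_list (map (\<lambda>xs. sum_list (map f xs)) xss)"
  by (induction xss) auto

lemma vertices_tree_subst:
  "vertices (tree_subst f t) = vertices t + sum_list (map (\<lambda>l. vertices (f l)) (leaves t))"
proof (induction t)
  case (Node a ts)
  have "sum_list (map (\<lambda>t. vertices (tree_subst f t)) ts) =
      sum_list (map (\<lambda>t. vertices t + sum_list (map (\<lambda>l. vertices (f l)) (leaves t))) ts)"
    using Node by (intro arg_cong[of _ _ sum_list] map_cong refl)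
  then show ?case by (simp add: o_def sum_list_addf sum_list_map_concat)
qed simp

lemma wf_tree_subst:
  "wf_tree M t \<Longrightarrow> (\<And>l. l \<in> set (leaves t) \<Longrightarrow> wf_tree M (f l)) \<Longrightarrow> wf_tree M (tree_subst f t)"
  by (induction t) auto

lemma leaves_relabel [simp]: "leaves (relabel g t) = map g (leaves t)"
  by (simp add: relabel_def leaves_tree_subst)

lemma vertices_relabel [simp]: "vertices (relabel g t) = vertices t"
  by (simp add: relabel_def vertices_tree_subst)

lemma wf_relabel: "wf_tree M t \<Longrightarrow> wf_tree M (relabel g t)"
  unfolding relabel_def by (rule wf_tree_subst) simp_all

lemma relabel_trees:
  assumes "t \<in> trees M n" "\<sigma> permutes {..<n}"
  shows "relabel \<sigma> t \<in> trees M n"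
proof -
  have "mset (map \<sigma> (leaves t)) = image_mset \<sigma> (mset_set {..<n})"
    using assms(1) by (simp add: trees_def lessThan_atLeast0)
  also have "\<dots> = mset_set {..<n}" by (rule permutes_image_mset[OF assms(2)])
  finally show ?thesis using assms(1) wf_relabel by (auto simp: trees_def lessThan_atLeast0)
qed

lemma vertices_graft_ge: "vertices t \<le> vertices (graft t ns ts)"
  by (simp add: graft_def vertices_tree_subst)

lemma vertices_graft:
  assumes "t \<in> trees M m" "length ts = m"
  shows "vertices (graft t ns ts) = vertices t + sum_list (map vertices ts)"
proof -
  have "sum_list (map (\<lambda>a. vertices (ts ! a)) (leaves t)) = sum_mset (image_mset (\<lambda>a. vertices (ts ! a)) (mset (leaves t)))"
    by (metis mset_map sum_mset_sum_list)
  also have "\<dots> = sum_list (map (\<lambda>a. vertices (ts ! a)) [0..<m])"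
    using assms(1) by (simp add: trees_def sum_mset_sum_list[symmetric] del: mset_upt)
  also have "map (\<lambda>a. vertices (ts ! a)) [0..<m] = map vertices ts"
    using assms(2) by (intro nth_equalityI) auto
  finally show ?thesis by (simp add: graft_def vertices_tree_subst)
qed

text \<open>
The shifted labels used by \<open>graft\<close> fill the interval \<open>{0..<sum_list ns}\<close> block by block.
\<close>

lemma concat_blocks: "concat (map (\<lambda>a. [offset ns a..<offset ns a + ns ! a]) [0..<length ns]) = [0..<sum_list ns]"
proof (induction ns rule: rev_induct)
  case (snoc n ns)
  have init: "map (\<lambda>a. [offset (ns @ [n]) a..<offset (ns @ [n]) a + (ns @ [n]) ! a]) [0..<length ns] =
      map (\<lambda>a. [offset ns a..<offset ns a + ns ! a]) [0..<length ns]"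
    by (intro map_cong refl) (auto simp: offset_def nth_append)
  have last: "offset (ns @ [n]) (length ns) = sum_list ns" by (simp add: offset_def)
  have "concat (map (\<lambda>a. [offset (ns @ [n]) a..<offset (ns @ [n]) a + (ns @ [n]) ! a]) [0..<length (ns @ [n])]) =
      [0..<sum_list ns] @ [sum_list ns..<sum_list ns + n]"
    by (simp add: init last snoc.IH)
  also have "\<dots> = [0..<sum_list ns + n]"
    using upt_add_eq_append[of 0 "sum_list ns" n] by simp
  finally show ?case by simp
qed simp

lemma graft_trees:
  assumes t: "t \<in> trees M (length ns)" and ts: "length ts = length ns"
    "\<And>a. a < length ns \<Longrightarrow> ts ! a \<in> trees M (ns ! a)"
  shows "graft t ns ts \<in> trees M (sum_list ns)"
proof -
  have set: "set (leaves t) = {..<length ns}"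
    using t mset_upt_iff[of "leaves t" "length ns"] by (simp add: trees_def)
  have "wf_tree M (graft t ns ts)"
    unfolding graft_def using t ts set by (intro wf_tree_subst wf_relabel) (auto simp: trees_def)
  moreover have "mset (leaves (graft t ns ts)) = mset [0..<sum_list ns]"
  proof -
    let ?g = "\<lambda>a. map (\<lambda>l. offset ns a + l) (leaves (ts ! a))"
    have "mset (leaves (graft t ns ts)) = (\<Sum>a\<in>#mset (leaves t). mset (?g a))"
      by (simp add: graft_def leaves_tree_subst mset_concat_map del: mset_map)
    also have "mset (leaves t) = mset [0..<length ns]" using t by (simp add: trees_def)
    also have "(\<Sum>a\<in>#mset [0..<length ns]. mset (?g a)) =
        (\<Sum>a\<in>#mset [0..<length ns]. mset [offset ns a..<offset ns a + ns ! a])"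
    proof (rule arg_cong[of _ _ sum_mset], rule image_mset_cong)
      fix a assume "a \<in># mset [0..<length ns]"
      then have "mset (leaves (ts ! a)) = mset [0..<ns ! a]" using ts(2) by (auto simp: trees_def)
      then have "mset (?g a) = image_mset ((+) (offset ns a)) (mset [0..<ns ! a])"
        by (simp add: image_mset.compositionality o_def del: mset_upt)
      also have "\<dots> = mset (map ((+) (offset ns a)) [0..<ns ! a])" by (simp only: mset_map)
      also have "map ((+) (offset ns a)) [0..<ns ! a] = [offset ns a..<offset ns a + ns ! a]"
        using map_add_upt[of "offset ns a" "ns ! a"] by (simp add: add.commute[of _ "offset ns a"] o_def)
      finally show "mset (?g a) = mset [offset ns a..<offset ns a + ns ! a]" .
    qed
    also have "\<dots> = mset (concat (map (\<lambda>a. [offset ns a..<offset ns a + ns ! a]) [0..<length ns]))"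
      by (rule mset_concat_map[symmetric])
    finally show ?thesis by (simp only: concat_blocks)
  qed
  ultimately show ?thesis by (simp add: trees_def)
qed

lemma keys_multilin:
  "u \<in> Poly_Mapping.keys (multilin f xs) \<Longrightarrow>
    \<exists>ss. list_all2 (\<lambda>s x. s \<in> Poly_Mapping.keys x) ss xs \<and> u \<in> Poly_Mapping.keys (f ss)"
proof (induction xs arbitrary: f)
  case (Cons x xs)
  then obtain s where s: "s \<in> Poly_Mapping.keys x" "u \<in> Poly_Mapping.keys (multilin (\<lambda>ss. f (s # ss)) xs)"
    by (auto dest!: subsetD[OF keys_lin])
  from Cons.IH[OF s(2)] obtain ss where "list_all2 (\<lambda>s x. s \<in> Poly_Mapping.keys x) ss xs"
    "u \<in> Poly_Mapping.keys (f (s # ss))" by blast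
  then show ?case using s(1) by (intro exI[of _ "s # ss"]) auto
qed simp

lemma multilin_cong:
  "(\<And>ss. list_all2 (\<lambda>s x. s \<in> Poly_Mapping.keys x) ss xs \<Longrightarrow> f ss = g ss) \<Longrightarrow> multilin f xs = multilin g xs"
proof (induction xs arbitrary: f g)
  case (Cons x xs)
  show ?case
    unfolding multilin.simps by (rule lin_cong, rule Cons.IH, rule Cons.prems) simp
qed simp

lemma multilin_scale: "multilin (\<lambda>ss. fscale c (f ss)) xs = fscale c (multilin f xs)"
  by (induction xs arbitrary: f) (simp_all add: lin_fun_scale)

lemma lin_multilin: "lin g (multilin f xs) = multilin (\<lambda>ss. lin g (f ss)) xs"
  by (induction xs arbitrary: f) (simp_all add: lin_lin)

text \<open>
  As an endomorphism of the free operad that preserves the relations, \<open>weight_scale\<close> preserves the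
  ideal they generate; since its eigenvalues are distinct in characteristic 0, this ideal is the sum
  of its homogeneous parts.
\<close>

definition weight_scale :: "('a tree \<Rightarrow>\<^sub>0 'k::field) \<Rightarrow> ('a tree \<Rightarrow>\<^sub>0 'k)" where
  "weight_scale x = lin (\<lambda>t. fscale (2 ^ vertices t) (basis_vec t)) x"

lemma weight_scale_homogeneous:
  assumes "\<And>t. t \<in> Poly_Mapping.keys x \<Longrightarrow> vertices t = d"
  shows "weight_scale x = fscale (2 ^ d) x"
proof -
  have "weight_scale x = lin (\<lambda>t. fscale (2 ^ d) (basis_vec t)) x"
    unfolding weight_scale_def using assms by (intro lin_cong) simp
  then show ?thesis by (simp add: lin_fun_scale)
qed

lemma keys_weight_scale: "Poly_Mapping.keys (weight_scale x) \<subseteq> Poly_Mapping.keys x"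
proof -
  have "weight_scale x \<in> {y. Poly_Mapping.keys y \<subseteq> Poly_Mapping.keys x}"
    unfolding weight_scale_def by (intro lin_in_subspace subspace_keys fs.subspace_scale) auto
  then show ?thesis by simp
qed

lemma weight_scale_add: "weight_scale (x + y) = weight_scale x + weight_scale y"
  and weight_scale_scale: "weight_scale (fscale c x) = fscale c (weight_scale x)"
  and weight_scale_sum: "weight_scale (\<Sum>i\<in>I. z i) = (\<Sum>i\<in>I. weight_scale (z i))"
  and weight_scale_zero [simp]: "weight_scale 0 = 0"
  and weight_scale_basis: "weight_scale (basis_vec t) = fscale (2 ^ vertices t) (basis_vec t)"
  by (simp_all add: weight_scale_def lin_add lin_scale lin_sum)

lemma multilin_weight_scale:
  "multilin f (map weight_scale xs) = multilin (\<lambda>ss. fscale (2 ^ sum_list (map vertices ss)) (f ss)) xs"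
proof (induction xs arbitrary: f)
  case (Cons x xs)
  have "lin g (weight_scale x) = lin (\<lambda>s. fscale (2 ^ vertices s) (g s)) x" for g
    unfolding weight_scale_def lin_lin by (simp add: lin_scale)
  then show ?case
    by (simp only: list.map multilin.simps Cons.IH sum_list.Cons power_add fs.scale_scale[symmetric] multilin_scale)
qed simp

lemma weight_scale_tree_rel:
  assumes "r \<in> tree_rel e M"
  shows "\<exists>v. weight_scale r = fscale (2 ^ v) r"
  using tree_rel_homogeneous[OF assms] weight_scale_homogeneous by blast

lemma weight_scale_null:
  assumes "x \<in> tree_null e M"
  shows "weight_scale x \<in> tree_null e M"
  unfolding weight_scale_def
proof (rule tree_null_lin[OF assms _ subspace_tree_null])
  fix r assume r: "r \<in> tree_rel e M"
  obtain v where "weight_scale r = fscale (2 ^ v) r" using weight_scale_tree_rel[OF r] by blast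
  then show "lin (\<lambda>t. fscale (2 ^ vertices t) (basis_vec t)) r \<in> tree_null e M"
    using fs.subspace_scale[OF subspace_tree_null tree_rel_null[OF r]] by (simp add: weight_scale_def)
qed

lemma tree_null_has_vertices: "x \<in> tree_null e M \<Longrightarrow> Poly_Mapping.keys x \<subseteq> {t. 0 < vertices t}"
proof -
  let ?S = "{x. Poly_Mapping.keys x \<subseteq> {t. 0 < vertices t}}"
  have "r \<in> ?S" if "r \<in> tree_rel e M" for r
    using that
  proof induction
    case (in_context r a us l vs)
    show ?case by (rule lin_in_subspace[OF subspace_keys]) auto
  qed (intro fs.subspace_diff fs.subspace_scale subspace_keys; auto)+
  then have "tree_rel e M \<subseteq> ?S" by blast
  then have "tree_null e M \<subseteq> ?S" unfolding tree_null_def by (rule fs.span_minimal[OF _ subspace_keys])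
  then show "x \<in> tree_null e M \<Longrightarrow> Poly_Mapping.keys x \<subseteq> {t. 0 < vertices t}" by blast
qed

context quadratic_operad
begin

abbreviation FV :: "('k, 'v tree \<Rightarrow>\<^sub>0 'k) operad_data" where "FV \<equiv> free_operad V"

lemma free_simps [simp]:
  "scl FV = fscale" "one FV = basis_vec (Leaf 0)"
  "act FV n x \<sigma> = lin (\<lambda>t. basis_vec (relabel (inv \<sigma>) t)) x"
  "cmp FV x ns ys = lin (\<lambda>t. multilin (\<lambda>ts. basis_vec (graft t ns ts)) ys) x"
  by (simp_all add: free_operad_def)

lemma car_free: "car FV n = {x. Poly_Mapping.keys x \<subseteq> trees V n}"
  by (simp add: free_operad_def span_basis_vec)

lemma free_weight: "free_operad_weight V d n = {x. Poly_Mapping.keys x \<subseteq> {t \<in> trees V n. vertices t = d}}"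
  by (simp add: free_operad_weight_def span_basis_vec)

lemma weight_car: "x \<in> free_operad_weight V d n \<Longrightarrow> x \<in> car FV n"
  by (auto simp: car_free free_weight)

abbreviation "W \<equiv> weight_part V \<pi>"

abbreviation "in_ideal \<equiv> operad_ideal FV (\<lambda>m. (car FV m \<inter> tree_null 0 V) \<union> R m)"

lemma keys_free_cmp:
  assumes "u \<in> Poly_Mapping.keys (cmp FV x ns ys)"
  obtains t ss where "t \<in> Poly_Mapping.keys x" "list_all2 (\<lambda>s y. s \<in> Poly_Mapping.keys y) ss ys"
    "u = graft t ns ss"
proof -
  from assms obtain t where t: "t \<in> Poly_Mapping.keys x"
    "u \<in> Poly_Mapping.keys (multilin (\<lambda>ts. basis_vec (graft t ns ts) :: _ \<Rightarrow>\<^sub>0 'k) ys)"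
    by (auto dest!: subsetD[OF keys_lin])
  from keys_multilin[OF t(2)] obtain ss where
    "list_all2 (\<lambda>s y. s \<in> Poly_Mapping.keys y) ss ys" "u = graft t ns ss" by auto
  then show thesis using that t(1) by blast
qed

lemma in_ideal_pos: "in_ideal n x \<Longrightarrow> 1 \<le> n"
proof (induction rule: operad_ideal.induct)
  case (outer ns x qs)
  then show ?case by (cases ns) (auto simp: inputs_def list_all2_Cons1)
next
  case (inner p ns qs a)
  then have "ns ! a \<le> sum_list ns" by (intro elem_le_sum_list) simp
  then show ?case using inner by simp
qed auto

lemma in_ideal_iff: "1 \<le> n \<Longrightarrow> in_ideal n x \<longleftrightarrow> x \<in> car FV n \<and> \<pi> x = 0"
  using proj_kernel[of n] by (auto simp: relation_ideal_def)

lemma in_ideal_car: "in_ideal n x \<Longrightarrow> x \<in> car FV n"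
  using in_ideal_pos in_ideal_iff by blast

lemma weight_scale_car: "x \<in> car FV n \<Longrightarrow> weight_scale x \<in> car FV n"
  using keys_weight_scale[of x] by (auto simp: car_free)

lemma inputs_weight_scale: "inputs FV ns qs \<Longrightarrow> inputs FV ns (map weight_scale qs)"
  using weight_scale_car by (auto simp: inputs_def list_all2_conv_all_nth)

lemma weight_scale_cmp:
  assumes x: "x \<in> car FV (length ns)" and qs: "inputs FV ns qs"
  shows "weight_scale (cmp FV x ns qs) = cmp FV (weight_scale x) ns (map weight_scale qs)"
proof -
  have len: "length qs = length ns" using qs by (simp add: inputs_def list_all2_lengthD)
  let ?m = "\<lambda>t f. multilin (\<lambda>ss. f ss (basis_vec (graft t ns ss) :: _ \<Rightarrow>\<^sub>0 'k)) qs"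
  have "weight_scale (cmp FV x ns qs) =
      lin (\<lambda>t. ?m t (\<lambda>ss. fscale (2 ^ vertices (graft t ns ss)))) x"
    by (simp add: weight_scale_def lin_lin lin_multilin)
  also have "\<dots> = lin (\<lambda>t. fscale (2 ^ vertices t) (?m t (\<lambda>ss. fscale (2 ^ sum_list (map vertices ss))))) x"
  proof (rule lin_cong)
    fix t assume t: "t \<in> Poly_Mapping.keys x"
    have "?m t (\<lambda>ss. fscale (2 ^ vertices (graft t ns ss))) =
        ?m t (\<lambda>ss y. fscale (2 ^ vertices t) (fscale (2 ^ sum_list (map vertices ss)) y))"
    proof (rule multilin_cong)
      fix ss assume "list_all2 (\<lambda>s x. s \<in> Poly_Mapping.keys x) ss qs"
      then have "length ss = length ns" using len by (simp add: list_all2_lengthD)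
      moreover have "t \<in> trees V (length ns)" using x t by (auto simp: car_free)
      ultimately show "fscale (2 ^ vertices (graft t ns ss)) (basis_vec (graft t ns ss) :: _ \<Rightarrow>\<^sub>0 'k) =
          fscale (2 ^ vertices t) (fscale (2 ^ sum_list (map vertices ss)) (basis_vec (graft t ns ss)))"
        by (simp add: vertices_graft power_add)
    qed
    then show "?m t (\<lambda>ss. fscale (2 ^ vertices (graft t ns ss))) =
        fscale (2 ^ vertices t) (?m t (\<lambda>ss. fscale (2 ^ sum_list (map vertices ss))))"
      by (simp only: multilin_scale)
  qed
  also have "\<dots> = cmp FV (weight_scale x) ns (map weight_scale qs)"
    by (simp add: weight_scale_def[of x] lin_lin lin_scale multilin_weight_scale)
  finally show ?thesis .
qed

lemma weight_scale_in_ideal: "in_ideal n x \<Longrightarrow> in_ideal n (weight_scale x)"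
proof (induction rule: operad_ideal.induct)
  case (gen n x)
  show ?case
  proof (cases "x \<in> R n")
    case True
    then have "x \<in> free_operad_weight V 2 n" using relations gen(1) by blast
    then have eq: "weight_scale x = fscale (2 ^ 2) x"
      by (intro weight_scale_homogeneous) (auto simp: free_weight)
    have "in_ideal n x" using True gen by (intro operad_ideal.gen) auto
    then have "in_ideal n (scl FV (2 ^ 2) x + 0)"
      using gen(1) by (intro operad_ideal.lin operad_ideal.zero)
    then show ?thesis unfolding eq by simp
  next
    case False
    then have "x \<in> car FV n" "x \<in> tree_null 0 V" using gen by auto
    then show ?thesis
      using weight_scale_car weight_scale_null gen(1) by (intro operad_ideal.gen) blast+
  qed
next
  case (zero n)
  then show ?case by (simp add: operad_ideal.zero)
next
  case (lin n x y c)
  then have "in_ideal n (scl FV c (weight_scale x) + weight_scale y)" by (intro operad_ideal.lin)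
  then show ?case by (simp add: weight_scale_add weight_scale_scale)
next
  case (act n x \<sigma>)
  have "weight_scale (act FV n x \<sigma>) = act FV n (weight_scale x) \<sigma>"
    by (simp add: weight_scale_def lin_lin lin_scale)
  then show ?case using operad_ideal.act[OF act.IH act.hyps(2)] by simp
next
  case (outer ns x qs)
  show ?case
    unfolding weight_scale_cmp[OF in_ideal_car[OF outer.hyps(1)] outer.hyps(2)]
    by (rule operad_ideal.outer[OF outer.IH inputs_weight_scale[OF outer.hyps(2)]])
next
  case (inner p ns qs a)
  have "length qs = length ns" using inner by (simp add: inputs_def list_all2_lengthD)
  then show ?case
    unfolding weight_scale_cmp[OF inner.hyps(1,2)]
    using inner by (intro operad_ideal.inner[of _ _ _ _ a] weight_scale_car inputs_weight_scale) auto
qed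

text \<open>
  The generators are supported on trees with at least one vertex, and grafting never decreases the
  number of vertices. Hence the unit of \<open>P\<close> does not vanish.
\<close>

lemma in_ideal_has_vertices: "in_ideal n x \<Longrightarrow> Poly_Mapping.keys x \<subseteq> {t. 0 < vertices t}"
proof (induction rule: operad_ideal.induct)
  case (gen n x)
  show ?case
  proof (cases "x \<in> R n")
    case True
    then have "x \<in> free_operad_weight V 2 n" using relations gen(1) by blast
    then show ?thesis by (auto simp: free_weight)
  next
    case False
    then show ?thesis using gen tree_null_has_vertices by blast
  qed
next
  case (lin n x y c)
  then have "fscale c x + y \<in> {x. Poly_Mapping.keys x \<subseteq> {t. 0 < vertices t}}"
    by (intro fs.subspace_add fs.subspace_scale subspace_keys) simp_all
  then show ?case by simp
next
  case (act n x \<sigma>)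
  then have "lin (\<lambda>t. basis_vec (relabel (inv \<sigma>) t)) x \<in> {x. Poly_Mapping.keys x \<subseteq> {t. 0 < vertices t}}"
    by (intro lin_in_subspace subspace_keys) auto
  then show ?case by simp
next
  case (outer ns x qs)
  show ?case
  proof
    fix u assume "u \<in> Poly_Mapping.keys (cmp FV x ns qs)"
    then obtain t ss where "t \<in> Poly_Mapping.keys x" "u = graft t ns ss" by (rule keys_free_cmp)
    then show "u \<in> {t. 0 < vertices t}" using outer.IH vertices_graft_ge[of t ns ss] by force
  qed
next
  case (inner p ns qs a)
  show ?case
  proof
    fix u assume "u \<in> Poly_Mapping.keys (cmp FV p ns qs)"
    then obtain t ss where t: "t \<in> Poly_Mapping.keys p" and u: "u = graft t ns ss"
      and ss: "list_all2 (\<lambda>s y. s \<in> Poly_Mapping.keys y) ss qs" by (rule keys_free_cmp)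
    have len: "length ss = length ns"
      using ss inner.hyps(2) by (simp add: inputs_def list_all2_lengthD)
    have "ss ! a \<in> Poly_Mapping.keys (qs ! a)"
      using ss inner.hyps(3) len by (auto simp: list_all2_conv_all_nth)
    then have "0 < vertices (ss ! a)" using inner.IH by auto
    moreover have "vertices (ss ! a) \<le> sum_list (map vertices ss)"
      using elem_le_sum_list[of a "map vertices ss"] inner.hyps(3) len by simp
    ultimately show "u \<in> {t. 0 < vertices t}"
      using vertices_graft[of t V "length ns" ss ns] t inner.hyps(1) len u by (auto simp: car_free)
  qed
qed (auto simp: free_operad_def)

lemma proj_zero: "1 \<le> (n :: nat) \<Longrightarrow> \<pi> 0 = 0"
  using in_ideal_iff[of n 0] operad_ideal.zero[of n FV] by simp

lemma proj_add: "1 \<le> n \<Longrightarrow> x \<in> car FV n \<Longrightarrow> y \<in> car FV n \<Longrightarrow> \<pi> (x + y) = \<pi> x + \<pi> y"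
  using proj_linear[of n x y 1] by simp

lemma proj_scale: "1 \<le> n \<Longrightarrow> x \<in> car FV n \<Longrightarrow> \<pi> (fscale c x) = scl P c (\<pi> x)"
  using proj_linear[of n x 0 c] proj_zero[of n] by (simp add: car_free)

lemma proj_sum:
  assumes "1 \<le> n" "\<And>i. i \<in> I \<Longrightarrow> x i \<in> car FV n"
  shows "\<pi> (\<Sum>i\<in>I. x i) = (\<Sum>i\<in>I. \<pi> (x i))"
  using assms(2)
proof (induction I rule: infinite_finite_induct)
  case (insert i I)
  have "(\<Sum>i\<in>I. x i) \<in> car FV n"
    unfolding car_free using insert.prems by (intro fs.subspace_sum subspace_keys) (auto simp: car_free)
  then show ?case using insert proj_add[OF assms(1)] by simp
qed (simp_all add: proj_zero[OF assms(1)])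

lemma W_subspace: "1 \<le> n \<Longrightarrow> vs.subspace (W d n)"
proof (rule vs.subspaceI)
  assume n: "1 \<le> n"
  have S: "fs.subspace (free_operad_weight V d n)" by (simp add: free_operad_weight_def)
  show "0 \<in> W d n"
    unfolding weight_part_def using proj_zero[OF n] fs.subspace_0[OF S] by (metis imageI)
  show "x + y \<in> W d n" if "x \<in> W d n" "y \<in> W d n" for x y
  proof -
    obtain a b where a: "a \<in> free_operad_weight V d n" "x = \<pi> a"
      and b: "b \<in> free_operad_weight V d n" "y = \<pi> b"
      using \<open>x \<in> W d n\<close> \<open>y \<in> W d n\<close> by (auto simp: weight_part_def)
    have "x + y = \<pi> (a + b)" using proj_add[OF n weight_car[OF a(1)] weight_car[OF b(1)]] a b by simp
    then show ?thesis unfolding weight_part_def using fs.subspace_add[OF S a(1) b(1)] by blast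
  qed
  show "scl P c x \<in> W d n" if "x \<in> W d n" for c x
  proof -
    obtain a where a: "a \<in> free_operad_weight V d n" "x = \<pi> a"
      using \<open>x \<in> W d n\<close> by (auto simp: weight_part_def)
    have "scl P c x = \<pi> (fscale c a)" using proj_scale[OF n weight_car[OF a(1)]] a by simp
    then show ?thesis unfolding weight_part_def using fs.subspace_scale[OF S a(1)] by blast
  qed
qed

lemma W_subset: "1 \<le> n \<Longrightarrow> W d n \<subseteq> car P n"
  unfolding weight_part_def using proj_onto weight_car by blast

lemma W_act:
  assumes n: "1 \<le> n" and x: "x \<in> W d n" and \<sigma>: "\<sigma> permutes {..<n}"
  shows "act P n x \<sigma> \<in> W d n"
proof -
  obtain y where y: "y \<in> free_operad_weight V d n" "x = \<pi> y" using x by (auto simp: weight_part_def)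
  have "lin (\<lambda>t. basis_vec (relabel (inv \<sigma>) t)) y \<in> free_operad_weight V d n"
    using y(1) relabel_trees[OF _ permutes_inv[OF \<sigma>]] unfolding free_weight
    by (intro lin_in_subspace subspace_keys) auto
  then have "act FV n y \<sigma> \<in> free_operad_weight V d n" by simp
  then show ?thesis
    using proj_act[OF n weight_car[OF y(1)] \<sigma>] y(2) unfolding weight_part_def by (metis imageI)
qed

lemma W_partial_cmp:
  assumes i: "i < m" and n: "1 \<le> n" and p: "p \<in> W d m" and q: "q \<in> W d' n"
  shows "partial_cmp P p m i q n \<in> W (d + d') (m + n - 1)"
proof -
  obtain x where x: "x \<in> free_operad_weight V d m" "p = \<pi> x" using p by (auto simp: weight_part_def)
  obtain y where y: "y \<in> free_operad_weight V d' n" "q = \<pi> y" using q by (auto simp: weight_part_def)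
  let ?ns = "(replicate m 1)[i := n]" and ?ys = "(replicate m (basis_vec (Leaf 0)))[i := y]"
  have unit: "basis_vec (Leaf 0) \<in> car FV 1" by (simp add: car_free trees_def)
  have inp: "inputs FV ?ns ?ys"
    unfolding inputs_def using unit n weight_car[OF y(1)]
    by (intro list_all2_update_cong list_all2_replicateI) auto
  have "map \<pi> ?ys = (replicate m (one P))[i := q]"
    using proj_one y(2) by (simp add: map_update)
  then have eq: "partial_cmp P p m i q n = \<pi> (cmp FV x ?ns ?ys)"
    using proj_cmp[of ?ns x ?ys] i inp weight_car[OF x(1)] x(2) by (auto simp: partial_cmp_def)
  have "cmp FV x ?ns ?ys \<in> free_operad_weight V (d + d') (m + n - 1)"
    unfolding free_weight
  proof (rule CollectI, rule subsetI)
    fix u assume "u \<in> Poly_Mapping.keys (cmp FV x ?ns ?ys)"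
    then obtain t ss where t: "t \<in> Poly_Mapping.keys x" and u: "u = graft t ?ns ss"
      and ss: "list_all2 (\<lambda>s y. s \<in> Poly_Mapping.keys y) ss ?ys" by (rule keys_free_cmp)
    have len: "length ss = m" using ss by (simp add: list_all2_lengthD)
    have si: "ss ! a \<in> (if a = i then Poly_Mapping.keys y else {Leaf 0})" if "a < m" for a
      using list_all2_nthD[OF ss, of a] that len i by (auto simp: nth_list_update split: if_splits)
    have tt: "t \<in> trees V m" "vertices t = d" using t x(1) by (auto simp: free_weight)
    have si': "ss ! a \<in> trees V (?ns ! a)" "vertices (ss ! a) = (if a = i then d' else 0)" if "a < m" for a
      using si[OF that] y(1) that by (auto simp: free_weight trees_def nth_list_update split: if_splits)
    have "u \<in> trees V (sum_list ?ns)"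
      unfolding u using tt si' len by (intro graft_trees) auto
    moreover have "vertices u = d + sum_list (map vertices ss)"
      unfolding u using vertices_graft[OF tt(1) len] tt by simp
    moreover have "map vertices ss = (replicate m 0)[i := d']"
      using si'(2) len by (intro nth_equalityI) (auto simp: nth_list_update)
    moreover have "sum_list ?ns = m + n - 1" using sum_list_replicate_update[OF i n] by simp
    moreover have "sum_list ((replicate m 0)[i := d']) = d'"
      using i by (simp add: sum_list_update sum_list_replicate)
    ultimately show "u \<in> {t \<in> trees V (m + n - 1). vertices t = d + d'}" by simp
  qed
  then show ?thesis unfolding eq weight_part_def by blast
qed

lemma dim_W_0:
  assumes n: "1 \<le> n"
  shows "vs.dim (W 0 n) = of_bool (n = 1)"
proof (cases "n = 1")
  case True
  have "{t \<in> trees V 1. vertices t = 0} = {Leaf 0}"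
  proof (intro equalityI subsetI)
    fix t assume "t \<in> {t \<in> trees V 1. vertices t = 0}"
    then show "t \<in> {Leaf 0}" by (cases t) (auto simp: trees_def)
  qed (auto simp: trees_def)
  then have "free_operad_weight V 0 1 = fs.span {basis_vec (Leaf 0)}"
    by (simp add: free_operad_weight_def)
  also have "\<dots> = range (\<lambda>c. fscale c (basis_vec (Leaf 0)))" by (rule fs.span_singleton)
  finally have "W 0 1 = range (\<lambda>c. \<pi> (fscale c (basis_vec (Leaf 0))))"
    unfolding weight_part_def by auto
  also have "\<dots> = range (\<lambda>c. scl P c (one P))"
  proof -
    have "basis_vec (Leaf 0) \<in> car FV 1" by (simp add: car_free trees_def)
    then have "\<pi> (fscale c (basis_vec (Leaf 0))) = scl P c (one P)" for c
      using proj_scale[of 1] proj_one by simp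
    then show ?thesis by simp
  qed
  also have "\<dots> = vs.span {one P}" by (rule vs.span_singleton[symmetric])
  finally have W: "W 0 1 = vs.span {one P}" .
  have "one P \<noteq> 0"
  proof
    assume "one P = 0"
    then have "in_ideal 1 (basis_vec (Leaf 0))"
      using in_ideal_iff[of 1 "basis_vec (Leaf 0)"] proj_one by (simp add: car_free trees_def)
    from in_ideal_has_vertices[OF this] show False by simp
  qed
  then have "vs.dim (vs.span {one P}) = card {one P}"
    by (intro vs.dim_span_eq_card_independent) simp
  then show ?thesis using True W by simp
next
  case False
  have none: "{t \<in> trees V n. vertices t = 0} = {}"
  proof (intro equalityI subsetI)
    fix t assume t: "t \<in> {t \<in> trees V n. vertices t = 0}"
    then obtain l where "t = Leaf l" by (cases t) auto
    then have "size (mset [l]) = size (mset [0..<n])" using t unfolding trees_def by (metis (mono_tags, lifting) leaves.simps(1) mem_Collect_eq)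
    then show "t \<in> {}" using False by simp
  qed simp
  then have "W 0 n = {0}"
    unfolding weight_part_def free_operad_weight_def none using proj_zero[OF n] by simp
  then show ?thesis using vs.dim_le_card[of "{0}" "{}"] False by simp
qed

end

text \<open>
  Applying \<open>weight_scale - 2 ^ m\<close> removes the part of weight \<open>m\<close> and multiplies the others by nonzero
  scalars, so the parts can be separated by induction on their number.
\<close>

lemma homogeneous_parts_in_ideal:
  fixes P :: "('k::field_char_0, 'p::ab_group_add) operad_data"
    and V :: "('k, 'v::ab_group_add) smod"
  assumes quad: "quadratic_operad P V R \<pi>"
  defines "I \<equiv> operad_ideal (free_operad V) (\<lambda>m. (car (free_operad V) m \<inter> tree_null 0 V) \<union> R m)"
  assumes n: "1 \<le> n"
  shows "finite D \<Longrightarrow> (\<And>d. d \<in> D \<Longrightarrow> x d \<in> free_operad_weight V d n) \<Longrightarrow> I n (\<Sum>d\<in>D. x d) \<Longrightarrow> d \<in> D \<Longrightarrow> I n (x d)"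
proof -
  interpret quadratic_operad P V R \<pi> by (rule quad)
  have lin: "I n (fscale c y + z)" if "I n y" "I n z" for c y z
    using operad_ideal.lin[of FV _ n y z c] that unfolding I_def by simp
  have zero: "I n 0" unfolding I_def using n by (rule operad_ideal.zero)
  have scale: "I n (fscale c y)" if "I n y" for c y using lin[OF that zero, of c] by simp
  have diff: "I n (y - z)" if "I n y" "I n z" for y z using lin[OF that(2,1), of "-1"] by simp
  have sum: "I n (\<Sum>i\<in>J. y i)" if "\<And>i. i \<in> J \<Longrightarrow> I n (y i)" for J :: "nat set" and y
    using that
  proof (induction J rule: infinite_finite_induct)
    case (insert i J)
    then show ?case using lin[of "y i" "\<Sum>i\<in>J. y i" 1] by simp
  qed (simp_all add: zero)
  have homogeneous: "weight_scale y = fscale (2 ^ d) y" if "y \<in> free_operad_weight V d n" for y d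
    using that by (intro weight_scale_homogeneous) (auto simp: free_weight)
  have "\<forall>x. (\<forall>d\<in>D. x d \<in> free_operad_weight V d n) \<longrightarrow> I n (\<Sum>d\<in>D. x d) \<longrightarrow> (\<forall>d\<in>D. I n (x d))"
    if "finite D" for D
    using that
  proof (induction D)
    case (insert m D)
    show ?case
    proof (intro allI impI)
      fix x assume x: "\<forall>d\<in>insert m D. x d \<in> free_operad_weight V d n" and I: "I n (\<Sum>d\<in>insert m D. x d)"
      let ?y = "\<Sum>d\<in>insert m D. x d" and ?c = "\<lambda>d. (2 :: 'k) ^ d - 2 ^ m"
      have "weight_scale ?y - fscale (2 ^ m) ?y = (\<Sum>d\<in>insert m D. fscale (?c d) (x d))"
        unfolding weight_scale_sum fs.scale_sum_right sum_subtractf[symmetric]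
      proof (rule sum.cong[OF refl])
        fix d assume "d \<in> insert m D"
        then have "weight_scale (x d) = fscale (2 ^ d) (x d)" using x by (intro homogeneous) auto
        then show "weight_scale (x d) - fscale (2 ^ m) (x d) = fscale (?c d) (x d)"
          by (simp add: fs.scale_left_diff_distrib)
      qed
      also have "\<dots> = (\<Sum>d\<in>D. fscale (?c d) (x d))" using insert.hyps by simp
      finally have eq: "weight_scale ?y - fscale (2 ^ m) ?y = (\<Sum>d\<in>D. fscale (?c d) (x d))" .
      have "I n (weight_scale ?y)" using I unfolding I_def by (rule weight_scale_in_ideal)
      from diff[OF this scale[OF I, of "2 ^ m"]] have "I n (\<Sum>d\<in>D. fscale (?c d) (x d))"
        unfolding eq .
      moreover have "\<forall>d\<in>D. fscale (?c d) (x d) \<in> free_operad_weight V d n"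
        using x unfolding free_operad_weight_def by (auto intro: fs.span_scale)
      ultimately have Ic: "\<forall>d\<in>D. I n (fscale (?c d) (x d))"
        using insert.IH[THEN spec, of "\<lambda>d. fscale (?c d) (x d)"] by blast
      have ID: "I n (x d)" if d: "d \<in> D" for d
      proof -
        have "d \<noteq> m" using d insert.hyps by auto
        then have "(2 :: nat) ^ d \<noteq> 2 ^ m" by simp
        then have "of_nat (2 ^ d) \<noteq> (of_nat (2 ^ m) :: 'k)" by (simp only: of_nat_eq_iff not_False_eq_True)
        then have "?c d \<noteq> 0" by simp
        then have "x d = fscale (inverse (?c d)) (fscale (?c d) (x d))" by simp
        moreover have "I n (fscale (inverse (?c d)) (fscale (?c d) (x d)))" using scale Ic d by blast
        ultimately show ?thesis by (rule ssubst)
      qed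
      have "x m = ?y - (\<Sum>d\<in>D. x d)" using insert.hyps by simp
      have "I n (?y - (\<Sum>d\<in>D. x d))" by (rule diff[OF I sum[OF ID]])
      then have "I n (x m)" by (simp only: \<open>x m = ?y - (\<Sum>d\<in>D. x d)\<close>[symmetric])
      with ID show "\<forall>d\<in>insert m D. I n (x d)" by blast
    qed
  qed simp
  then show "finite D \<Longrightarrow> (\<And>d. d \<in> D \<Longrightarrow> x d \<in> free_operad_weight V d n) \<Longrightarrow> I n (\<Sum>d\<in>D. x d) \<Longrightarrow> d \<in> D \<Longrightarrow> I n (x d)"
    by blast
qed

lemma quadratic_weighted_operad:
  fixes P :: "('k::field_char_0, 'p::ab_group_add) operad_data"
    and V :: "('k, 'v::ab_group_add) smod"
  assumes quad: "quadratic_operad P V R \<pi>"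
    and fin: "\<And>d n. 1 \<le> n \<Longrightarrow> fin_dim (scl P) (weight_part V \<pi> d n)"
  shows "weighted_operad P (weight_part V \<pi>)"
proof -
  interpret quadratic_operad P V R \<pi> by (rule quad)
  show ?thesis
  proof unfold_locales
    show "w d = 0" if n: "1 \<le> n" and D: "finite D" "\<And>d. d \<in> D \<Longrightarrow> w d \<in> W d n"
      and sum: "(\<Sum>d\<in>D. w d) = 0" and d: "d \<in> D" for n D w d
    proof -
      have "\<forall>d\<in>D. \<exists>y. y \<in> free_operad_weight V d n \<and> w d = \<pi> y"
        using D(2) by (auto simp: weight_part_def)
      then obtain x where x: "\<And>d. d \<in> D \<Longrightarrow> x d \<in> free_operad_weight V d n" "\<And>d. d \<in> D \<Longrightarrow> w d = \<pi> (x d)"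
        by metis
      have car: "\<And>d. d \<in> D \<Longrightarrow> x d \<in> car FV n" using x(1) weight_car by blast
      have "(\<Sum>d\<in>D. x d) \<in> car FV n"
        unfolding car_free using car by (intro fs.subspace_sum subspace_keys) (auto simp: car_free)
      moreover have "\<pi> (\<Sum>d\<in>D. x d) = 0"
      proof -
        have "\<pi> (\<Sum>d\<in>D. x d) = (\<Sum>d\<in>D. \<pi> (x d))" by (rule proj_sum[OF n car])
        also have "\<dots> = (\<Sum>d\<in>D. w d)" by (rule sum.cong[OF refl]) (simp add: x(2))
        finally show ?thesis using sum by simp
      qed
      ultimately have I: "in_ideal n (\<Sum>d\<in>D. x d)" using in_ideal_iff[OF n] by blast
      have "in_ideal n (x d)"
      proof (rule homogeneous_parts_in_ideal[where x = x and D = D, OF quad n D(1)])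
        show "x d \<in> free_operad_weight V d n" if "d \<in> D" for d using that by (rule x(1))
      qed (fact I d)+
      then show "w d = 0" using in_ideal_iff[OF n] x(2)[OF d] by simp
    qed
  qed (use W_subspace W_subset W_act W_partial_cmp fin in \<open>auto\<close>)
qed

theorem proposition168:
  fixes P :: "('k::field_char_0, 'p::ab_group_add) operad_data"
    and V :: "('k, 'v::ab_group_add) smod"
    and R :: "nat \<Rightarrow> ('v tree \<Rightarrow>\<^sub>0 'k) set"
    and \<pi> :: "('v tree \<Rightarrow>\<^sub>0 'k) \<Rightarrow> 'p"
  assumes "quadratic_operad P V R \<pi>"
    and "koszul P (weight_part V \<pi>)"
    and "\<And>d n. 1 \<le> n \<Longrightarrow> fin_dim (scl P) (weight_part V \<pi> d n)"
    and "\<And>d n. 1 \<le> n \<Longrightarrow>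
          fin_dim_mod fscale (bar_null P (weight_part V \<pi>)) (koszul_dual P (weight_part V \<pi>) d n)"
  shows "negate_y (poincare_koszul_dual P (weight_part V \<pi>))
             oo poincare_operad P (weight_part V \<pi>) = fps_X \<and>
         negate_y (poincare_operad P (weight_part V \<pi>))
             oo poincare_koszul_dual P (weight_part V \<pi>) = fps_X"
proof -
  interpret quadratic_operad P V R \<pi> by (rule assms(1))
  interpret w: weighted_operad P "weight_part V \<pi>"
    by (rule quadratic_weighted_operad[OF assms(1,3)])
  let ?F = "poincare_operad P (weight_part V \<pi>)"
  let ?K = "poincare_koszul_dual P (weight_part V \<pi>)"
  have FK: "?F oo negate_y ?K = fps_X"
    using w.poincare_operad_tree_series[OF dim_W_0] w.tree_series_koszul_dual[OF assms(2)] by simp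
  have "?F $ 1 $ 0 = 1"
    using dim_W_0[of 1] by (simp add: poincare_operad_def poincare_series_def)
  then have F1: "?F $ 1 \<noteq> 0" by auto
  have 0: "?F $ 0 = 0" "negate_y ?K $ 0 = 0"
    by (simp_all add: poincare_operad_def poincare_koszul_dual_def poincare_series_def negate_y_def)
  have "negate_y ?K oo ?F = fps_X" by (rule fps_compose_inverse_commute[OF F1 0 FK])
  moreover have "negate_y ?F oo ?K = fps_X"
    using arg_cong[OF FK, of negate_y] by (simp only: negate_y_compose negate_y_negate_y negate_y_fps_X)
  ultimately show ?thesis ..
qed

end
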